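(* Let $x\in\Bbbk-\{0\}$, let $s$ be a nonnegative integer, $r$ a positive integer, and $a\in\Bbbk-\{0\}$. Let $f\in R^{\circ}_r(z_x)$ with $f=az_x^{-s/r}+\underline{o}(z_x^{-s/r})$, and suppose that $E_f$ has no horizontal sections. Then $$\mathcal{M}^{(x,\infty)}(E_f)\simeq D_g,$$ where $g\in S^{\circ}_{r+s}(\theta)$ is determined by the following system of equations: $$f=-\left(\frac{z_x}{z}\right)\theta^{-1},$$ $$g=z+\left(\frac{xs}{2(s+r)}\right)\theta.$$
   Context: $\Bbbk$ is an algebraically closed field of characteristic zero. The notation $\underline{o}(z_x^{k})$ denotes a series all of whose terms have order $>k$. **Connections at $x$.** Let $x\in\Bbbk-\{0\}$, $z_x=z-x$ (so $z=x+z_x$), and $K=\Bbbk((z_x))$. Objects of $\mathcal{C}_x$ are pairs $(V,\nabla)$, $V$ a finite-dimensional $K$-vector space, $\nabla:V\to V$ a $\Bbbk$-linear map with $\nabla(hv)=h\nabla(v)+\frac{dh}{dz_x}v$ for $h\in K$; morphisms are $K$-linear maps commuting with the $\nabla$'s. A horizontal section is a nonzero $v$ with $\nabla v=0$. For $q\ge1$ let $K_q=\Bbbk((z_x^{1/q}))$; for $f\in K_q$ set $E_f=(K_q,\frac{d}{dz_x}+z_x^{-1}f)$, viewed over $K$. Let $R_q=R_q(z_x)$ be the set of orbits of $\mathrm{Gal}(K_q/K)$ (acting by $z_x^{1/q}\mapsto\eta z_x^{1/q}$, $\eta^q=1$) on $K_q/\left(z_x^{1/q}\Bbbk[[z_x^{1/q}]]+\frac{\mathbb{Z}}{q}\right)$,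 and let $R_q^\circ\subset R_q$ be the set of those classes that cannot be represented by elements of $K_{q'}$ for any $0<q'<q$. The isomorphism class of $E_f$ depends only on the class of $f$ in $R_q$, and $f\in R_q^\circ$ is identified with a representative in $K_q$. **Difference operators.** Over $\Bbbk((\theta))$, let $\varphi$ be the $\Bbbk$-automorphism $\varphi(v(\theta))=v\left(\frac{\theta}{1+\theta}\right)$, extended to $\Bbbk((\theta^{1/q}))$ by $\varphi(v(\theta^{1/q}))=v\left(\theta^{1/q}\sum_{i\ge0}\binom{-1/q}{i}\theta^i\right)$. Objects of $\mathcal{N}$ are pairs $(V,\Phi)$, $V$ a finite-dimensional $\Bbbk((\theta))$-vector space and $\Phi:V\to V$ an invertible $\Bbbk$-linear map with $\Phi(hv)=\varphi(h)\Phi(v)$ for all $h\in\Bbbk((\theta))$; morphisms are $\Bbbk((\theta))$-linear maps commuting with the $\Phi$'s. For $g\in\Bbbk((\theta^{1/q}))^*$ set $D_g=(\Bbbk((\theta^{1/q})),g\varphi)$, viewed over $\Bbbk((\theta))$. Let $S_q=S_q(\theta)$ be the set of orbits of $\mathrm{Gal}(\Bbbk((\theta^{1/q}))/\Bbbk((\theta)))$ on the multiplicative quotient $\Bbbk((\theta^{1/q}))^*/\left(1+\frac{\mathbb{Z}}{q}\theta+\theta^{1+(1/q)}\Bbbk[[\theta^{1/q}]]\right)$, and $S_q^\circ\subset S_q$ the set of classes that cannot be represented by elements of $\Bbbk((\theta^{1/q'}))^*$ for any $0<q'<q$. The isomorphism class of $D_g$ depends only on the class of $g$ in $S_q$. **Local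 Mellin transform.** For $E=(V,\nabla)\in\mathcal{C}_x$ with no horizontal sections put $\theta:=-(z\nabla)^{-1}:V\to V$ and $\Phi:=z=x+z_x:V\to V$. Then $\theta$ extends to an action of $\Bbbk((\theta))$ on $V$ (compatible with the topology: the $\theta$-adic topology on $V$ coincides with the $z_x$-adic topology), $V$ is finite-dimensional over $\Bbbk((\theta))$ (written $V_\theta$), $\Phi$ is an invertible difference operator, and $\mathcal{M}^{(x,\infty)}(E):=(V_\theta,\Phi)\in\mathcal{N}$. **How the system determines $g$.** In the system $z=x+z_x$ and $\theta$ are commuting formal variables. The first equation is solved explicitly for $z_x$ (hence $z$) as an element of $\Bbbk((\theta^{1/(r+s)}))$, and this is substituted into the second equation to give $g\in\Bbbk((\theta^{1/(r+s)}))$. Different choices of roots (replacing $\theta^{1/(r+s)}$ by $\eta\theta^{1/(r+s)}$, $\eta^{r+s}=1$) give the same Galois orbit. *)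

theory Defs
  imports "HOL-Computational_Algebra.Computational_Algebra"
begin

text \<open>
  The field \<open>k\<close> is a type of class \<open>alg_closed_field\<close> and \<open>field_char_0\<close>. For \<open>q \<ge> 1\<close> the field
  \<open>k((z\<^sup>1\<^sup>/\<^sup>q))\<close> is represented by the type \<open>'a fls\<close> whose indeterminate is \<open>z\<^sup>1\<^sup>/\<^sup>q\<close>; it is an
  extension of \<open>k((z))\<close> through \<open>h(z) \<mapsto> h((z\<^sup>1\<^sup>/\<^sup>q)\<^sup>q)\<close>, i.e. \<open>\<lambda>h. fls_compose_power h q\<close>.
  Orders and exponents are counted in the indeterminate \<open>z\<^sup>1\<^sup>/\<^sup>q\<close>, so \<open>z\<^sup>i\<^sup>/\<^sup>q\<close> is \<open>fls_X_intpow i\<close>.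
\<close>

subsection \<open>Ramified Laurent series fields and the Galois action\<close>

text \<open>The automorphism \<open>z\<^sup>1\<^sup>/\<^sup>q \<mapsto> \<eta> z\<^sup>1\<^sup>/\<^sup>q\<close>, for \<open>\<eta>\<^sup>q = 1\<close>.\<close>
definition galois_act :: "'a::field \<Rightarrow> 'a fls \<Rightarrow> 'a fls" where
  "galois_act \<eta> h = fls_compose_fps h (fps_const \<eta> * fps_X)"

text \<open>\<open>little_o k h\<close>: all terms of \<open>h\<close> have order greater than \<open>k\<close>.\<close>
definition little_o :: "int \<Rightarrow> 'a::zero fls \<Rightarrow> bool" where
  "little_o k h \<longleftrightarrow> (\<forall>n. fls_nth h n \<noteq> 0 \<longrightarrow> n > k)"

text \<open>
  \<open>h \<in> k((z\<^sup>1\<^sup>/\<^sup>q))\<close> belongs to \<open>k((z\<^sup>1\<^sup>/\<^sup>p))\<close>; the two fields are compared inside \<open>k((z\<^sup>1\<^sup>/\<^sup>(\<^sup>p\<^sup>q\<^sup>)))\<close>.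
\<close>
definition in_ramified :: "nat \<Rightarrow> nat \<Rightarrow> 'a::zero fls \<Rightarrow> bool" where
  "in_ramified q p h \<longleftrightarrow> (\<exists>h'. fls_compose_power h p = fls_compose_power h' q)"

subsection \<open>The sets \<open>R\<^sub>q\<close> and \<open>S\<^sub>q\<close>\<close>

text \<open>
  A Galois orbit on a quotient of \<open>k((z\<^sup>1\<^sup>/\<^sup>q))\<close> is represented by its preimage in \<open>k((z\<^sup>1\<^sup>/\<^sup>q))\<close>, i.e. by
  an equivalence class for the relation generated by the Galois action and the subgroup.
\<close>
definition R_rel :: "nat \<Rightarrow> ('a::field fls \<times> 'a fls) set" where
  "R_rel q = {(f, f'). \<exists>\<eta> (n::int). \<eta> ^ q = 1 \<and>
     little_o 0 (galois_act \<eta> f - f' - fls_const (of_int n / of_nat q))}"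

definition R_set :: "nat \<Rightarrow> 'a::field fls set set" where
  "R_set q = UNIV // R_rel q"

definition R_circ :: "nat \<Rightarrow> 'a::field fls set set" where
  "R_circ q = {C \<in> R_set q. \<forall>p. 0 < p \<and> p < q \<longrightarrow> \<not> (\<exists>h\<in>C. in_ramified q p h)}"

text \<open>In the indeterminate \<open>\<theta>\<^sup>1\<^sup>/\<^sup>q\<close>, \<open>\<theta>\<close> is the \<open>q\<close>-th power.\<close>
definition S_rel :: "nat \<Rightarrow> ('a::field fls \<times> 'a fls) set" where
  "S_rel q = {(g, g'). g \<noteq> 0 \<and> g' \<noteq> 0 \<and> (\<exists>\<eta> (n::int). \<eta> ^ q = 1 \<and>
     little_o (int q) (galois_act \<eta> g / g' - 1 - fls_const (of_int n / of_nat q) * fls_X ^ q))}"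

definition S_set :: "nat \<Rightarrow> 'a::field fls set set" where
  "S_set q = {g. g \<noteq> 0} // S_rel q"

definition S_circ :: "nat \<Rightarrow> 'a::field fls set set" where
  "S_circ q = {C \<in> S_set q. \<forall>p. 0 < p \<and> p < q \<longrightarrow> \<not> (\<exists>h\<in>C. in_ramified q p h)}"

subsection \<open>Connections\<close>

text \<open>
  Both connections and difference operators are pairs of a scalar multiplication by Laurent series
  and an additive operator on the same underlying group.
\<close>
type_synonym ('a, 'v) laurent_module = "('a fls \<Rightarrow> 'v \<Rightarrow> 'v) \<times> ('v \<Rightarrow> 'v)"

definition fin_dim :: "('a::field fls \<Rightarrow> 'v::ab_group_add \<Rightarrow> 'v) \<Rightarrow> bool" where
  "fin_dim scale \<longleftrightarrow> (\<exists>B. finite_dimensional_vector_space scale B)"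

definition k_linear :: "('a::field fls \<Rightarrow> 'v::ab_group_add \<Rightarrow> 'v) \<Rightarrow> ('v \<Rightarrow> 'v) \<Rightarrow> bool" where
  "k_linear scale F \<longleftrightarrow>
     Vector_Spaces.linear (\<lambda>c. scale (fls_const c)) (\<lambda>c. scale (fls_const c)) F"

definition is_connection :: "('a::field, 'v::ab_group_add) laurent_module \<Rightarrow> bool" where
  "is_connection E \<longleftrightarrow> (case E of (scale, D) \<Rightarrow>
     fin_dim scale \<and> k_linear scale D \<and>
     (\<forall>h v. D (scale h v) = scale h (D v) + scale (fls_deriv h) v))"

definition has_horizontal_section :: "('a::field, 'v::ab_group_add) laurent_module \<Rightarrow> bool" where
  "has_horizontal_section E \<longleftrightarrow> (\<exists>v. v \<noteq> 0 \<and> snd E v = 0)"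

text \<open>\<open>d/dz\<close> on \<open>k((u))\<close> where \<open>u\<^sup>q = z\<close>, so that \<open>d/dz = (q u\<^sup>q\<^sup>-\<^sup>1)\<^sup>-\<^sup>1 d/du\<close>.\<close>
definition ramified_deriv :: "nat \<Rightarrow> 'a::field fls \<Rightarrow> 'a fls" where
  "ramified_deriv q v = fls_const (1 / of_nat q) * fls_X_intpow (1 - int q) * fls_deriv v"

text \<open>\<open>E\<^sub>f\<close> for \<open>f \<in> k((z\<^sup>1\<^sup>/\<^sup>q))\<close>, viewed over \<open>k((z))\<close>.\<close>
definition conn_E :: "nat \<Rightarrow> 'a::field fls \<Rightarrow> ('a, 'a fls) laurent_module" where
  "conn_E q f = (\<lambda>h v. fls_compose_power h q * v,
                 \<lambda>v. ramified_deriv q v + fls_X_intpow (- int q) * f * v)"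

subsection \<open>Difference operators\<close>

definition shift_aut :: "'a::field fls \<Rightarrow> 'a fls" where
  "shift_aut h = fls_compose_fps h (fps_X / (1 + fps_X))"

text \<open>The extension \<open>v(\<theta>\<^sup>1\<^sup>/\<^sup>q) \<mapsto> v(\<theta>\<^sup>1\<^sup>/\<^sup>q \<Sum>\<^sub>i (-1/q choose i) \<theta>\<^sup>i)\<close> of \<open>shift_aut\<close>.\<close>
definition ramified_shift_aut :: "nat \<Rightarrow> 'a::field_char_0 fls \<Rightarrow> 'a fls" where
  "ramified_shift_aut q h =
     fls_compose_fps h (fps_X * fps_compose (fps_binomial (- 1 / of_nat q)) (fps_X ^ q))"

definition is_difference_op :: "('a::field, 'v::ab_group_add) laurent_module \<Rightarrow> bool" where
  "is_difference_op N \<longleftrightarrow> (case N of (scale, \<Phi>) \<Rightarrow>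
     fin_dim scale \<and> k_linear scale \<Phi> \<and> bij \<Phi> \<and>
     (\<forall>h v. \<Phi> (scale h v) = scale (shift_aut h) (\<Phi> v)))"

text \<open>\<open>D\<^sub>g\<close> for \<open>g \<in> k((\<theta>\<^sup>1\<^sup>/\<^sup>q))\<close>, viewed over \<open>k((\<theta>))\<close>.\<close>
definition diff_D :: "nat \<Rightarrow> 'a::field_char_0 fls \<Rightarrow> ('a, 'a fls) laurent_module" where
  "diff_D q g = (\<lambda>h v. fls_compose_power h q * v, \<lambda>v. g * ramified_shift_aut q v)"

definition difference_iso ::
  "('a::field, 'v::ab_group_add) laurent_module \<Rightarrow> ('a, 'w::ab_group_add) laurent_module \<Rightarrow> bool"
where
  "difference_iso M N \<longleftrightarrow> is_difference_op M \<and> is_difference_op N \<and>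
     (\<exists>T. Vector_Spaces.linear (fst M) (fst N) T \<and> bij T \<and> (\<forall>v. T (snd M v) = snd N (T v)))"

subsection \<open>The local Mellin transform\<close>

text \<open>
  Open sets of the \<open>t\<close>-adic topology on a finite-dimensional \<open>k((t))\<close>-vector space: for a basis \<open>B\<close>,
  the lattices \<open>t\<^sup>n (\<Sum>\<^sub>b k[[t]] b)\<close> form a base of neighbourhoods of \<open>0\<close>. The
  topology does not depend on the choice of \<open>B\<close>.
\<close>
definition adic_lattice ::
  "('a::field fls \<Rightarrow> 'v::ab_group_add \<Rightarrow> 'v) \<Rightarrow> 'v set \<Rightarrow> nat \<Rightarrow> 'v set"
where
  "adic_lattice scale B n = {scale (fls_X ^ n) (\<Sum>b\<in>B. scale (fps_to_fls (c b)) b) | c. True}"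

definition adic_open :: "('a::field fls \<Rightarrow> 'v::ab_group_add \<Rightarrow> 'v) \<Rightarrow> 'v set \<Rightarrow> bool" where
  "adic_open scale U \<longleftrightarrow> (\<exists>B. finite_dimensional_vector_space scale B \<and>
     (\<forall>v\<in>U. \<exists>n. \<forall>l\<in>adic_lattice scale B n. v + l \<in> U))"

text \<open>The operator \<open>\<theta> = -(z\<nabla>)\<^sup>-\<^sup>1\<close>, where \<open>z = x + z\<^sub>x\<close>.\<close>
definition mellin_theta ::
  "'a::field \<Rightarrow> ('a, 'v::ab_group_add) laurent_module \<Rightarrow> 'v \<Rightarrow> 'v"
where
  "mellin_theta x E v = - inv (\<lambda>w. fst E (fls_const x + fls_X) (snd E w)) v"

text \<open>
  \<open>S\<close> is a \<open>k((\<theta>))\<close>-vector space structure extending the action of \<open>k\<close> and of the operator \<open>\<theta>\<close>, whose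
  \<open>\<theta>\<close>-adic topology is the \<open>z\<^sub>x\<close>-adic one. The last condition makes \<open>S\<close> unique, since
  \<open>k[\<theta>, \<theta>\<^sup>-\<^sup>1]\<close> is dense in \<open>k((\<theta>))\<close>.
\<close>
definition is_theta_action ::
  "'a::field \<Rightarrow> ('a, 'v::ab_group_add) laurent_module \<Rightarrow> ('a fls \<Rightarrow> 'v \<Rightarrow> 'v) \<Rightarrow> bool"
where
  "is_theta_action x E S \<longleftrightarrow> fin_dim S \<and>
     (\<forall>c v. S (fls_const c) v = fst E (fls_const c) v) \<and>
     (\<forall>v. S fls_X v = mellin_theta x E v) \<and>
     (\<forall>U. adic_open S U \<longleftrightarrow> adic_open (fst E) U)"

definition local_mellin ::
  "'a::field \<Rightarrow> ('a, 'v::ab_group_add) laurent_module \<Rightarrow> ('a, 'v) laurent_module"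
where
  "local_mellin x E = ((THE S. is_theta_action x E S), fst E (fls_const x + fls_X))"

subsection \<open>The system of equations\<close>

text \<open>
  With \<open>t = \<theta>\<^sup>1\<^sup>/\<^sup>(\<^sup>r\<^sup>+\<^sup>s\<^sup>)\<close>, a solution of the first equation is given by the series \<open>w(t) = z\<^sub>x\<^sup>1\<^sup>/\<^sup>r\<close>; it has
  to be nonzero with zero constant term for \<open>f(w)\<close> to make sense.
\<close>
definition solves_system ::
  "'a::field_char_0 \<Rightarrow> nat \<Rightarrow> nat \<Rightarrow> 'a fls \<Rightarrow> 'a fls \<Rightarrow> bool"
where
  "solves_system x r s f g \<longleftrightarrow> (\<exists>w. w \<noteq> 0 \<and> fps_nth w 0 = 0 \<and>
     (let zx = fps_to_fls (w ^ r);
          z = fls_const x + zx;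
          \<theta> = fls_X ^ (r + s)
      in fls_compose_fps f w = - (zx / z) * inverse \<theta> \<and>
         g = z + fls_const (x * of_nat s / (2 * (of_nat s + of_nat r))) * \<theta>))"

subsection \<open>Consistency of the definitions\<close>

lemma galois_act_nth: "\<eta> \<noteq> 0 \<Longrightarrow> fls_nth (galois_act \<eta> h) n = fls_nth h n * \<eta> powi n"
  by (simp add: galois_act_def fls_nth_fls_compose_fps_linear)

lemma root_of_unity_nonzero: "q > 0 \<Longrightarrow> \<eta> ^ q = (1::'a::field) \<Longrightarrow> \<eta> \<noteq> 0"
  by (auto simp: power_0_left)

lemma galois_act_1: "galois_act 1 f = f"
  by (rule fls_eqI) (simp add: galois_act_nth)

lemma galois_act_diff: "\<eta> \<noteq> 0 \<Longrightarrow> galois_act \<eta> (f - g) = galois_act \<eta> f - galois_act \<eta> g"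
  by (rule fls_eqI) (simp add: galois_act_nth algebra_simps)

lemma galois_act_const: "\<eta> \<noteq> 0 \<Longrightarrow> galois_act \<eta> (fls_const c) = fls_const c"
  by (rule fls_eqI) (simp add: galois_act_nth)

lemma galois_act_galois_act:
  "\<eta> \<noteq> 0 \<Longrightarrow> \<epsilon> \<noteq> 0 \<Longrightarrow> galois_act \<epsilon> (galois_act \<eta> f) = galois_act (\<epsilon> * \<eta>) f"
  by (rule fls_eqI) (simp add: galois_act_nth power_int_mult_distrib)

lemma little_o_galois: "\<eta> \<noteq> 0 \<Longrightarrow> little_o k f \<Longrightarrow> little_o k (galois_act \<eta> f)"
  by (auto simp: little_o_def galois_act_nth)

lemma little_o_add: "little_o k f \<Longrightarrow> little_o k g \<Longrightarrow> little_o k (f + g)"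
  for f g :: "'a::field fls"
  unfolding little_o_def by (metis add.right_neutral fls_plus_nth)

lemma little_o_uminus: "little_o k f \<Longrightarrow> little_o k (-f)"
  for f :: "'a::field fls"
  unfolding little_o_def by simp

lemma equiv_R_rel:
  assumes "q > 0"
  shows "equiv UNIV (R_rel q :: ('a::field fls \<times> 'a fls) set)"
proof (rule equivI)
  show "refl (R_rel q :: ('a fls \<times> 'a fls) set)"
    unfolding refl_on_def R_rel_def
    by (auto intro!: exI[of _ "1::'a"] exI[of _ "0::int"] simp: little_o_def galois_act_1)
  show "sym (R_rel q :: ('a fls \<times> 'a fls) set)"
  proof (rule symI)
    fix f f' :: "'a fls" assume "(f, f') \<in> R_rel q"
    then obtain \<eta> and n :: int where *: "\<eta> ^ q = 1"
      "little_o 0 (galois_act \<eta> f - f' - fls_const (of_int n / of_nat q))"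
      by (auto simp: R_rel_def)
    have nz: "\<eta> \<noteq> 0" using * assms root_of_unity_nonzero by blast
    have "little_o 0 (- galois_act (inverse \<eta>) (galois_act \<eta> f - f' - fls_const (of_int n / of_nat q)))"
      using *(2) nz by (intro little_o_galois little_o_uminus) auto
    also have "- galois_act (inverse \<eta>) (galois_act \<eta> f - f' - fls_const (of_int n / of_nat q)) =
       galois_act (inverse \<eta>) f' - f - fls_const (of_int (-n) / of_nat q)"
      using nz by (simp add: galois_act_diff galois_act_galois_act galois_act_1 galois_act_const flip: fls_const_uminus)
    finally show "(f', f) \<in> R_rel q" unfolding R_rel_def using *(1)
      by (auto intro!: exI[of _ "inverse \<eta>"] exI[of _ "-n"] simp: power_inverse)
  qed
  show "trans (R_rel q :: ('a fls \<times> 'a fls) set)"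
  proof (rule transI)
    fix f f' f'' :: "'a fls" assume "(f, f') \<in> R_rel q" "(f', f'') \<in> R_rel q"
    then obtain \<eta> \<epsilon> and n m :: int where *: "\<eta> ^ q = 1"  "\<epsilon> ^ q = 1"
      "little_o 0 (galois_act \<eta> f - f' - fls_const (of_int n / of_nat q))"
      "little_o 0 (galois_act \<epsilon> f' - f'' - fls_const (of_int m / of_nat q))"
      by (auto simp: R_rel_def)
    have nz: "\<eta> \<noteq> 0" "\<epsilon> \<noteq> 0" using * assms root_of_unity_nonzero by blast+
    have "little_o 0 (galois_act \<epsilon> (galois_act \<eta> f - f' - fls_const (of_int n / of_nat q)) +
         (galois_act \<epsilon> f' - f'' - fls_const (of_int m / of_nat q)))"
      using *(3,4) nz by (intro little_o_add little_o_galois) auto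
    also have "galois_act \<epsilon> (galois_act \<eta> f - f' - fls_const (of_int n / of_nat q)) +
         (galois_act \<epsilon> f' - f'' - fls_const (of_int m / of_nat q)) =
        galois_act (\<epsilon> * \<eta>) f - f'' - fls_const (of_int (n + m) / of_nat q)"
      using nz by (simp add: galois_act_diff galois_act_galois_act galois_act_const add_divide_distrib flip: fls_plus_const)
    finally show "(f, f'') \<in> R_rel q" unfolding R_rel_def using *(1,2)
      by (auto intro!: exI[of _ "\<epsilon> * \<eta>"] exI[of _ "n + m"] simp: power_mult_distrib)
  qed
qed simp

lemma fin_dim_ramified:
  assumes q: "q > 0"
  shows "fin_dim (\<lambda>h v. fls_compose_power h q * v :: 'a::field fls)"
proof -
  interpret V: vector_space "\<lambda>h v. fls_compose_power h q * v :: 'a fls"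
    by unfold_locales (use q in \<open>auto simp: algebra_simps\<close>)
  define G where "G = (\<lambda>i::nat. fls_X_intpow (int i) :: 'a fls) ` {..<q}"
  have span: "v \<in> V.span G" for v
  proof -
    define c where "c i = Abs_fls (\<lambda>n. fls_nth v (int q * n + int i))" for i :: nat
    have c: "fls_nth (c i) n = fls_nth v (int q * n + int i)" for i n
      unfolding c_def
    proof (subst nth_Abs_fls_lower_bound)
      show "\<forall>k < (- \<bar>fls_subdegree v\<bar> - int i). fls_nth v (int q * k + int i) = 0"
      proof (intro allI impI)
        fix k assume k: "k < - \<bar>fls_subdegree v\<bar> - int i"
        have "int q * k \<le> 1 * k"
          using q k by (intro mult_right_mono_neg) auto
        thus "fls_nth v (int q * k + int i) = 0"
          using k by (intro fls_eq0_below_subdegree) auto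
      qed
    qed auto
    have "v = (\<Sum>i<q. fls_compose_power (c i) q * fls_X_intpow (int i))"
    proof (rule fls_eqI)
      fix n :: int
      have "fls_nth (\<Sum>i<q. fls_compose_power (c i) q * fls_X_intpow (int i)) n =
            (\<Sum>i<q. if i = nat (n mod int q) then fls_nth v n else 0)"
        unfolding fls_nth_sum
      proof (intro sum.cong refl)
        fix i assume i: "i \<in> {..<q}"
        have "int q dvd n - int i \<longleftrightarrow> n mod int q = int i mod int q"
          by (simp add: mod_eq_dvd_iff)
        also have "int i mod int q = int i" using i by simp
        also have "n mod int q = int i \<longleftrightarrow> i = nat (n mod int q)"
          using q by auto
        finally have "int q dvd n - int i \<longleftrightarrow> i = nat (n mod int q)" .
        thus "fls_nth (fls_compose_power (c i) q * fls_X_intpow (int i)) n =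
            (if i = nat (n mod int q) then fls_nth v n else 0)"
          using q by (auto simp: fls_X_intpow_times_conv_shift fls_nth_compose_power c)
      qed
      also have "\<dots> = fls_nth v n" using q
        by (simp add: nat_less_iff)
      finally show "fls_nth v n = fls_nth (\<Sum>i<q. fls_compose_power (c i) q * fls_X_intpow (int i)) n" ..
    qed
    also have "\<dots> \<in> V.span G"
      by (intro V.span_sum V.span_scale V.span_base) (auto simp: G_def)
    finally show ?thesis .
  qed
  obtain B where B: "B \<subseteq> G" "V.independent B" "G \<subseteq> V.span B"
    using V.maximal_independent_subset by blast
  have "V.span B = UNIV"
    using span V.span_minimal[OF B(3) V.subspace_span] by auto
  moreover have "finite B" using B(1) by (rule finite_subset) (auto simp: G_def)
  ultimately have "finite_dimensional_vector_space (\<lambda>h v. fls_compose_power h q * v :: 'a fls) B"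
    using B by unfold_locales auto
  thus ?thesis unfolding fin_dim_def by blast
qed

lemma ramified_deriv_mult:
  "ramified_deriv q (v * w) = ramified_deriv q v * w + v * ramified_deriv q w"
  unfolding ramified_deriv_def by (simp add: fls_deriv_mult algebra_simps)

lemma ramified_deriv_nth:
  "fls_nth (ramified_deriv q v) n = of_int (n + int q) / of_nat q * fls_nth v (n + int q)"
  unfolding ramified_deriv_def mult.assoc fls_X_intpow_times_conv_shift(1) by simp

lemma ramified_deriv_base:
  fixes h :: "'a::field_char_0 fls"
  assumes "q > 0"
  shows "ramified_deriv q (fls_compose_power h q) = fls_compose_power (fls_deriv h) q"
proof (rule fls_eqI)
  fix n :: int
  show "fls_nth (ramified_deriv q (fls_compose_power h q)) n = fls_nth (fls_compose_power (fls_deriv h) q) n"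
  proof (cases "int q dvd n")
    case True
    then obtain k where k: "n = int q * k" by (elim dvdE)
    have "(int q * k + int q) div int q = k + 1"
      using assms by (simp add: distrib_left[symmetric] del: distrib_left_numeral)
    thus ?thesis using assms
      by (simp add: k ramified_deriv_nth fls_nth_compose_power field_simps)
  next
    case False
    thus ?thesis using assms
      by (simp add: ramified_deriv_nth fls_nth_compose_power)
  qed
qed

lemma is_connection_conn_E:
  fixes f :: "'a::field_char_0 fls"
  assumes q: "q > 0"
  shows "is_connection (conn_E q f)"
proof -
  have "k_linear (\<lambda>h v. fls_compose_power h q * v) (\<lambda>v. ramified_deriv q v + fls_X_intpow (- int q) * f * v)"
    unfolding k_linear_def using q
    by unfold_locales (auto simp: algebra_simps ramified_deriv_def simp flip: fls_plus_const)
  thus ?thesis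
    unfolding is_connection_def conn_E_def prod.case using fin_dim_ramified[OF q]
    by (intro conjI allI)
       (assumption | simp add: ramified_deriv_mult ramified_deriv_base q algebra_simps)+
qed

lemma little_o_mult:
  fixes f g :: "'a::field fls"
  assumes "little_o k f" "little_o (-1) g"
  shows "little_o k (f * g)"
proof (cases "f = 0 \<or> g = 0")
  case False
  have "fls_subdegree f > k" "fls_subdegree g > -1"
    using assms False by (auto simp: little_o_def)
  hence "fls_subdegree (f * g) > k" using False by simp
  thus ?thesis unfolding little_o_def
    by (metis fls_eq0_below_subdegree less_le_trans not_le)
qed (auto simp: little_o_def)

lemma little_o_mono: "little_o k f \<Longrightarrow> l \<le> k \<Longrightarrow> little_o l f"
  by (force simp: little_o_def)

lemma little_o_const_X: "int n > k \<Longrightarrow> little_o k (fls_const c * fls_X ^ n :: 'a::field fls)"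
  by (auto simp: little_o_def fls_X_power_conv_shift_1)

lemma unit_class_unit:
  fixes a :: "'a::field fls"
  assumes "q > 0" "little_o (int q) (a - 1 - fls_const c * fls_X ^ q)"
  shows "a \<noteq> 0" "little_o (-1) a" "little_o (-1) (inverse a)"
proof -
  have 0: "little_o 0 (a - 1)"
    using little_o_add[OF little_o_mono[OF assms(2), of 0] little_o_const_X[of 0 q c]] assms(1) by simp
  hence a0: "fls_nth a 0 = 1" by (fastforce simp: little_o_def dest: spec[of _ "0::int"])
  thus nz: "a \<noteq> 0" by auto
  have neg: "fls_nth a n = 0" if "n < 0" for n
    using 0[unfolded little_o_def, rule_format, of n] that by auto
  hence "fls_subdegree a = 0" using a0 by (intro fls_subdegree_eqI) auto
  hence "fls_subdegree (inverse a) = 0" using nz by (simp add: fls_inverse_subdegree)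
  thus "little_o (-1) (inverse a)" unfolding little_o_def
    by (metis add.left_neutral add_le_less_mono fls_eq0_below_subdegree int_one_le_iff_zero_less not_le linorder_neqE_linordered_idom less_trans neg_less_0_iff_less zero_less_one)
  show "little_o (-1) a" using neg by (force simp: little_o_def)
qed

lemma unit_class_mult:
  fixes a b :: "'a::field fls"
  assumes q: "q > 0" and a: "little_o (int q) (a - 1 - fls_const c * fls_X ^ q)"
    and b: "little_o (int q) (b - 1 - fls_const d * fls_X ^ q)"
  shows "little_o (int q) (a * b - 1 - fls_const (c + d) * fls_X ^ q)"
proof -
  have "a * b - 1 - fls_const (c + d) * fls_X ^ q =
    (a - 1 - fls_const c * fls_X ^ q) * b + (b - 1 - fls_const d * fls_X ^ q)
     + (b - 1 - fls_const d * fls_X ^ q) * (fls_const c * fls_X ^ q)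
     + fls_const (c * d) * fls_X ^ (q + q)"
    by (simp add: algebra_simps power_add flip: fls_plus_const fls_const_mult_const)
  also have "little_o (int q) \<dots>"
    using q by (intro little_o_add little_o_mult a b little_o_const_X unit_class_unit[OF q b]) auto
  finally show ?thesis .
qed

lemma unit_class_inverse:
  fixes a b :: "'a::field fls"
  assumes q: "q > 0" and a: "little_o (int q) (a - 1 - fls_const c * fls_X ^ q)"
  shows "little_o (int q) (inverse a - 1 - fls_const (-c) * fls_X ^ q)"
proof -
  have "inverse a - 1 - fls_const (-c) * fls_X ^ q =
    (- (a - 1 - fls_const c * fls_X ^ q) + (a - 1 - fls_const c * fls_X ^ q) * (fls_const c * fls_X ^ q)
     + fls_const (c * c) * fls_X ^ (q + q)) * inverse a"
    using unit_class_unit(1)[OF q a]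
    by (simp add: field_simps power_add flip: fls_const_mult_const)
  also have "little_o (int q) \<dots>"
    using q by (intro little_o_mult little_o_add little_o_uminus a little_o_const_X unit_class_unit[OF q a]) auto
  finally show ?thesis .
qed

lemma galois_act_hom:
  fixes f g :: "'a::field fls"
  assumes "\<eta> \<noteq> 0"
  shows "galois_act \<eta> (f * g) = galois_act \<eta> f * galois_act \<eta> g"
    "galois_act \<eta> (f / g) = galois_act \<eta> f / galois_act \<eta> g"
    "galois_act \<eta> 1 = 1"
  using assms by (simp_all add: galois_act_def fls_compose_fps_mult fls_compose_fps_divide)

lemma galois_act_eq_0_iff: "\<eta> \<noteq> 0 \<Longrightarrow> galois_act \<eta> f = 0 \<longleftrightarrow> f = 0"
  by (auto simp: fls_eq_iff galois_act_nth)

lemma galois_act_X_power: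
  "q > 0 \<Longrightarrow> \<eta> ^ q = 1 \<Longrightarrow> galois_act \<eta> (fls_const c * fls_X ^ q) = fls_const c * fls_X ^ q"
  by (rule fls_eqI) (auto simp: galois_act_nth root_of_unity_nonzero fls_X_power_conv_shift_1)

lemma equiv_S_rel:
  assumes q: "q > 0"
  shows "equiv {g. g \<noteq> 0} (S_rel q :: ('a::field fls \<times> 'a fls) set)"
proof (rule equivI)
  let ?P = "\<lambda>(c::'a) (h::'a fls). little_o (int q) (h - 1 - fls_const c * fls_X ^ q)"
  have gal: "?P c (galois_act \<eta> h)" if "?P c h" "\<eta> ^ q = 1" for c h \<eta>
  proof -
    have "\<eta> \<noteq> 0" using that q root_of_unity_nonzero by blast
    thus ?thesis
      using little_o_galois[OF _ that(1), of \<eta>] galois_act_X_power[OF q that(2), of c]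
      by (simp only: galois_act_diff galois_act_hom(3) not_False_eq_True simp_thms)
  qed
  show "S_rel q \<subseteq> {g. g \<noteq> 0} \<times> {g. g \<noteq> (0 :: 'a fls)}" by (auto simp: S_rel_def)
  show "refl_on {g. g \<noteq> 0} (S_rel q :: ('a fls \<times> 'a fls) set)"
    unfolding refl_on_def S_rel_def
    by (auto intro!: exI[of _ "1::'a"] exI[of _ "0::int"] simp: little_o_def galois_act_1)
  show "sym (S_rel q :: ('a fls \<times> 'a fls) set)"
  proof (rule symI)
    fix f f' :: "'a fls" assume "(f, f') \<in> S_rel q"
    then obtain \<eta> and n :: int where *: "f \<noteq> 0" "f' \<noteq> 0" "\<eta> ^ q = 1"
      "?P (of_int n / of_nat q) (galois_act \<eta> f / f')"
      by (auto simp: S_rel_def)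
    have nz: "\<eta> \<noteq> 0" using * assms root_of_unity_nonzero by blast
    have "?P (- (of_int n / of_nat q)) (galois_act (inverse \<eta>) (inverse (galois_act \<eta> f / f')))"
      by (intro gal unit_class_inverse q *) (use * in \<open>auto simp: power_inverse\<close>)
    also have "galois_act (inverse \<eta>) (inverse (galois_act \<eta> f / f')) = galois_act (inverse \<eta>) f' / f"
      using nz by (simp add: galois_act_hom galois_act_galois_act galois_act_1)
    finally show "(f', f) \<in> S_rel q" unfolding S_rel_def using *
      by (auto intro!: exI[of _ "inverse \<eta>"] exI[of _ "-n"] simp: power_inverse)
  qed
  show "trans (S_rel q :: ('a fls \<times> 'a fls) set)"
  proof (rule transI)
    fix f f' f'' :: "'a fls" assume "(f, f') \<in> S_rel q" "(f', f'') \<in> S_rel q"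
    then obtain \<eta> \<epsilon> and n m :: int where *: "f \<noteq> 0" "f' \<noteq> 0" "f'' \<noteq> 0" "\<eta> ^ q = 1"  "\<epsilon> ^ q = 1"
      "?P (of_int n / of_nat q) (galois_act \<eta> f / f')" "?P (of_int m / of_nat q) (galois_act \<epsilon> f' / f'')"
      by (auto simp: S_rel_def)
    have nz: "\<eta> \<noteq> 0" "\<epsilon> \<noteq> 0" using * assms root_of_unity_nonzero by blast+
    have "?P (of_int n / of_nat q + of_int m / of_nat q)
            (galois_act \<epsilon> (galois_act \<eta> f / f') * (galois_act \<epsilon> f' / f''))"
      by (intro unit_class_mult gal q *)
    also have "galois_act \<epsilon> (galois_act \<eta> f / f') * (galois_act \<epsilon> f' / f'') = galois_act (\<epsilon> * \<eta>) f / f''"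
      using nz * by (simp add: galois_act_hom galois_act_galois_act galois_act_eq_0_iff)
    finally show "(f, f'') \<in> S_rel q" unfolding S_rel_def using *
      by (auto intro!: exI[of _ "\<epsilon> * \<eta>"] exI[of _ "n + m"] simp: power_mult_distrib add_divide_distrib)
  qed
qed

end

theory Submission
  imports Defs
begin

text \<open>
  Put \<open>n = r + s\<close> and \<open>\<theta> = t\<^sup>n\<close>. The connection \<open>E\<^sub>f\<close> lives on \<open>k((u))\<close> with \<open>u\<^sup>r = z\<^sub>x\<close>. A solution \<open>w(t)\<close>
  of the first equation has order 1, so it is a change of coordinate \<open>u = w(t)\<close>, and the equation
  says exactly that in the coordinate \<open>t\<close> the operator \<open>z\<nabla>\<close> becomes \<open>D = (Z/Z') d/dt - \<theta>\<^sup>-\<^sup>1\<close>, where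
  \<open>Z = x + w\<^sup>r\<close> is multiplication by \<open>z\<close>. Hence all that has to be understood is the pair \<open>(Z, D)\<close> on
  \<open>k((t))\<close>, and the isomorphism with \<open>D\<^sub>g\<close> has to turn \<open>-D\<close> into multiplication by \<open>\<theta>\<^sup>-\<^sup>1\<close> and \<open>Z\<close> into
  \<open>g\<phi>\<close>.

  The first half of this demand asks for a bijection \<open>\<Psi>\<close> of \<open>k((t))\<close> that preserves orders and
  satisfies \<open>-D \<Psi> \<theta> = \<Psi>\<close>. For \<open>s > 0\<close> try \<open>\<Psi>(t\<^sup>j) = t\<^sup>j \<Sum>\<^sub>k p\<^sub>k(j) t\<^sup>k\<close>: the condition becomes
  \<open>p\<^sub>m(j + n) - p\<^sub>m(j) = (terms in p\<^sub>k with k \<le> m - s)\<close>, which has polynomial solutions in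
  characteristic 0 (\<open>intertwiner_ramified\<close>). For \<open>s = 0\<close> one has \<open>r = n = 1\<close>, the operator \<open>D\<close> is
  invertible because there is no horizontal section, and its powers applied to 1 give \<open>\<Psi>\<close>
  (\<open>intertwiner_unramified\<close>).

  The second half is then nearly automatic. From \<open>D Z = Z (D + 1)\<close> the operator \<open>\<Phi> = \<Psi>\<^sup>-\<^sup>1 Z \<Psi>\<close>
  satisfies \<open>\<Phi> \<theta>\<^sup>-\<^sup>1 = (\<theta>\<^sup>-\<^sup>1 + 1) \<Phi>\<close>, as does \<open>\<phi>\<close>; so with \<open>g' = \<Phi>(1)\<close> the operators \<open>\<Phi>\<close> and \<open>g'\<phi>\<close> agree
  on the powers of \<open>\<theta>\<close>. Their values at \<open>t\<^sup>j\<close>, read through \<open>\<Psi>\<close>, have coefficients that are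
  polynomial in \<open>j\<close>, so they agree at every \<open>t\<^sup>j\<close>. The polynomials \<open>p\<^sub>k\<close> with \<open>k < s\<close> are constant and
  \<open>p\<^sub>s\<close> is an explicit quadratic polynomial; this yields \<open>g' = g - x\<theta> + o(\<theta>)\<close>, and it is here that the
  correction \<open>xs/(2(r+s))\<close> in \<open>g\<close> arises. Finally \<open>g\<phi>(h) = g'h\<close> has a solution \<open>h = \<theta> + o(\<theta>)\<close>, and
  \<open>h \<Psi>\<^sup>-\<^sup>1\<close> is the required map (\<open>model_isomorphism\<close>).

  This map also transports multiplication by Laurent series in \<open>\<theta>\<close> to \<open>E\<^sub>f\<close>. The transported action
  has the right topology since the map shifts orders by a constant, and it is the only such action
  because Laurent polynomials are dense (\<open>laurent_action_unique\<close>).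

  What remains concerns the class of \<open>g\<close>. With \<open>K = z\<^sub>x\<^sup>-\<^sup>1 f z\<close> the first equation reads
  \<open>K(w) = -\<theta>\<^sup>-\<^sup>1\<close>; taking an \<open>n\<close>-th root and a compositional inverse gives a solution, and any two
  solutions differ by \<open>t \<mapsto> \<eta>t\<close> with \<open>\<eta>\<^sup>n = 1\<close>. If the class of \<open>g\<close> came from a smaller ramification,
  then for some prime \<open>d\<close> dividing \<open>n\<close> and a primitive \<open>d\<close>-th root of unity \<open>\<zeta>\<close> the series \<open>z\<close> would be
  invariant under \<open>t \<mapsto> \<zeta>t\<close> modulo \<open>o(\<theta>)\<close>; this forces \<open>f(\<zeta>u) - f(u) = o(1)\<close> and
  \<open>d\<close> to divide \<open>r\<close>, so that \<open>f\<close> would come from a smaller ramification too (\<open>ramification_descends\<close>).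
\<close>

unbundle fps_syntax

section \<open>Laurent series of order at least k\<close>

definition ord_ge :: "int \<Rightarrow> 'a::zero fls \<Rightarrow> bool" where
  "ord_ge k v \<longleftrightarrow> (\<forall>i<k. v $$ i = 0)"

lemma ord_geD: "ord_ge k v \<Longrightarrow> i < k \<Longrightarrow> v $$ i = 0"
  by (simp add: ord_ge_def)

lemma ord_ge_iff_subdegree: "ord_ge k v \<longleftrightarrow> v = 0 \<or> k \<le> fls_subdegree v"
  unfolding ord_ge_def
  by (metis fls_eq0_below_subdegree fls_subdegree_geI fls_zero_nth less_le_trans)

lemma ord_ge_subdegree: "ord_ge (fls_subdegree v) v"
  by (simp add: ord_ge_def)

lemma little_o_iff_ord_ge: "little_o k v \<longleftrightarrow> ord_ge (k + 1) v"
proof -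
  have *: "i < k + 1 \<longleftrightarrow> \<not> k < i" for i by linarith
  show ?thesis unfolding little_o_def ord_ge_def * by blast
qed

lemma ord_ge_mono: "ord_ge k v \<Longrightarrow> l \<le> k \<Longrightarrow> ord_ge l v"
  by (auto simp: ord_ge_def)

lemma ord_ge_0 [simp]: "ord_ge k 0"
  by (simp add: ord_ge_def)

lemma ord_ge_add: "ord_ge k u \<Longrightarrow> ord_ge k v \<Longrightarrow> ord_ge k (u + v)"
  for u v :: "'a::monoid_add fls"
  by (simp add: ord_ge_def)

lemma ord_ge_diff: "ord_ge k u \<Longrightarrow> ord_ge k v \<Longrightarrow> ord_ge k (u - v)"
  for u v :: "'a::group_add fls"
  by (simp add: ord_ge_def)

lemma ord_ge_uminus: "ord_ge k u \<Longrightarrow> ord_ge k (- u)"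
  for u :: "'a::group_add fls"
  by (simp add: ord_ge_def)

lemma ord_ge_sum: "(\<And>i. i \<in> I \<Longrightarrow> ord_ge k (f i)) \<Longrightarrow> ord_ge k (sum f I)"
  for f :: "_ \<Rightarrow> 'a::comm_monoid_add fls"
  by (simp add: ord_ge_def fls_nth_sum)

lemma ord_ge_mult: "ord_ge k u \<Longrightarrow> ord_ge l v \<Longrightarrow> ord_ge (k + l) (u * v)"
  for u v :: "'a::field fls"
  by (cases "u = 0 \<or> v = 0") (auto simp: ord_ge_iff_subdegree)

lemma ord_ge_mult': "ord_ge k u \<Longrightarrow> ord_ge l v \<Longrightarrow> m \<le> k + l \<Longrightarrow> ord_ge m (u * v)"
  for u v :: "'a::field fls"
  using ord_ge_mult ord_ge_mono by blast

lemma mult_nth_lowest: "ord_ge k u \<Longrightarrow> ord_ge l v \<Longrightarrow> (u * v) $$ (k + l) = u $$ k * v $$ l"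
  for u v :: "'a::field fls"
proof -
  assume k: "ord_ge k u" and l: "ord_ge l v"
  consider "u = 0 \<or> v = 0" | "u \<noteq> 0" "v \<noteq> 0" "fls_subdegree u = k" "fls_subdegree v = l"
    | "u \<noteq> 0" "v \<noteq> 0" "k < fls_subdegree u" | "u \<noteq> 0" "v \<noteq> 0" "l < fls_subdegree v"
    using k l by (force simp: ord_ge_iff_subdegree)
  then show ?thesis
    by cases (use k l in \<open>auto simp: ord_ge_iff_subdegree intro!: fls_eq0_below_subdegree\<close>)
qed

lemma ord_ge_const_mult: "ord_ge k v \<Longrightarrow> ord_ge k (fls_const c * v)"
  for v :: "'a::field fls"
  by (simp add: ord_ge_def)

lemma ord_ge_fps [simp]: "ord_ge 0 (fps_to_fls p)"
  by (simp add: ord_ge_def)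

lemma ord_ge_X_intpow [simp]: "ord_ge j (fls_X_intpow j :: 'a::field fls)"
  by (simp add: ord_ge_def)

lemma X_intpow_nth: "(fls_X_intpow j :: 'a::field fls) $$ i = (if i = j then 1 else 0)"
  by simp

lemma shift_one_mult_nth: "(fls_shift k 1 * v) $$ i = v $$ (i + k)" for v :: "'a::field fls"
  using fls_X_intpow_times_conv_shift(1)[of "- k" v] by simp

lemma X_intpow_mult_nth: "(fls_X_intpow j * v) $$ i = v $$ (i - j)" for v :: "'a::field fls"
  by (simp add: fls_X_intpow_times_conv_shift)

lemma X_intpow_add: "fls_X_intpow (i + j) = fls_X_intpow i * (fls_X_intpow j :: 'a::field fls)"
  by (rule fls_eqI) (simp add: X_intpow_mult_nth algebra_simps)

lemma ord_ge_inverse: "ord_ge 0 u \<Longrightarrow> u $$ 0 \<noteq> 0 \<Longrightarrow> ord_ge 0 (inverse u)"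
  for u :: "'a::field fls"
proof -
  assume "ord_ge 0 u" "u $$ 0 \<noteq> 0"
  then have "fls_subdegree u = 0"
    by (intro fls_subdegree_eqI) (auto simp: ord_ge_def)
  then show ?thesis by (simp add: ord_ge_iff_subdegree)
qed

lemma ord_ge_all_imp_0: "(\<And>k. ord_ge k v) \<Longrightarrow> v = 0"
  by (rule fls_zero_eqI) (meson ord_geD less_add_one)

section \<open>Filtered operators on Laurent series\<close>

text \<open>
  Linear maps that raise orders by at least \<open>d\<close>. They are continuous, hence determined by their values
  on the powers of the indeterminate, and can be inverted by solving triangular systems.
\<close>

definition filtered :: "int \<Rightarrow> ('a::field fls \<Rightarrow> 'a fls) \<Rightarrow> bool" where
  "filtered d L \<longleftrightarrow> (\<forall>u v. L (u + v) = L u + L v) \<and>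
     (\<forall>c v. L (fls_const c * v) = fls_const c * L v) \<and>
     (\<forall>k v. ord_ge k v \<longrightarrow> ord_ge (k + d) (L v))"

lemma filteredI:
  assumes "\<And>u v. L (u + v) = L u + L v" "\<And>c v. L (fls_const c * v) = fls_const c * L v"
    "\<And>k v. ord_ge k v \<Longrightarrow> ord_ge (k + d) (L v)"
  shows "filtered d L"
  using assms by (auto simp: filtered_def)

lemma filtered_add: "filtered d L \<Longrightarrow> L (u + v) = L u + L v"
  and filtered_scale: "filtered d L \<Longrightarrow> L (fls_const c * v) = fls_const c * L v"
  and filtered_ord: "filtered d L \<Longrightarrow> ord_ge k v \<Longrightarrow> ord_ge (k + d) (L v)"
  by (auto simp: filtered_def)

lemma filtered_zero: "filtered d L \<Longrightarrow> L 0 = 0"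
  using filtered_scale[of d L 0 0] by simp

lemma filtered_uminus: "filtered d L \<Longrightarrow> L (- v) = - L v"
  using filtered_add[of d L v "- v"] filtered_zero[of d L] by (simp add: eq_neg_iff_add_eq_0 add.commute)

lemma filtered_diff: "filtered d L \<Longrightarrow> L (u - v) = L u - L v"
  using filtered_add[of d L u "- v"] filtered_uminus[of d L v] by simp

lemma filtered_sum: "filtered d L \<Longrightarrow> L (sum f I) = (\<Sum>i\<in>I. L (f i))"
  by (induction I rule: infinite_finite_induct) (auto simp: filtered_zero filtered_add)

lemma filtered_comp:
  assumes "filtered d L" "filtered e M"
  shows "filtered (d + e) (\<lambda>v. M (L v))"
proof (rule filteredI)
  fix k and v :: "'a fls" assume "ord_ge k v"
  then have "ord_ge (k + d + e) (M (L v))" using assms by (auto intro: filtered_ord)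
  then show "ord_ge (k + (d + e)) (M (L v))" by (simp add: add.assoc)
qed (simp_all add: assms[THEN filtered_add] assms[THEN filtered_scale])

lemma filtered_minus: "filtered d L \<Longrightarrow> filtered d M \<Longrightarrow> filtered d (\<lambda>v. L v - M v)"
  unfolding filtered_def by (simp add: algebra_simps ord_ge_diff)

lemma filtered_neg: "filtered d L \<Longrightarrow> filtered d (\<lambda>v. - L v)"
  unfolding filtered_def by (simp add: ord_ge_uminus)

lemma filtered_mono: "filtered d L \<Longrightarrow> d' \<le> d \<Longrightarrow> filtered d' L"
  unfolding filtered_def by (meson add_left_mono ord_ge_mono)

lemma filtered_mult: "ord_ge d c \<Longrightarrow> filtered d (\<lambda>v. c * v)"
  by (rule filteredI) (auto simp: algebra_simps intro: ord_ge_mult')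

lemma filtered_deriv: "filtered (-1) fls_deriv"
  by (rule filteredI) (auto simp: fls_deriv_mult ord_ge_def)

lemma series_truncation:
  fixes v :: "'a::field fls"
  assumes "ord_ge k v"
  shows "ord_ge (N + 1) (v - (\<Sum>j=k..N. fls_const (v $$ j) * fls_X_intpow j))"
proof -
  have "(\<Sum>j=k..N. fls_const (v $$ j) * fls_X_intpow j) $$ i = v $$ i" if "i < N + 1" for i
  proof -
    have "(\<Sum>j=k..N. fls_const (v $$ j) * fls_X_intpow j) $$ i = (\<Sum>j\<in>{k..N}. if j = i then v $$ i else 0)"
      unfolding fls_nth_sum by (intro sum.cong) (auto simp: X_intpow_nth)
    also have "\<dots> = v $$ i" using that ord_geD[OF assms, of i] by auto
    finally show ?thesis .
  qed
  then show ?thesis by (simp add: ord_ge_def)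
qed

text \<open>
  Terms of order greater than \<open>N - d\<close> do not contribute to the coefficient at \<open>N\<close>, so the values on the
  powers of the indeterminate suffice.
\<close>

lemma filtered_nth:
  assumes L: "filtered d L" and v: "ord_ge k v"
  shows "L v $$ N = (\<Sum>j=k..N - d. v $$ j * L (fls_X_intpow j) $$ N)"
proof -
  let ?S = "\<Sum>j=k..N - d. fls_const (v $$ j) * fls_X_intpow j"
  have "ord_ge (N - d + 1 + d) (L (v - ?S))"
    using series_truncation[OF v] by (rule filtered_ord[OF L])
  then have "L (v - ?S) $$ N = 0" by (rule ord_geD) simp
  then have "L v $$ N = L ?S $$ N" by (simp add: filtered_diff[OF L])
  also have "L ?S = (\<Sum>j=k..N - d. fls_const (v $$ j) * L (fls_X_intpow j))"
    by (simp add: filtered_sum[OF L] filtered_scale[OF L])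
  finally show ?thesis by (simp add: fls_nth_sum)
qed

lemma filtered_ext:
  assumes L: "filtered d L" and M: "filtered d M"
    and eq: "\<And>j. L (fls_X_intpow j) = M (fls_X_intpow j)"
  shows "L = M"
proof (rule ext, rule fls_eqI)
  fix v :: "'a fls" and N
  show "L v $$ N = M v $$ N"
    by (simp only: filtered_nth[OF L ord_ge_subdegree[of v]] filtered_nth[OF M ord_ge_subdegree[of v]] eq)
qed

lemma filtered_nth_lowest:
  "filtered d L \<Longrightarrow> ord_ge k v \<Longrightarrow> L v $$ (k + d) = v $$ k * L (fls_X_intpow k) $$ (k + d)"
  by (simp add: filtered_nth[of d L k v "k + d"])

text \<open>
  Course-of-values recursion for a functional that is available only inside a proof.
\<close>

lemma nat_recursion_exists:
  fixes F :: "(nat \<Rightarrow> 'b) \<Rightarrow> nat \<Rightarrow> 'b"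
  assumes "\<And>a b i. (\<And>j. j < i \<Longrightarrow> a j = b j) \<Longrightarrow> F a i = F b i"
  shows "\<exists>a. \<forall>i. a i = F a i"
proof (rule dependent_wellorder_choice)
  fix r :: 'b and f g :: "nat \<Rightarrow> 'b" and x :: nat
  assume "\<And>y. y < x \<Longrightarrow> f y = g y"
  then show "(r = F f x) = (r = F g x)" using assms[of x f g] by simp
qed blast

lemma fls_of_coeffs:
  "\<exists>v. ord_ge k v \<and> (\<forall>i\<ge>k. v $$ i = a (nat (i - k)))"
  by (rule exI[of _ "fls_shift (- k) (fps_to_fls (Abs_fps a))"]) (auto simp: ord_ge_def)

text \<open>
  The coefficients of a preimage are found one after the other: each new one occurs with the nonzero
  factor \<open>L(t\<^sup>j)\<close> at \<open>j + d\<close>.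
\<close>

lemma filtered_onto:
  assumes L: "filtered d L" and lead: "\<And>j. j \<ge> k \<Longrightarrow> L (fls_X_intpow j) $$ (j + d) \<noteq> 0"
    and y: "ord_ge (k + d) y"
  obtains v where "ord_ge k v" "L v = y"
proof -
  let ?e = "\<lambda>i N. L (fls_X_intpow (k + int i)) $$ (k + d + int N)"
  have "\<exists>a. \<forall>i. a i = (y $$ (k + d + int i) - (\<Sum>j<i. a j * ?e j i)) / ?e i i"
    by (rule nat_recursion_exists) simp
  then obtain a where a: "\<And>i. a i = (y $$ (k + d + int i) - (\<Sum>j<i. a j * ?e j i)) / ?e i i"
    by blast
  obtain v where v: "ord_ge k v" "\<And>i. i \<ge> k \<Longrightarrow> v $$ i = a (nat (i - k))"
    using fls_of_coeffs[of k a] by blast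
  have "L v $$ N = y $$ N" for N
  proof (cases "N < k + d")
    case True
    then show ?thesis using filtered_ord[OF L v(1)] y by (auto simp: ord_ge_def)
  next
    case False
    define i where "i = nat (N - k - d)"
    have N: "N = k + d + int i" using False by (simp add: i_def)
    have ei: "?e i i \<noteq> 0" using lead[of "k + int i"] by (simp add: algebra_simps)
    have "L v $$ N = (\<Sum>j=k..N - d. v $$ j * L (fls_X_intpow j) $$ N)"
      by (rule filtered_nth[OF L v(1)])
    also have "\<dots> = (\<Sum>j\<le>i. a j * ?e j i)"
      by (rule sum.reindex_bij_witness[of _ "\<lambda>j. k + int j" "\<lambda>j. nat (j - k)"])
        (auto simp: v(2) N)
    also have "\<dots> = y $$ N"
      using a[of i] ei by (simp add: lessThan_Suc_atMost[symmetric] N field_simps)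
    finally show ?thesis .
  qed
  then have "L v = y" by (intro fls_eqI) auto
  then show ?thesis using v that by blast
qed

lemma filtered_ord_iff:
  assumes L: "filtered d L" and lead: "\<And>j. L (fls_X_intpow j) $$ (j + d) \<noteq> 0"
  shows "ord_ge (k + d) (L v) \<longleftrightarrow> ord_ge k v"
proof
  assume *: "ord_ge (k + d) (L v)"
  show "ord_ge k v"
  proof (rule ccontr)
    assume "\<not> ord_ge k v"
    then have v: "v \<noteq> 0" "fls_subdegree v < k" by (auto simp: ord_ge_iff_subdegree)
    let ?m = "fls_subdegree v"
    have "L v $$ (?m + d) \<noteq> 0"
      unfolding filtered_nth_lowest[OF L ord_ge_subdegree] using lead v by simp
    then show False using * v by (auto simp: ord_ge_def)
  qed
qed (rule filtered_ord[OF L])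

lemma filtered_bij:
  assumes L: "filtered d L" and lead: "\<And>j. L (fls_X_intpow j) $$ (j + d) \<noteq> 0"
  shows "bij L" and "filtered (- d) (inv L)"
proof -
  have "inj L"
  proof (rule injI)
    fix u v assume "L u = L v"
    then have "L (u - v) = 0" by (simp add: filtered_diff[OF L])
    then have "ord_ge k (u - v)" for k using filtered_ord_iff[OF L lead, of k "u - v"] by simp
    then show "u = v" using ord_ge_all_imp_0[of "u - v"] by simp
  qed
  moreover have "surj L"
  proof -
    have "\<exists>v. L v = y" for y
      by (rule filtered_onto[OF L lead, of "fls_subdegree y - d" y]) (auto simp: ord_ge_subdegree)
    then show ?thesis by (metis surjI someI_ex)
  qed
  ultimately show bij: "bij L" by (rule bijI)
  have inv: "L (inv L y) = y" for y using \<open>surj L\<close> by (simp add: surj_f_inv_f)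
  have inv': "inv L (L y) = y" for y using \<open>inj L\<close> by simp
  show "filtered (- d) (inv L)"
  proof (rule filteredI)
    fix u v :: "'a fls" show "inv L (u + v) = inv L u + inv L v"
      by (metis filtered_add[OF L] inv inv')
  next
    fix c and v :: "'a fls" show "inv L (fls_const c * v) = fls_const c * inv L v"
      by (metis filtered_scale[OF L] inv inv')
  next
    fix k and v :: "'a fls" assume "ord_ge k v"
    then show "ord_ge (k + - d) (inv L v)"
      using filtered_ord_iff[OF L lead, of "k - d" "inv L v"] by (simp add: inv)
  qed
qed

lemma filtered_inv_lead:
  assumes L: "filtered d L" and lead: "\<And>j. L (fls_X_intpow j) $$ (j + d) \<noteq> 0"
  shows "inv L (fls_X_intpow j) $$ (j - d) \<noteq> 0"
proof -
  let ?y = "inv L (fls_X_intpow j)"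
  have "ord_ge (j - d) ?y"
    using filtered_ord[OF filtered_bij(2)[OF L lead] ord_ge_X_intpow, of j] by simp
  then have "L ?y $$ (j - d + d) = ?y $$ (j - d) * L (fls_X_intpow (j - d)) $$ (j - d + d)"
    by (rule filtered_nth_lowest[OF L])
  moreover have "L ?y = fls_X_intpow j"
    using filtered_bij(1)[OF L lead] by (simp add: bij_is_surj surj_f_inv_f)
  ultimately show ?thesis by auto
qed

text \<open>
  A map that is already known to be continuous raises orders as much as it does on the powers of the
  indeterminate.
\<close>

lemma filtered_improve:
  assumes L: "filtered d L" and X: "\<And>j. ord_ge (j + e) (L (fls_X_intpow j))"
  shows "filtered e L"
proof (rule filteredI)
  fix k and v :: "'a fls" assume v: "ord_ge k v"
  have "L v $$ N = 0" if "N < k + e" for N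
    unfolding filtered_nth[OF L v] using that X by (intro sum.neutral) (auto simp: ord_ge_def)
  then show "ord_ge (k + e) (L v)" by (simp add: ord_ge_def)
qed (simp_all add: filtered_add[OF L] filtered_scale[OF L])

text \<open>
  One vanishing leading coefficient gives a kernel element: \<open>L(t\<^sup>m)\<close> has order above \<open>m + d\<close>, so it is also
  the image of a series of order above \<open>m\<close>. This is used twice, to produce a horizontal section when
  the exponent is resonant, and to solve a homogeneous difference equation.
\<close>

lemma filtered_kernel:
  assumes L: "filtered d L" and m: "L (fls_X_intpow m) $$ (m + d) = 0"
    and lead: "\<And>j. j > m \<Longrightarrow> L (fls_X_intpow j) $$ (j + d) \<noteq> 0"
  obtains h where "ord_ge m h" "h $$ m = 1" "L h = 0"
proof -
  have "ord_ge (m + 1 + d) (L (fls_X_intpow m))"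
    using filtered_ord[OF L, of m "fls_X_intpow m"] m
    by (auto simp: ord_ge_def) (metis add.commute add.left_commute zless_add1_eq)
  then obtain v where v: "ord_ge (m + 1) v" "L v = L (fls_X_intpow m)"
    using filtered_onto[OF L, of "m + 1" "L (fls_X_intpow m)"] lead by auto
  show ?thesis
    by (rule that[of "fls_X_intpow m - v"])
      (use v in \<open>auto simp: filtered_diff[OF L] ord_ge_def\<close>)
qed

lemma filtered_of_family:
  assumes e: "\<And>j. ord_ge (j + d) (e j)"
  obtains L where "filtered d L" "\<And>j. L (fls_X_intpow j) = (e j :: 'a::field fls)"
proof -
  define c where "c v N = (\<Sum>j=fls_subdegree v..N - d. v $$ j * e j $$ N)" for v N
  define L where "L v = Abs_fls (c v)" for v
  have c_eq: "c v N = (\<Sum>j=k..N - d. v $$ j * e j $$ N)" if "ord_ge k v" for v k N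
  proof (cases "v = 0")
    case False
    with that have "k \<le> fls_subdegree v" by (simp add: ord_ge_iff_subdegree)
    then show ?thesis unfolding c_def by (intro sum.mono_neutral_left) auto
  qed (simp add: c_def)
  have L_nth: "L v $$ N = c v N" for v N
  proof -
    have "\<forall>N < fls_subdegree v + d. c v N = 0" by (simp add: c_def)
    then show ?thesis unfolding L_def by (rule nth_Abs_fls_lower_bound)
  qed
  have "filtered d L"
  proof (rule filteredI)
    fix u v :: "'a fls"
    define k where "k = min (fls_subdegree u) (fls_subdegree v)"
    have k: "ord_ge k u" "ord_ge k v"
      by (auto intro!: ord_ge_mono[OF ord_ge_subdegree] simp: k_def)
    then have k': "ord_ge k (u + v)" by (rule ord_ge_add)
    show "L (u + v) = L u + L v"
      by (rule fls_eqI) (simp add: L_nth c_eq[OF k(1)] c_eq[OF k(2)] c_eq[OF k'] algebra_simps sum.distrib)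
  next
    fix a and v :: "'a fls"
    show "L (fls_const a * v) = fls_const a * L v"
      using ord_ge_subdegree[of v] ord_ge_const_mult[OF ord_ge_subdegree[of v], of a]
      by (intro fls_eqI) (simp add: L_nth c_eq sum_distrib_left mult.assoc)
  next
    fix k and v :: "'a fls" assume "ord_ge k v"
    then show "ord_ge (k + d) (L v)"
      by (auto simp: ord_ge_def L_nth c_eq[OF \<open>ord_ge k v\<close>])
  qed
  moreover have "L (fls_X_intpow j) = e j" for j
  proof (rule fls_eqI)
    fix N
    have "L (fls_X_intpow j) $$ N = (\<Sum>i=j..N - d. fls_X_intpow j $$ i * e i $$ N)"
      unfolding L_nth by (rule c_eq) simp
    also have "\<dots> = (\<Sum>i=j..N - d. if i = j then e j $$ N else 0)"
      by (intro sum.cong) auto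
    also have "\<dots> = e j $$ N" using e[of j] by (auto simp: ord_ge_def)
    finally show "L (fls_X_intpow j) $$ N = e j $$ N" .
  qed
  ultimately show ?thesis by (rule that)
qed

lemma filtered_compose:
  fixes w :: "'a::field fps"
  assumes w: "w $ 0 = 0" "w $ 1 \<noteq> 0"
  shows "filtered 0 (\<lambda>v. fls_compose_fps v w)"
proof -
  have w': "w \<noteq> 0" and "subdegree w = 1" using w by (auto intro!: subdegreeI)
  then show ?thesis
    by (intro filteredI)
      (auto simp: fls_compose_fps_add[OF w' w(1)] fls_compose_fps_mult[OF w' w(1)]
        ord_ge_iff_subdegree w(1))
qed

lemma mult_nth_finite_sum:
  fixes u v :: "'a::field fls"
  assumes u: "ord_ge a u" and v: "ord_ge b v"
  shows "(u * v) $$ N = (\<Sum>i=a..N - b. u $$ i * v $$ (N - i))"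
proof -
  have "(v * u) $$ N = (\<Sum>i=a..N - b. u $$ i * (v * fls_X_intpow i) $$ N)"
    by (rule filtered_nth[OF filtered_mult[OF v] u])
  then show ?thesis by (simp add: mult.commute[of v] X_intpow_mult_nth)
qed

section \<open>The difference automorphism\<close>

text \<open>
  The series \<open>(1 + t\<^sup>n)\<^sup>c\<close>.
\<close>

definition binom_fls :: "nat \<Rightarrow> 'a::field_char_0 \<Rightarrow> 'a fls" where
  "binom_fls n c = fps_to_fls (fps_binomial c oo fps_X ^ n)"

lemma X_power_nth_0: "n > 0 \<Longrightarrow> (fps_X ^ n :: 'a::field fps) $ 0 = 0"
  by simp

lemma binom_fls_add: "n > 0 \<Longrightarrow> binom_fls n (c + d) = binom_fls n c * binom_fls n d"
  by (simp add: binom_fls_def fps_binomial_add_mult fps_compose_mult_distrib X_power_nth_0 fls_times_fps_to_fls)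

lemma binom_fls_0: "binom_fls n 0 = 1"
  by (simp add: binom_fls_def)

lemma binom_fls_nz: "n > 0 \<Longrightarrow> binom_fls n c \<noteq> 0"
  using binom_fls_add[of n c "- c"] binom_fls_0[of n, where 'a = 'a] by (metis add.right_inverse mult_zero_left zero_neq_one)

lemma binom_fls_powi: "n > 0 \<Longrightarrow> binom_fls n c powi j = binom_fls n (of_int j * c)"
proof -
  assume n: "n > 0"
  have nat: "binom_fls n c ^ k = binom_fls n (of_nat k * c)" for k and c :: 'a
    by (induction k) (simp_all add: binom_fls_0 algebra_simps binom_fls_add[OF n])
  have inv: "inverse (binom_fls n c) = binom_fls n (- c)"
    using binom_fls_add[OF n, of c "- c"] binom_fls_nz[OF n, of c] by (simp add: binom_fls_0 field_simps)
  show ?thesis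
  proof (cases "j \<ge> 0")
    case False
    then have "of_int j = - (of_nat (nat (- j)) :: 'a)" by simp
    then show ?thesis using False by (simp add: power_int_def inv nat)
  qed (simp add: power_int_def nat)
qed

lemma binom_fls_nth:
  "n > 0 \<Longrightarrow> binom_fls n c $$ m = (if m \<ge> 0 \<and> int n dvd m then c gchoose nat (m div int n) else 0)"
proof (cases "m \<ge> 0")
  case True
  then obtain k where "m = int k" by (rule nonneg_int_cases)
  then show ?thesis by (simp add: binom_fls_def fps_nth_compose_X_power flip: zdiv_int)
qed (simp add: binom_fls_def)

lemma binom_fls_1: "n > 0 \<Longrightarrow> binom_fls n 1 = 1 + fls_X_intpow (int n)"
proof -
  assume n: "n > 0"
  have "fps_binomial 1 oo fps_X ^ n = (1 + fps_X ^ n :: 'a fps)"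
    using n by (simp add: fps_binomial_1 fps_compose_add_distrib)
  then show ?thesis by (simp add: binom_fls_def fps_to_fls_power fls_X_power_conv_shift_1)
qed

lemma shift_series:
  "n > 0 \<Longrightarrow> fps_X * (fps_binomial (- 1 / of_nat n) oo fps_X ^ n) \<noteq> (0 :: 'a::field_char_0 fps)"
  "(fps_X * (fps_binomial (- 1 / of_nat n) oo fps_X ^ n) :: 'a fps) $ 0 = 0"
  "n > 0 \<Longrightarrow> (fps_X * (fps_binomial (- 1 / of_nat n) oo fps_X ^ n) :: 'a fps) $ 1 = 1"
  using binom_fls_nz[of n "- (1 / of_nat n) :: 'a"] by (auto simp: binom_fls_def)

lemma shift_filtered: "n > 0 \<Longrightarrow> filtered 0 (ramified_shift_aut n)"
  unfolding ramified_shift_aut_def by (rule filtered_compose) (use shift_series[of n] in simp_all)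

lemma shift_mult: "n > 0 \<Longrightarrow> ramified_shift_aut n (u * v) = ramified_shift_aut n u * ramified_shift_aut n v"
  unfolding ramified_shift_aut_def by (rule fls_compose_fps_mult) (use shift_series[of n] in simp_all)

lemma shift_X_intpow:
  "n > 0 \<Longrightarrow> ramified_shift_aut n (fls_X_intpow j) = fls_X_intpow j * binom_fls n (- of_int j / of_nat n)"
proof -
  assume n: "n > 0"
  have "ramified_shift_aut n (fls_X_intpow j :: 'a fls) = ramified_shift_aut n (fls_X powi j)"
    by simp
  also have "\<dots> = fps_to_fls (fps_X * (fps_binomial (- 1 / of_nat n) oo fps_X ^ n)) powi j"
    unfolding ramified_shift_aut_def using n
    by (subst fls_compose_fps_powi) (use shift_series[of n] in simp_all)
  also have "\<dots> = fls_X_intpow j * binom_fls n (- 1 / of_nat n) powi j"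
    by (simp add: fls_times_fps_to_fls power_int_mult_distrib binom_fls_def)
  finally show ?thesis using n by (simp add: binom_fls_powi)
qed

lemma shift_lead: "n > 0 \<Longrightarrow> ramified_shift_aut n (fls_X_intpow j) $$ (j + 0) \<noteq> 0"
  by (simp add: shift_X_intpow X_intpow_mult_nth binom_fls_nth)

text \<open>
  With \<open>\<theta> = t\<^sup>n\<close> this is \<open>\<phi>(\<theta>\<^sup>-\<^sup>1) = \<theta>\<^sup>-\<^sup>1 + 1\<close>: the automorphism is the translation of \<open>\<theta>\<^sup>-\<^sup>1\<close>.
\<close>

lemma shift_X_minus_n: "n > 0 \<Longrightarrow> ramified_shift_aut n (fls_X_intpow (- int n)) = fls_X_intpow (- int n) + 1"
  by (simp only: shift_X_intpow)
    (simp add: binom_fls_1 distrib_left X_intpow_add[symmetric, of "- int n" "int n", simplified])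

section \<open>Families depending polynomially on the exponent\<close>

text \<open>
  Families \<open>v\<^sub>j\<close> of the form \<open>t\<^sup>j \<Sum>\<^sub>m c\<^sub>m(j) t\<^sup>m\<close> with polynomials \<open>c\<^sub>m\<close>. An identity between two of them
  needs to be checked only for infinitely many \<open>j\<close>.
\<close>

definition poly_family :: "(int \<Rightarrow> 'a::field_char_0 fls) \<Rightarrow> bool" where
  "poly_family v \<longleftrightarrow> (\<exists>c :: int \<Rightarrow> 'a poly. \<forall>j m. v j $$ (j + m) = (if m < 0 then 0 else poly (c m) (of_int j)))"

lemma poly_familyI:
  "(\<And>j m. v j $$ (j + m) = (if m < 0 then 0 else poly (c m) (of_int j))) \<Longrightarrow> poly_family v"
  unfolding poly_family_def by (rule exI[of _ c]) blast

lemma poly_family_ord: "poly_family v \<Longrightarrow> ord_ge j (v j)"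
proof -
  assume "poly_family v"
  then obtain c :: "int \<Rightarrow> 'a poly" where "\<And>j m. v j $$ (j + m) = (if m < 0 then 0 else poly (c m) (of_int j))"
    unfolding poly_family_def by blast
  from this[of j "i - j" for i] show ?thesis by (auto simp: ord_ge_def)
qed

lemma poly_family_apply:
  assumes L: "filtered 0 L" "poly_family (\<lambda>i. L (fls_X_intpow i))" and v: "poly_family v"
  shows "poly_family (\<lambda>j. L (v j))"
proof -
  obtain p :: "int \<Rightarrow> 'a poly" where
    p: "\<And>j m. L (fls_X_intpow j) $$ (j + m) = (if m < 0 then 0 else poly (p m) (of_int j))"
    using L(2) unfolding poly_family_def by blast
  obtain c :: "int \<Rightarrow> 'a poly" where c: "\<And>j m. v j $$ (j + m) = (if m < 0 then 0 else poly (c m) (of_int j))"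
    using v unfolding poly_family_def by blast
  have "L (v j) $$ (j + m) = (if m < 0 then 0 else
      poly (\<Sum>k=0..m. c k * pcompose (p (m - k)) [:of_int k, 1:]) (of_int j))" for j m
  proof -
    have "L (v j) $$ (j + m) = (\<Sum>i=j..j + m - 0. v j $$ i * L (fls_X_intpow i) $$ (j + m))"
      by (rule filtered_nth[OF L(1) poly_family_ord[OF v]])
    also have "\<dots> = (\<Sum>k=0..m. v j $$ (j + k) * L (fls_X_intpow (j + k)) $$ ((j + k) + (m - k)))"
      by (rule sum.reindex_bij_witness[of _ "\<lambda>k. j + k" "\<lambda>i. i - j"]) (auto simp: algebra_simps)
    also have "\<dots> = (\<Sum>k=0..m. poly (c k) (of_int j) * poly (p (m - k)) (of_int (j + k)))"
      unfolding p c by (intro sum.cong refl) (simp add: p c)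
    also have "\<dots> = (if m < 0 then 0 else
      poly (\<Sum>k=0..m. c k * pcompose (p (m - k)) [:of_int k, 1:]) (of_int j))"
      by (simp add: poly_sum poly_pcompose add.commute)
    finally show ?thesis .
  qed
  then show ?thesis by (rule poly_familyI)
qed

lemma poly_family_const_mult: "ord_ge 0 z \<Longrightarrow> poly_family (\<lambda>j. z * fls_X_intpow j)"
proof -
  assume z: "ord_ge 0 z"
  then have "(z * fls_X_intpow j) $$ (j + m) = (if m < 0 then 0 else poly [:z $$ m:] (of_int j))" for j m
    by (simp add: mult.commute[of z] X_intpow_mult_nth ord_ge_def)
  then show ?thesis by (rule poly_familyI)
qed

lemma poly_family_mult: "ord_ge 0 z \<Longrightarrow> poly_family v \<Longrightarrow> poly_family (\<lambda>j. z * v j)"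
  by (rule poly_family_apply[OF filtered_mult poly_family_const_mult])

lemma gbinomial_poly: "\<exists>p. \<forall>a::'a::field_char_0. poly p a = (c * a) gchoose k"
  by (rule exI[of _ "smult (1 / fact k) (\<Prod>i=0..<k. [:- of_nat i, c:])"])
    (simp add: gbinomial_prod_rev poly_prod mult.commute)

lemma poly_family_shift: "n > 0 \<Longrightarrow> poly_family (\<lambda>j. ramified_shift_aut n (fls_X_intpow j))"
proof -
  assume n: "n > 0"
  have "\<exists>p. \<forall>a::'a. poly p a = (- 1 / of_nat n * a) gchoose k" for k by (rule gbinomial_poly)
  then obtain p :: "nat \<Rightarrow> 'a poly" where p: "\<And>k a. poly (p k) a = (- 1 / of_nat n * a) gchoose k"
    by metis
  have "ramified_shift_aut n (fls_X_intpow j) $$ (j + m) = (if m < 0 then 0 else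
      poly (if int n dvd m then p (nat (m div int n)) else 0) (of_int j))" for j m
    using n by (simp add: shift_X_intpow X_intpow_mult_nth binom_fls_nth p)
  then show ?thesis by (rule poly_familyI)
qed

lemma poly_eq_0_if_zero_on_multiples:
  fixes p :: "'a::field_char_0 poly"
  assumes n: "n > 0" and "\<And>k. poly p (of_int (int n * int k)) = 0"
  shows "p = 0"
proof (rule ccontr)
  assume "p \<noteq> 0"
  then have "finite {x. poly p x = 0}" by (rule poly_roots_finite)
  moreover have "range (\<lambda>k. of_int (int n * int k)) \<subseteq> {x. poly p x = 0}" using assms by auto
  ultimately have "finite (range (\<lambda>k. of_int (int n * int k) :: 'a))" by (rule rev_finite_subset)
  moreover have "inj (\<lambda>k. of_int (int n * int k) :: 'a)"
    using n by (intro injI) (simp del: of_int_mult of_int_of_nat_eq)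
  ultimately show False by (simp add: finite_image_iff)
qed

lemma poly_family_eqI:
  assumes u: "poly_family u" and v: "poly_family v" and n: "n > 0"
    and eq: "\<And>k. u (int n * int k) = v (int n * int k)"
  shows "u j = v j"
proof (rule fls_eqI)
  fix N
  obtain c :: "int \<Rightarrow> 'a poly" where c: "\<And>j m. u j $$ (j + m) = (if m < 0 then 0 else poly (c m) (of_int j))"
    using u unfolding poly_family_def by blast
  obtain d :: "int \<Rightarrow> 'a poly" where d: "\<And>j m. v j $$ (j + m) = (if m < 0 then 0 else poly (d m) (of_int j))"
    using v unfolding poly_family_def by blast
  have "c m - d m = 0" if "m \<ge> 0" for m
  proof (rule poly_eq_0_if_zero_on_multiples[OF n])
    fix k
    show "poly (c m - d m) (of_int (int n * int k)) = 0"
      using c[of "int n * int k" m] d[of "int n * int k" m] that by (simp add: eq)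
  qed
  then show "u j $$ N = v j $$ N"
    using c[of j "N - j"] d[of j "N - j"] by auto
qed

text \<open>
  A periodic polynomial takes its value at 0 infinitely often.
\<close>

lemma periodic_poly_const:
  fixes p :: "'a::field_char_0 poly"
  assumes n: "n > 0" and p: "pcompose p [:of_nat n, 1:] = p"
  shows "poly p a = poly p b"
proof -
  have per: "poly p (y + of_nat n) = poly p y" for y
    using arg_cong[OF p, of "\<lambda>q. poly q y"] by (simp add: poly_pcompose add.commute)
  have "poly p (of_int (int n * int k)) = poly p 0" for k
  proof (induction k)
    case (Suc k)
    then show ?case using per[of "of_int (int n * int k)"] by (simp add: algebra_simps)
  qed simp
  then have "p - [:poly p 0:] = 0"
    by (intro poly_eq_0_if_zero_on_multiples[OF n]) simp
  then have "p = [:poly p 0:]" by simp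
  then have "poly p y = poly p 0" for y by (metis poly_const_conv)
  then show ?thesis by metis
qed

text \<open>
  In characteristic 0 the difference operator lowers degrees by exactly one, so leading terms can be
  removed one after the other.
\<close>

lemma poly_difference_equation:
  fixes R :: "'a::field_char_0 poly"
  assumes n: "n > 0"
  shows "\<exists>p. pcompose p [:of_nat n, 1:] - p = R"
proof -
  have "\<exists>p. pcompose p [:of_nat n, 1:] - p = R" if "\<And>i. i \<ge> d \<Longrightarrow> coeff R i = 0" for d and R :: "'a poly"
    using that
  proof (induction d arbitrary: R)
    case 0
    then have "R = 0" by (intro poly_eqI) auto
    then show ?case by (intro exI[of _ 0]) simp
  next
    case (Suc d)
    define c where "c = coeff R d / (of_nat (Suc d) * of_nat n)"
    \<comment> \<open>The difference of \<open>c X\<^sup>d\<^sup>+\<^sup>1\<close>, whose coefficient at \<open>d\<close> is \<open>c (d + 1) n\<close>.\<close>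
    define q :: "'a poly" where "q = smult c ([:of_nat n, 1:] ^ Suc d - [:0, 1:] ^ Suc d)"
    have q: "q = pcompose (smult c ([:0, 1:] ^ Suc d)) [:of_nat n, 1:] - smult c ([:0, 1:] ^ Suc d)"
      unfolding q_def by (simp add: fun_eq_iff poly_pcompose algebra_simps flip: poly_eq_poly_eq_iff)
    have "coeff (R - q) i = 0" if "i \<ge> d" for i
    proof -
      from that consider "i = d" | "i = Suc d" | "i > Suc d" by force
      then show ?thesis
      proof cases
        case 1
        have "Suc d choose d = Suc d" by (metis binomial_Suc_n)
        then show ?thesis using n 1 unfolding q_def
          by (simp add: coeff_linear_poly_power c_def del: power_Suc of_nat_Suc)
      next
        case 2
        then show ?thesis using Suc.prems[of i] unfolding q_def
          by (simp add: coeff_linear_poly_power del: power_Suc)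
      next
        case 3
        then show ?thesis using Suc.prems[of i] unfolding q_def
          by (simp add: coeff_eq_0 degree_linear_power del: power_Suc)
      qed
    qed
    from Suc.IH[OF this] obtain p where p: "pcompose p [:of_nat n, 1:] - p = R - q" by blast
    show ?case
      by (rule exI[of _ "p + smult c ([:0, 1:] ^ Suc d)"])
        (use p q in \<open>simp only: pcompose_add, simp add: algebra_simps\<close>)
  qed
  from this[of "Suc (degree R)" R] show ?thesis by (simp add: coeff_eq_0)
qed

section \<open>The connection in the coordinate of the solution\<close>

text \<open>
  The left-hand side is \<open>b (p\<^sub>s(r) - p\<^sub>s(0))\<close> for the quadratic polynomial \<open>p\<^sub>s\<close> of \<open>intertwiner_ramified\<close>, with
  \<open>R = r\<close> and \<open>S = s\<close>; the term \<open>xs/(2(r+s))\<close> of \<open>g\<close> originates here.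
\<close>

lemma quadratic_correction:
  fixes R S x b :: "'a::field_char_0"
  assumes "R \<noteq> 0" "b \<noteq> 0" "R + S \<noteq> 0"
  shows "b * (x / (R * b) / (2 * (R + S)) * (R * (R + (R + S)))) = - (x * S / (2 * (R + S)) - x)"
proof -
  have "b * (x / (R * b) / (2 * M) * (R * (R + M))) = - (x * (M - R) / (2 * M) - x)" if "M \<noteq> 0" for M
    using assms(1,2) that by (simp add: field_simps)
  from this[of "R + S"] assms(3) show ?thesis by simp
qed

text \<open>
  What remains of the connection after the substitution \<open>u = w(t)\<close> is the series \<open>Z = x + w\<^sup>r\<close>, which begins
  with \<open>x + b t\<^sup>r\<close>. In a Mellin integral, \<open>t\<close> is the coordinate in which the
  saddle point is at \<open>\<theta>\<^sup>-\<^sup>1 = t\<^sup>-\<^sup>n\<close>.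
\<close>

locale saddle =
  fixes r s n :: nat and x b :: "'a::field_char_0" and Z :: "'a fls"
  assumes n: "n = r + s" and r: "r > 0" and x: "x \<noteq> 0" and b: "b \<noteq> 0"
    and Z_ord: "ord_ge 0 Z" and Z_0: "Z $$ 0 = x" and Z_r: "Z $$ int r = b"
    and Z_gap: "\<And>i. 0 < i \<Longrightarrow> i < int r \<Longrightarrow> Z $$ i = 0"
begin

text \<open>
  Since \<open>z = Z(t)\<close>, the derivation \<open>z d/dz\<close> is \<open>P d/dt\<close>; the constant \<open>c\<close> below is the leading coefficient
  of \<open>P\<close>, and \<open>D\<close> is \<open>z\<nabla>\<close>.
\<close>

definition P :: "'a fls" where "P = Z / fls_deriv Z"

definition c :: 'a where "c = x / (of_nat r * b)"

definition D :: "'a fls \<Rightarrow> 'a fls" where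
  "D v = P * fls_deriv v - fls_X_intpow (- int n) * v"

lemma n_pos: "n > 0" and c_nz: "c \<noteq> 0"
  using n r x b by (auto simp: c_def)

lemma int_n: "int n = int r + int s"
  using n by simp

lemma deriv_Z: "fls_deriv Z \<noteq> 0" "fls_subdegree (fls_deriv Z) = int r - 1"
proof -
  have *: "fls_deriv Z $$ (int r - 1) \<noteq> 0" using r b Z_r by simp
  then show "fls_deriv Z \<noteq> 0" by (metis fls_zero_nth)
  show "fls_subdegree (fls_deriv Z) = int r - 1"
  proof (rule fls_subdegree_eqI[OF *])
    fix k assume "k < int r - 1"
    then show "fls_deriv Z $$ k = 0"
      using Z_gap[of "k + 1"] ord_geD[OF Z_ord, of "k + 1"] by (cases "k + 1" "0::int" rule: linorder_cases) auto
  qed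
qed

lemma Z_nz: "Z \<noteq> 0"
  using Z_0 x by auto

lemma Z_subdegree: "fls_subdegree Z = 0"
  using Z_0 x Z_ord by (intro fls_subdegree_eqI) (auto simp: ord_ge_def)

lemma P_ord: "ord_ge (1 - int r) P"
  using deriv_Z Z_nz by (simp add: P_def ord_ge_iff_subdegree divide_inverse Z_subdegree)

lemma P_lead: "P $$ (1 - int r) = c"
proof -
  have "(P * fls_deriv Z) $$ ((1 - int r) + (int r - 1)) = P $$ (1 - int r) * fls_deriv Z $$ (int r - 1)"
    using deriv_Z by (intro mult_nth_lowest P_ord) (simp add: ord_ge_iff_subdegree)
  then have "x = P $$ (1 - int r) * (of_nat r * b)"
    using deriv_Z Z_0 Z_r by (simp add: P_def)
  then show ?thesis using r b unfolding c_def by (simp add: field_simps)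
qed

lemma D_filtered: "filtered (- int n) D"
proof -
  have "filtered (- int r) (\<lambda>v. P * fls_deriv v)"
    using filtered_comp[OF filtered_deriv filtered_mult[OF P_ord]] by simp
  then show ?thesis unfolding D_def
    by (intro filtered_minus filtered_mult ord_ge_X_intpow) (auto elim: filtered_mono simp: int_n)
qed

lemma deriv_X_intpow: "fls_deriv (fls_X_intpow j :: 'a fls) = fls_const (of_int j) * fls_X_intpow (j - 1)"
proof (rule fls_eqI)
  fix i
  show "fls_deriv (fls_X_intpow j) $$ i = (fls_const (of_int j) * fls_X_intpow (j - 1)) $$ i"
    by (cases "j = i + 1") auto
qed

text \<open>
  The derivation raises orders by \<open>-r\<close>, multiplication by \<open>t\<^sup>-\<^sup>n\<close> by \<open>-r - s\<close>. So the derivation is a small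
  perturbation for \<open>s > 0\<close>, whereas both parts contribute for \<open>s = 0\<close>.
\<close>

lemma D_lead: "D (fls_X_intpow j) $$ (j - int n) = (if s = 0 then of_int j * c else 0) - 1"
proof -
  have *: "P * fls_deriv (fls_X_intpow j) = fls_const (of_int j) * (fls_X_intpow (j - 1) * P)"
    unfolding deriv_X_intpow by (simp only: ac_simps)
  have "(P * fls_deriv (fls_X_intpow j)) $$ (j - int n) = of_int j * P $$ (1 - int r - int s)"
    unfolding * by (simp add: shift_one_mult_nth int_n, simp add: algebra_simps)
  also have "\<dots> = (if s = 0 then of_int j * c else 0)"
    using P_lead ord_geD[OF P_ord, of "1 - int r - int s"] by auto
  finally show ?thesis by (simp add: D_def shift_one_mult_nth)
qed

lemma D_Z_mult: "D (Z * v) = Z * (D v + v)"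
proof -
  have "P * fls_deriv Z = Z" using deriv_Z by (simp add: P_def)
  then have "P * (fls_deriv Z * v) = Z * v" by (simp flip: mult.assoc)
  then show ?thesis by (simp add: D_def fls_deriv_mult algebra_simps)
qed

text \<open>
  The equations that \<open>-D \<Psi>(t\<^sup>j\<^sup>+\<^sup>n) = \<Psi>(t\<^sup>j)\<close> imposes on the coefficients of
  \<open>\<Psi>(t\<^sup>j) = t\<^sup>j \<Sum>\<^sub>k p\<^sub>k(j) t\<^sup>k\<close>. For \<open>s > 0\<close> the right-hand side involves only earlier polynomials.
\<close>

lemma ramified_family:
  assumes s: "s > 0"
  obtains p :: "nat \<Rightarrow> 'a poly" where "p 0 = 1"
    "\<And>m. pcompose (p m) [:of_nat n, 1:] - p m =
      (\<Sum>k\<in>{k. k + s \<le> m}. smult (P $$ (1 - int n + int m - int k))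
        ([:of_nat n + of_nat k, 1:] * pcompose (p k) [:of_nat n, 1:]))"
proof -
  define rhs where "rhs p m = (\<Sum>k\<in>{k. k + s \<le> m}. smult (P $$ (1 - int n + int m - int k))
        ([:of_nat n + of_nat k, 1:] * pcompose (p k) [:of_nat n, 1:]))" for p :: "nat \<Rightarrow> 'a poly" and m
  have "\<exists>p. \<forall>m. (m = 0 \<longrightarrow> p m = 1) \<and> pcompose (p m) [:of_nat n, 1:] - p m = rhs p m"
  proof (rule dependent_wellorder_choice)
    fix q :: "'a poly" and f g :: "nat \<Rightarrow> 'a poly" and m
    assume *: "\<And>k. k < m \<Longrightarrow> f k = g k"
    have "rhs f m = rhs g m" unfolding rhs_def
      by (intro sum.cong refl) (use s in \<open>simp add: *\<close>)
    then show "((m = 0 \<longrightarrow> q = 1) \<and> pcompose q [:of_nat n, 1:] - q = rhs f m) \<longleftrightarrow>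
        ((m = 0 \<longrightarrow> q = 1) \<and> pcompose q [:of_nat n, 1:] - q = rhs g m)" by simp
  next
    fix f :: "nat \<Rightarrow> 'a poly" and m
    show "\<exists>q. (m = 0 \<longrightarrow> q = 1) \<and> pcompose q [:of_nat n, 1:] - q = rhs f m"
    proof (cases "m = 0")
      case True
      then have "rhs f m = 0" using s by (simp add: rhs_def)
      then show ?thesis by (intro exI[of _ 1]) (simp add: one_poly_def[symmetric] pcompose_1)
    next
      case False
      then show ?thesis using poly_difference_equation[OF n_pos, of "rhs f m"] by auto
    qed
  qed
  then show ?thesis using that unfolding rhs_def by blast
qed

text \<open>
  The nonzero leading coefficients make \<open>\<Psi>\<close> a bijection whose inverse preserves orders as well.
\<close>

definition intertwiner :: "('a fls \<Rightarrow> 'a fls) \<Rightarrow> bool" where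
  "intertwiner \<Psi> \<longleftrightarrow> filtered 0 \<Psi> \<and> (\<forall>j. \<Psi> (fls_X_intpow j) $$ j \<noteq> 0) \<and>
     (\<forall>v. D (\<Psi> (fls_X_intpow (int n) * v)) = - \<Psi> v)"

lemma intertwinerI:
  assumes "filtered 0 \<Psi>" "\<And>j. \<Psi> (fls_X_intpow j) $$ j \<noteq> 0"
    "\<And>j. D (\<Psi> (fls_X_intpow (j + int n))) = - \<Psi> (fls_X_intpow j)"
  shows "intertwiner \<Psi>"
proof -
  have "filtered (int n + 0 + - int n) (\<lambda>v. D (\<Psi> (fls_X_intpow (int n) * v)))"
    by (intro filtered_comp[OF filtered_comp] D_filtered assms filtered_mult ord_ge_X_intpow)
  moreover have "filtered (int n + 0 + - int n) (\<lambda>v. - \<Psi> v)"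
    using filtered_neg[OF assms(1)] by simp
  ultimately have "(\<lambda>v. D (\<Psi> (fls_X_intpow (int n) * v))) = (\<lambda>v. - \<Psi> v)"
    by (rule filtered_ext) (simp only: X_intpow_add[symmetric] add.commute[of "int n"] assms(3))
  then have "D (\<Psi> (fls_X_intpow (int n) * v)) = - \<Psi> v" for v by (rule fun_cong)
  then show ?thesis using assms(1,2) by (simp add: intertwiner_def)
qed

text \<open>
  The last two clauses describe the part of \<open>\<Psi>\<close> that determines \<open>\<Phi>(1)\<close> modulo \<open>o(\<theta>)\<close>. The equation for
  \<open>p\<^sub>s\<close> is \<open>p\<^sub>s(X + n) - p\<^sub>s(X) = c (X + n)\<close>, which \<open>c X (X + n) / (2n)\<close> solves as well; solutions differ
  by periodic polynomials, that is, by constants.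
\<close>

lemma intertwiner_ramified:
  assumes s: "s > 0"
  obtains \<Psi> p where "intertwiner \<Psi>"
    "\<And>j m. \<Psi> (fls_X_intpow j) $$ (j + m) = (if m < 0 then 0 else poly (p (nat m)) (of_int j))"
    "p 0 = 1" "\<And>m i j. m < s \<Longrightarrow> poly (p m) i = poly (p m) j"
    "\<And>i j. poly (p s) i - poly (p s) j =
        c / (2 * of_nat n) * (i * (i + of_nat n) - j * (j + of_nat n))"
proof -
  obtain p :: "nat \<Rightarrow> 'a poly" where p0: "p 0 = 1" and p:
    "\<And>m. pcompose (p m) [:of_nat n, 1:] - p m =
      (\<Sum>k\<in>{k. k + s \<le> m}. smult (P $$ (1 - int n + int m - int k))
        ([:of_nat n + of_nat k, 1:] * pcompose (p k) [:of_nat n, 1:]))"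
    using ramified_family[OF s] by blast
  define e where "e j = fls_shift (- j) (fps_to_fls (Abs_fps (\<lambda>k. poly (p k) (of_int j))))" for j
  have e: "e j $$ (j + m) = (if m < 0 then 0 else poly (p (nat m)) (of_int j))" for j m
    by (simp add: e_def)
  have e_ord: "ord_ge (j + 0) (e j)" for j
    by (simp add: e_def ord_ge_def)
  obtain \<Psi> where \<Psi>: "filtered 0 \<Psi>" "\<And>j. \<Psi> (fls_X_intpow j) = e j"
    using filtered_of_family[of 0 e] e_ord by blast
  have D_e: "D (e (j + int n)) = - e j" for j
  proof (rule fls_eqI)
    fix N
    define m where "m = N - j"
    let ?J = "of_int (j + int n) :: 'a"
    have N: "N = j + m" by (simp add: m_def)
    have d_ord: "ord_ge (j + int n - 1) (fls_deriv (e (j + int n)))"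
      using filtered_ord[OF filtered_deriv e_ord[of "j + int n"]] by simp
    have "(P * fls_deriv (e (j + int n))) $$ N
        = (\<Sum>i=j + int n - 1..N - (1 - int r). fls_deriv (e (j + int n)) $$ i * P $$ (N - i))"
      using mult_nth_finite_sum[OF d_ord P_ord] by (simp add: mult.commute)
    also have "\<dots> = (\<Sum>k\<in>{k. int k + int s \<le> m}.
        fls_deriv (e (j + int n)) $$ (j + int n - 1 + int k) * P $$ (m - int n + 1 - int k))"
      by (rule sum.reindex_bij_witness[of _ "\<lambda>k. j + int n - 1 + int k" "\<lambda>i. nat (i - (j + int n - 1))"])
        (auto simp: N int_n algebra_simps)
    also have "\<dots> = (\<Sum>k\<in>{k. int k + int s \<le> m}.
        P $$ (1 - int n + m - int k) * ((?J + of_nat k) * poly (p k) ?J))"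
    proof (intro sum.cong refl)
      fix k
      have "fls_deriv (e (j + int n)) $$ (j + int n - 1 + int k) = (?J + of_nat k) * poly (p k) ?J"
        using e[of "j + int n" "int k"] by (simp add: algebra_simps)
      moreover have "m - int n + 1 - int k = 1 - int n + m - int k" by simp
      ultimately show "fls_deriv (e (j + int n)) $$ (j + int n - 1 + int k) * P $$ (m - int n + 1 - int k)
         = P $$ (1 - int n + m - int k) * ((?J + of_nat k) * poly (p k) ?J)"
        by (simp only: mult.commute)
    qed
    also have "\<dots> = (if m < 0 then 0 else poly (p (nat m)) ?J - poly (p (nat m)) (of_int j))"
    proof (cases "m < 0")
      case True
      then have "{k. int k + int s \<le> m} = {}" by auto
      then show ?thesis using True by simp
    next
      case False
      then obtain k where m: "m = int k" by (metis nonneg_int_cases not_less)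
      have set: "{l. int l + int s \<le> m} = {l. l + s \<le> k}" by (auto simp: m)
      show ?thesis
        unfolding set using arg_cong[OF p[of k], of "\<lambda>q. poly q (of_int j)"]
        by (simp add: m poly_sum poly_pcompose algebra_simps)
    qed
    finally show "D (e (j + int n)) $$ N = (- e j) $$ N"
      using e[of j m] e[of "j + int n" m]
      by (auto simp: D_def shift_one_mult_nth N algebra_simps split: if_splits)
  qed
  have int: "intertwiner \<Psi>"
    by (rule intertwinerI) (use e[of _ 0] p0 in \<open>simp_all only: \<Psi> D_e, simp\<close>)
  have const: "poly (p m) i = poly (p m) j" if "m < s" for m i j
  proof (rule periodic_poly_const[OF n_pos])
    have "{k. k + s \<le> m} = {}" using that by auto
    then show "pcompose (p m) [:of_nat n, 1:] = p m" using p[of m] by simp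
  qed
  have quad: "poly (p s) i - poly (p s) j =
        c / (2 * of_nat n) * (i * (i + of_nat n) - j * (j + of_nat n))" for i j
  proof -
    define K where "K = c / (2 * of_nat n)"
    have K: "c = 2 * of_nat n * K" using n_pos by (simp add: K_def)
    define q where "q = p s - smult K ([:0, 1:] * [:of_nat n, 1:])"
    have "{k. k + s \<le> s} = {0}" by auto
    then have ps: "pcompose (p s) [:of_nat n, 1:] - p s = smult c [:of_nat n, 1:]"
      using p[of s] P_lead p0 by (simp add: int_n pcompose_1)
    have "pcompose q [:of_nat n, 1:] = q"
    proof (rule poly_eq_poly_eq_iff[THEN iffD1], rule ext)
      fix y
      show "poly (pcompose q [:of_nat n, 1:]) y = poly q y"
        using arg_cong[OF ps, of "\<lambda>q. poly q y"] unfolding q_def K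
        by (simp add: poly_pcompose algebra_simps)
    qed
    from periodic_poly_const[OF n_pos this, of i j] show ?thesis
      unfolding K_def[symmetric] by (simp add: q_def algebra_simps)
  qed
  show ?thesis by (rule that[OF int _ p0 const quad]) (simp_all add: \<Psi> e)
qed

text \<open>
  The leading coefficient of \<open>D(t\<^sup>j)\<close> is \<open>jc - 1\<close>, which vanishes for at most one \<open>j\<close>. If it did vanish,
  \<open>D\<close> would have a kernel; so \<open>D\<close> is bijective and \<open>\<Psi>(t\<^sup>j)\<close> can be taken to be \<open>(-D)\<^sup>-\<^sup>j 1\<close>.
\<close>

lemma intertwiner_unramified:
  assumes s: "s = 0" "r = 1" and inj: "\<And>v. D v = 0 \<Longrightarrow> v = 0"
  obtains \<Psi> where "intertwiner \<Psi>"
proof -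
  have n1: "n = 1" using n s by simp
  have D1: "filtered (-1) D" using D_filtered n1 by simp
  have lead: "D (fls_X_intpow j) $$ (j + -1) \<noteq> 0" for j
  proof
    assume *: "D (fls_X_intpow j) $$ (j + -1) = 0"
    have jc: "of_int i * c = 1" if "D (fls_X_intpow i) $$ (i + -1) = 0" for i
      using that D_lead[of i] s n1 by simp
    have "D (fls_X_intpow i) $$ (i + -1) \<noteq> 0" if "i > j" for i
    proof
      assume "D (fls_X_intpow i) $$ (i + -1) = 0"
      with * have "of_int i * c = of_int j * c" by (simp only: jc)
      then show False using c_nz that by simp
    qed
    with filtered_kernel[OF D1 *] obtain h where "h $$ j = 1" "D h = 0" by blast
    with inj show False by (metis fls_zero_nth zero_neq_one)
  qed
  note bij = filtered_bij[OF D1 lead]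
  define N where "N v = - D v" for v
  define M where "M v = - inv D v" for v
  have N: "filtered (-1) N" unfolding N_def by (rule filtered_neg[OF D1])
  have M: "filtered 1 M" unfolding M_def using filtered_neg[OF bij(2)] by simp
  have NM: "N (M v) = v" for v
    using bij(1) filtered_uminus[OF D1] by (simp add: N_def M_def bij_is_surj surj_f_inv_f)
  have N_lead: "N v $$ (j - 1) \<noteq> 0" if "ord_ge j v" "v $$ j \<noteq> 0" for j v
    using filtered_nth_lowest[OF D1 that(1)] lead[of j] that(2) by (simp add: N_def)
  define e where "e j = (if j \<ge> 0 then (M ^^ nat j) 1 else (N ^^ nat (- j)) 1)" for j :: int
  have e_step: "N (e (j + 1)) = e j" for j
  proof (cases "j \<ge> 0")
    case True
    then have "nat (j + 1) = Suc (nat j)" by simp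
    then show ?thesis using True by (simp add: e_def NM)
  next
    case False
    then have "nat (- j) = Suc (nat (- j - 1))" by simp
    then show ?thesis using False by (auto simp: e_def)
  qed
  have e_ord: "ord_ge j (e j)" for j
  proof (cases "j \<ge> 0")
    case True
    have "ord_ge (int k) ((M ^^ k) 1)" for k
      by (induction k) (use filtered_ord[OF M] in \<open>auto simp: ord_ge_def add.commute\<close>)
    from this[of "nat j"] show ?thesis using True by (simp add: e_def)
  next
    case False
    have "ord_ge (- int k) ((N ^^ k) 1)" for k
    proof (induction k)
      case (Suc k)
      have "- int (Suc k) = - int k + -1" by simp
      then show ?case using filtered_ord[OF N Suc] by (simp only: funpow.simps comp_apply)
    qed (simp add: ord_ge_def)
    from this[of "nat (- j)"] show ?thesis using False by (simp add: e_def)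
  qed
  have e_lead_step: "e j $$ j \<noteq> 0 \<longleftrightarrow> e (j + 1) $$ (j + 1) \<noteq> 0" for j
    using filtered_nth_lowest[OF N e_ord[of "j + 1"]] N_lead[of "j + 1" "fls_X_intpow (j + 1)"]
      ord_ge_X_intpow[of "j + 1", where 'a = 'a]
    by (simp add: e_step)
  have e_lead: "e j $$ j \<noteq> 0" for j
  proof (induction j rule: int_induct[of _ 0])
    case base
    show ?case by (simp add: e_def)
  next
    case (step1 i)
    then show ?case using e_lead_step[of i] by blast
  next
    case (step2 i)
    then show ?case using e_lead_step[of "i - 1"] by simp
  qed
  obtain \<Psi> where \<Psi>: "filtered 0 \<Psi>" "\<And>j. \<Psi> (fls_X_intpow j) = e j"
    using filtered_of_family[of 0 e] e_ord by auto
  have "intertwiner \<Psi>"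
  proof (rule intertwinerI[OF \<Psi>(1)])
    show "\<Psi> (fls_X_intpow j) $$ j \<noteq> 0" for j unfolding \<Psi> by (rule e_lead)
    show "D (\<Psi> (fls_X_intpow (j + int n))) = - \<Psi> (fls_X_intpow j)" for j
      using e_step[of j] unfolding \<Psi> N_def n1 by (simp add: minus_equation_iff)
  qed
  then show ?thesis by (rule that)
qed

section \<open>Multiplication by z as a difference operator\<close>

context
  fixes \<Psi> assumes \<Psi>: "intertwiner \<Psi>"
begin

lemma \<Psi>_filtered: "filtered 0 \<Psi>" and \<Psi>_lead: "\<Psi> (fls_X_intpow j) $$ (j + 0) \<noteq> 0"
  and D_\<Psi>: "D (\<Psi> v) = - \<Psi> (fls_X_intpow (- int n) * v)"
proof -
  show "filtered 0 \<Psi>" "\<Psi> (fls_X_intpow j) $$ (j + 0) \<noteq> 0" using \<Psi> by (auto simp: intertwiner_def)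
  have "D (\<Psi> (fls_X_intpow (int n) * (fls_X_intpow (- int n) * v))) = - \<Psi> (fls_X_intpow (- int n) * v)"
    using \<Psi> unfolding intertwiner_def by blast
  then show "D (\<Psi> v) = - \<Psi> (fls_X_intpow (- int n) * v)"
    unfolding mult.assoc[symmetric] X_intpow_add[symmetric] by simp
qed

lemma bij_\<Psi>: "bij \<Psi>" and inv_\<Psi>_filtered: "filtered 0 (inv \<Psi>)"
  using filtered_bij[OF \<Psi>_filtered \<Psi>_lead] by auto

lemma \<Psi>_inv: "\<Psi> (inv \<Psi> v) = v" and inv_\<Psi>: "inv \<Psi> (\<Psi> v) = v"
  using bij_\<Psi> by (simp_all add: bij_is_surj surj_f_inv_f bij_is_inj)

definition \<Phi> :: "'a fls \<Rightarrow> 'a fls" where "\<Phi> v = inv \<Psi> (Z * \<Psi> v)"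

lemma \<Phi>_filtered: "filtered 0 \<Phi>"
  using filtered_comp[OF filtered_comp[OF \<Psi>_filtered filtered_mult[OF Z_ord]] inv_\<Psi>_filtered]
  by (simp add: \<Phi>_def[abs_def])

text \<open>
  This is \<open>D Z = Z (D + 1)\<close>, transported by \<open>\<Psi>\<close>.
\<close>

lemma \<Phi>_shift: "\<Phi> (fls_X_intpow (- int n) * v) = (fls_X_intpow (- int n) + 1) * \<Phi> v"
proof -
  have "Z * \<Psi> (fls_X_intpow (- int n) * v) = - (Z * D (\<Psi> v))"
    by (simp add: D_\<Psi>)
  also have "\<dots> = - D (\<Psi> (\<Phi> v)) + \<Psi> (\<Phi> v)"
    by (simp add: \<Phi>_def \<Psi>_inv D_Z_mult algebra_simps)
  also have "\<dots> = \<Psi> ((fls_X_intpow (- int n) + 1) * \<Phi> v)"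
    unfolding D_\<Psi> distrib_right filtered_add[OF \<Psi>_filtered] by simp
  finally show ?thesis unfolding \<Phi>_def[of "_ * _"] by (simp add: inv_\<Psi>)
qed

lemma \<Phi>_agree_step:
  "\<Phi> (fls_X_intpow j) = y * ramified_shift_aut n (fls_X_intpow j) \<longleftrightarrow>
   \<Phi> (fls_X_intpow (j + int n)) = y * ramified_shift_aut n (fls_X_intpow (j + int n))"
proof -
  let ?v = "fls_X_intpow (j + int n) :: 'a fls"
  have j: "fls_X_intpow j = fls_X_intpow (- int n) * ?v"
    unfolding X_intpow_add[symmetric] by simp
  have nz: "fls_X_intpow (- int n) + 1 \<noteq> (0 :: 'a fls)"
    using n_pos by (auto simp: fls_eq_iff intro!: exI[of _ 0])
  show ?thesis
    unfolding j \<Phi>_shift shift_mult[OF n_pos] shift_X_minus_n[OF n_pos] using nz by (auto simp: ac_simps)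
qed

lemma \<Phi>_on_multiples: "\<Phi> (fls_X_intpow (int n * int k)) = \<Phi> 1 * ramified_shift_aut n (fls_X_intpow (int n * int k))"
proof (induction k)
  case 0
  have "ramified_shift_aut n 1 = (1 :: 'a fls)"
    unfolding ramified_shift_aut_def by simp
  then show ?case by simp
next
  case (Suc k)
  have "int n * int (Suc k) = int n * int k + int n" by (simp add: algebra_simps)
  then show ?case using Suc \<Phi>_agree_step[of "int n * int k"] by simp
qed

lemma \<Phi>_eqI:
  assumes "\<And>j. \<Phi> (fls_X_intpow j) = \<Phi> 1 * ramified_shift_aut n (fls_X_intpow j)"
  shows "\<Phi> v = \<Phi> 1 * ramified_shift_aut n v"
proof -
  have "ord_ge 0 (\<Phi> 1)" using filtered_ord[OF \<Phi>_filtered, of 0 1] by (simp add: ord_ge_def)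
  then have "filtered 0 (\<lambda>v. \<Phi> 1 * ramified_shift_aut n v)"
    using filtered_comp[OF shift_filtered[OF n_pos] filtered_mult] by fastforce
  from filtered_ext[OF \<Phi>_filtered this assms] show ?thesis by meson
qed

lemma \<Phi>_1_unramified:
  assumes s: "s = 0" "r = 1"
  shows "ord_ge (int n + 1) (\<Phi> 1 - (Z - fls_const x * fls_X_intpow (int n)))"
proof -
  have n1: "n = 1" using n s by simp
  define e where "e j = \<Psi> (fls_X_intpow j)" for j
  have e_ord: "ord_ge j (e j)" for j
    using filtered_ord[OF \<Psi>_filtered ord_ge_X_intpow, of j] by (simp add: e_def)
  have e_lead: "e j $$ j \<noteq> 0" for j using \<Psi>_lead[of j] by (simp add: e_def)
  have g_ord: "ord_ge 0 (\<Phi> 1)" using filtered_ord[OF \<Phi>_filtered, of 0 1] by (simp add: ord_ge_def)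
  have eq: "Z * e 0 = \<Psi> (\<Phi> 1)" by (simp add: e_def \<Phi>_def \<Psi>_inv)
  have int01: "{0..1::int} = {0, 1}" by auto
  have "(Z * e 0) $$ (0 + 0) = x * e 0 $$ 0"
    by (subst mult_nth_lowest[OF Z_ord e_ord]) (simp add: Z_0)
  moreover have "\<Psi> (\<Phi> 1) $$ (0 + 0) = \<Phi> 1 $$ 0 * e 0 $$ 0"
    unfolding filtered_nth_lowest[OF \<Psi>_filtered g_ord] by (simp add: e_def)
  ultimately have g0: "\<Phi> 1 $$ 0 = x" using e_lead[of 0] by (simp add: eq)
  have "(Z * e 0) $$ 1 = x * e 0 $$ 1 + b * e 0 $$ 0"
    using mult_nth_finite_sum[OF Z_ord e_ord[of 0], of 1] Z_r s by (simp add: int01 Z_0)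
  moreover have "\<Psi> (\<Phi> 1) $$ 1 = x * e 0 $$ 1 + \<Phi> 1 $$ 1 * e 1 $$ 1"
    using filtered_nth[OF \<Psi>_filtered g_ord, of 1] by (simp add: int01 g0 e_def)
  moreover have "e 0 $$ 0 = (1 - c) * e 1 $$ 1"
  proof -
    have "D (e 1) = - e 0"
      unfolding e_def D_\<Psi> X_intpow_add[symmetric] by (simp add: n1)
    then have "- e 0 $$ 0 = e 1 $$ 1 * D (fls_X_intpow 1) $$ (1 + - int n)"
      using filtered_nth_lowest[OF D_filtered e_ord[of 1]] by (simp add: n1)
    also have "D (fls_X_intpow 1) $$ (1 + - int n) = c - 1"
      using D_lead[of 1] s by simp
    finally show ?thesis by (simp add: algebra_simps minus_equation_iff[of "e 0 $$ 0"])
  qed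
  ultimately have "\<Phi> 1 $$ 1 * e 1 $$ 1 = b * (1 - c) * e 1 $$ 1"
    unfolding eq by (simp add: algebra_simps)
  then have "\<Phi> 1 $$ 1 = b * (1 - c)" using e_lead[of 1] by simp
  also have "\<dots> = b - x" using b s unfolding c_def by (simp add: field_simps)
  finally have g1: "\<Phi> 1 $$ 1 = b - x" .
  have "(\<Phi> 1 - (Z - fls_const x * fls_X_intpow (int n))) $$ i = 0" if "i < int n + 1" for i
  proof -
    from that n1 consider "i < 0" | "i = 0" | "i = 1" by force
    then show ?thesis
      by cases (use g_ord Z_ord Z_r s g1 in \<open>auto simp: ord_ge_def g0 Z_0 n1\<close>)
  qed
  then show ?thesis by (simp add: ord_ge_def)
qed

text \<open>
  Since \<open>\<Psi>\<close> preserves orders, it suffices to compare \<open>\<Psi>\<close> of the claimed value with \<open>Z \<Psi>(1)\<close>. In the difference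
  of \<open>\<Psi>(Z)\<close> and \<open>Z \<Psi>(1)\<close> the coefficient \<open>Z\<^sub>i\<close> is multiplied by \<open>p\<^sub>k(i) - p\<^sub>k(0)\<close> at order \<open>i + k\<close>. Up to
  order \<open>n\<close> this vanishes except for \<open>i = r\<close> and \<open>k = s\<close>.
\<close>

lemma \<Phi>_1_ramified:
  assumes s: "s > 0"
    and p: "\<And>j m. \<Psi> (fls_X_intpow j) $$ (j + m) = (if m < 0 then 0 else poly (p (nat m)) (of_int j))"
    and p0: "p 0 = 1" and const: "\<And>m i j. m < s \<Longrightarrow> poly (p m) i = poly (p m) j"
    and quad: "\<And>i j. poly (p s) i - poly (p s) j =
        c / (2 * of_nat n) * (i * (i + of_nat n) - j * (j + of_nat n))"
  shows "ord_ge (int n + 1) (\<Phi> 1 - (Z + fls_const (x * of_nat s / (2 * of_nat n) - x) * fls_X_intpow (int n)))"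
    (is "ord_ge _ (_ - (Z + fls_const ?\<kappa> * _))")
proof -
  define e where "e j = \<Psi> (fls_X_intpow j)" for j
  have p': "e i $$ N = (if N < i then 0 else poly (p (nat (N - i))) (of_int i))" for i N
    using p[of i "N - i"] by (simp add: e_def)
  have e_ord: "ord_ge j (e j)" for j
    by (simp add: ord_ge_def p')
  \<comment> \<open>Only \<open>i = r\<close>, \<open>N = n\<close> survives; there \<open>b (p\<^sub>s(r) - p\<^sub>s(0)) = x - xs/(2n)\<close>.\<close>
  have coeff: "\<Psi> Z $$ N - (Z * e 0) $$ N = (if N = int n then - ?\<kappa> else 0)" if N: "N \<le> int n" for N
  proof -
    have "\<Psi> Z $$ N - (Z * e 0) $$ N = (\<Sum>i=0..N. Z $$ i * (e i $$ N - e 0 $$ (N - i)))"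
      using filtered_nth[OF \<Psi>_filtered Z_ord, of N] mult_nth_finite_sum[OF Z_ord e_ord[of 0], of N]
      by (simp add: e_def sum_subtractf algebra_simps)
    also have "\<dots> = (\<Sum>i=0..N. if i = int r \<and> N = int n then - ?\<kappa> else 0)"
    proof (intro sum.cong refl)
      fix i assume i: "i \<in> {0..N}"
      then have diff: "e i $$ N - e 0 $$ (N - i) = poly (p (nat (N - i))) (of_int i) - poly (p (nat (N - i))) 0"
        by (simp add: p')
      show "Z $$ i * (e i $$ N - e 0 $$ (N - i)) = (if i = int r \<and> N = int n then - ?\<kappa> else 0)"
      proof (cases "0 < i \<and> i < int r \<or> i = 0")
        case True
        then show ?thesis using r Z_gap[of i] by (auto simp: p')
      next
        case False
        then have ir: "i \<ge> int r" using i by auto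
        show ?thesis
        proof (cases "i = int r \<and> N = int n")
          case True
          have "nat (int n - int r) = s" by (simp add: int_n)
          moreover have nn: "of_nat n = (of_nat r + of_nat s :: 'a)" by (simp add: n)
          moreover have "of_nat r + of_nat s \<noteq> (0::'a)" using n_pos by (simp flip: nn)
          ultimately show ?thesis
            unfolding diff using True quad[of "of_nat r" 0] r b quadratic_correction[of "of_nat r" b "of_nat s" x]
            by (simp add: Z_r c_def)
        next
          case False
          then have "nat (N - i) < s" using ir N s by (auto simp: int_n)
          then show ?thesis unfolding diff using False const[of "nat (N - i)" "of_int i" 0] by auto
        qed
      qed
    qed
    also have "\<dots> = (if N = int n then - ?\<kappa> else 0)"
      using r by (auto simp: int_n)
    finally show ?thesis .
  qed
  let ?G = "Z + fls_const ?\<kappa> * fls_X_intpow (int n)"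
  have "ord_ge (int n + 1) (\<Psi> ?G - Z * e 0)"
    unfolding ord_ge_def
  proof (intro allI impI)
    fix N assume "N < int n + 1"
    then have N: "N \<le> int n" by simp
    have "\<Psi> ?G = \<Psi> Z + fls_const ?\<kappa> * e (int n)"
      by (simp add: filtered_add[OF \<Psi>_filtered] filtered_scale[OF \<Psi>_filtered] e_def)
    then have "(\<Psi> ?G - Z * e 0) $$ N = (\<Psi> Z $$ N - (Z * e 0) $$ N) + ?\<kappa> * e (int n) $$ N"
      by simp
    also have "\<dots> = 0" unfolding coeff[OF N] using N by (simp add: p' p0)
    finally show "(\<Psi> ?G - Z * e 0) $$ N = 0" .
  qed
  then have "ord_ge (int n + 1 + 0) (inv \<Psi> (\<Psi> ?G - Z * e 0))"
    by (rule filtered_ord[OF inv_\<Psi>_filtered])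
  also have "inv \<Psi> (\<Psi> ?G - Z * e 0) = ?G - \<Phi> 1"
    unfolding filtered_diff[OF inv_\<Psi>_filtered] inv_\<Psi> by (simp add: \<Phi>_def e_def)
  finally show ?thesis using ord_ge_uminus by fastforce
qed

end

text \<open>
  The map is \<open>h \<Psi>\<^sup>-\<^sup>1\<close>, where \<open>h = \<theta> + o(\<theta>)\<close> is a solution of \<open>g\<phi>(h) = \<Phi>(1) h\<close>. It is the factor \<open>\<theta>\<close>
  that absorbs the term \<open>-x\<theta>\<close> by which \<open>\<Phi>(1)\<close> differs from \<open>g\<close>, because \<open>\<phi>(\<theta>) = \<theta> (1 - \<theta> + o(\<theta>))\<close>.
\<close>

theorem model_isomorphism:
  assumes "s = 0 \<Longrightarrow> r = 1" and "s = 0 \<Longrightarrow> (\<And>v. D v = 0 \<Longrightarrow> v = 0)"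
  obtains T where "filtered (int n) T" "\<And>j. T (fls_X_intpow j) $$ (j + int n) \<noteq> 0"
    "\<And>v. T (D v) = - (fls_X_intpow (- int n) * T v)"
    "\<And>v. T (Z * v) = (Z + fls_const (x * of_nat s / (2 * of_nat n)) * fls_X_intpow (int n))
       * ramified_shift_aut n (T v)"
proof -
  let ?\<kappa> = "x * of_nat s / (2 * of_nat n)"
  obtain \<Psi> where \<Psi>: "intertwiner \<Psi>"
    and eq: "\<And>j. \<Phi> \<Psi> (fls_X_intpow j) = \<Phi> \<Psi> 1 * ramified_shift_aut n (fls_X_intpow j)"
    and g: "ord_ge (int n + 1) (\<Phi> \<Psi> 1 - (Z + fls_const (?\<kappa> - x) * fls_X_intpow (int n)))"
  proof (cases "s = 0")
    case True
    with intertwiner_unramified assms obtain \<Psi> where \<Psi>: "intertwiner \<Psi>" by metis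
    have n1: "int n = 1" using True assms(1) n by simp
    have "\<Phi> \<Psi> (fls_X_intpow j) = \<Phi> \<Psi> 1 * ramified_shift_aut n (fls_X_intpow j)" for j
    proof (induction j rule: int_induct[of _ 0])
      case base
      show ?case using \<Phi>_on_multiples[OF \<Psi>, of 0] by simp
    next
      case (step1 i)
      then show ?case using \<Phi>_agree_step[OF \<Psi>, of i] unfolding n1 by blast
    next
      case (step2 i)
      then show ?case using \<Phi>_agree_step[OF \<Psi>, of "i - 1"] unfolding n1 by simp
    qed
    moreover have "ord_ge (int n + 1) (\<Phi> \<Psi> 1 - (Z + fls_const (?\<kappa> - x) * fls_X_intpow (int n)))"
      using \<Phi>_1_unramified[OF \<Psi>] True assms(1) by simp
    ultimately show ?thesis using \<Psi> that by blast
  next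
    case False
    then have s: "s > 0" by simp
    obtain \<Psi> p where \<Psi>: "intertwiner \<Psi>" and
      p: "\<And>j m. \<Psi> (fls_X_intpow j) $$ (j + m) = (if m < 0 then 0 else poly (p (nat m)) (of_int j))"
      "p 0 = 1" "\<And>m i j. m < s \<Longrightarrow> poly (p m) i = poly (p m) j"
      "\<And>i j. poly (p s) i - poly (p s) j =
        c / (2 * of_nat n) * (i * (i + of_nat n) - j * (j + of_nat n))"
      using intertwiner_ramified[OF s] by metis
    note g = \<Phi>_1_ramified[OF \<Psi> s p]
    have fam: "poly_family (\<lambda>j. \<Psi> (fls_X_intpow j))"
      using p(1) by (rule poly_familyI)
    have "ord_ge 0 (\<Phi> \<Psi> 1)" using filtered_ord[OF \<Phi>_filtered[OF \<Psi>], of 0 1] by (simp add: ord_ge_def)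
    then have fam1: "poly_family (\<lambda>j. \<Psi> (\<Phi> \<Psi> 1 * ramified_shift_aut n (fls_X_intpow j)))"
      by (intro poly_family_apply[OF \<Psi>_filtered[OF \<Psi>] fam] poly_family_mult poly_family_shift n_pos)
    have fam2: "poly_family (\<lambda>j. Z * \<Psi> (fls_X_intpow j))"
      by (intro poly_family_mult Z_ord fam)
    have agree: "Z * \<Psi> (fls_X_intpow (int n * int k)) =
        \<Psi> (\<Phi> \<Psi> 1 * ramified_shift_aut n (fls_X_intpow (int n * int k)))" for k
      unfolding \<Phi>_on_multiples[OF \<Psi>, symmetric] by (simp add: \<Phi>_def[OF \<Psi>] \<Psi>_inv[OF \<Psi>])
    have "Z * \<Psi> (fls_X_intpow j) = \<Psi> (\<Phi> \<Psi> 1 * ramified_shift_aut n (fls_X_intpow j))" for j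
      by (rule poly_family_eqI[OF fam2 fam1 n_pos agree])
    then have "\<Phi> \<Psi> (fls_X_intpow j) = \<Phi> \<Psi> 1 * ramified_shift_aut n (fls_X_intpow j)" for j
      unfolding \<Phi>_def[OF \<Psi>, of "fls_X_intpow j"] by (simp only: inv_\<Psi>[OF \<Psi>])
    then show ?thesis using \<Psi> g that by blast
  qed
  let ?\<phi> = "ramified_shift_aut n :: 'a fls \<Rightarrow> 'a fls"
  let ?g = "Z + fls_const ?\<kappa> * fls_X_intpow (int n)"
  define L where "L h = ?g * ?\<phi> h - \<Phi> \<Psi> 1 * h" for h
  have g_ord: "ord_ge 0 ?g" and g_0: "?g $$ 0 = x"
    using Z_ord Z_0 n_pos by (auto simp: ord_ge_def)
  have gt_ord: "ord_ge 0 (\<Phi> \<Psi> 1)"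
    using filtered_ord[OF \<Phi>_filtered[OF \<Psi>], of 0 1] by (simp add: ord_ge_def)
  have L_X: "ord_ge (j + int n) (L (fls_X_intpow j)) \<and>
      L (fls_X_intpow j) $$ (j + int n) = x * (1 - of_int j / of_nat n)" for j
  proof -
    let ?B = "binom_fls n (- of_int j / of_nat n) :: 'a fls"
    define E where "E = \<Phi> \<Psi> 1 - (Z + fls_const (?\<kappa> - x) * fls_X_intpow (int n))"
    have E: "ord_ge (int n + 1) E" unfolding E_def by (rule g)
    have L_eq: "L (fls_X_intpow j) = fls_X_intpow j * (?g * (?B - 1) + fls_const x * fls_X_intpow (int n) - E)"
      unfolding L_def shift_X_intpow[OF n_pos] E_def
      by (simp add: algebra_simps fls_minus_const[symmetric])
    have B_ord: "ord_ge (int n) (?B - 1)"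
      unfolding ord_ge_def
    proof (intro allI impI)
      fix i assume "i < int n"
      then have "int n dvd i \<Longrightarrow> i > 0 \<Longrightarrow> False" using zdvd_not_zless by blast
      then show "(?B - 1) $$ i = 0" using n_pos by (cases "i = 0") (auto simp: binom_fls_nth)
    qed
    have "(?g * (?B - 1)) $$ (0 + int n) = x * (- of_int j / of_nat n)"
      unfolding mult_nth_lowest[OF g_ord B_ord] using n_pos g_0 by (simp add: binom_fls_nth)
    moreover have "ord_ge (int n) (?g * (?B - 1))" using ord_ge_mult[OF g_ord B_ord] by simp
    moreover define V where "V = ?g * (?B - 1) + fls_const x * fls_X_intpow (int n) - E"
    ultimately have "ord_ge (int n) V" "V $$ int n = x * (- of_int j / of_nat n) + x"
      using E by (auto simp: ord_ge_def)
    then show ?thesis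
      unfolding L_eq V_def[symmetric] by (auto simp: ord_ge_def X_intpow_mult_nth right_diff_distrib)
  qed
  have L: "filtered (int n) L"
  proof (rule filtered_improve)
    show "filtered 0 L" unfolding L_def
      using filtered_comp[OF shift_filtered[OF n_pos] filtered_mult[OF g_ord]] filtered_mult[OF gt_ord]
      by (intro filtered_minus) simp_all
  qed (use L_X in blast)
  \<comment> \<open>The leading coefficient \<open>x (1 - j/n)\<close> vanishes exactly at \<open>j = n\<close>.\<close>
  obtain h where h: "ord_ge (int n) h" "h $$ int n = 1" "L h = 0"
  proof (rule filtered_kernel[OF L])
    show "L (fls_X_intpow (int n)) $$ (int n + int n) = 0"
      using L_X[of "int n"] n_pos by simp
    show "L (fls_X_intpow j) $$ (j + int n) \<noteq> 0" if "int n < j" for j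
    proof -
      have "of_int j \<noteq> (of_nat n :: 'a)" using that by (metis of_int_eq_iff of_int_of_nat_eq less_irrefl)
      then show ?thesis using L_X[of j] n_pos x by simp
    qed
  qed blast
  define T where "T v = h * inv \<Psi> v" for v
  show ?thesis
  proof (rule that)
    show "filtered (int n) T" unfolding T_def[abs_def]
      using filtered_comp[OF inv_\<Psi>_filtered[OF \<Psi>] filtered_mult[OF h(1)]] by simp
    show "T (fls_X_intpow j) $$ (j + int n) \<noteq> 0" for j
      using mult_nth_lowest[OF h(1), of j "inv \<Psi> (fls_X_intpow j)"]
        filtered_ord[OF inv_\<Psi>_filtered[OF \<Psi>], of j "fls_X_intpow j"]
        filtered_inv_lead[OF \<Psi>_filtered[OF \<Psi>] \<Psi>_lead[OF \<Psi>], of j] h(2)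
      by (simp add: T_def add.commute)
    fix v
    define u where "u = inv \<Psi> v"
    have v: "v = \<Psi> u" by (simp add: u_def \<Psi>_inv[OF \<Psi>])
    show "T (D v) = - (fls_X_intpow (- int n) * T v)"
      unfolding v T_def D_\<Psi>[OF \<Psi>] filtered_uminus[OF inv_\<Psi>_filtered[OF \<Psi>]] inv_\<Psi>[OF \<Psi>]
      by (simp add: ac_simps)
    have "T (Z * v) = h * \<Phi> \<Psi> u" unfolding T_def v \<Phi>_def[OF \<Psi>] ..
    also have "\<dots> = (\<Phi> \<Psi> 1 * h) * ?\<phi> u" by (simp add: \<Phi>_eqI[OF \<Psi> eq, of u] ac_simps)
    also have "\<Phi> \<Psi> 1 * h = ?g * ?\<phi> h" using h(3) by (simp add: L_def)
    also have "?g * ?\<phi> h * ?\<phi> u = ?g * ?\<phi> (T v)"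
      by (simp add: T_def u_def shift_mult[OF n_pos] mult.assoc)
    finally show "T (Z * v) = ?g * ?\<phi> (T v)" .
  qed
qed

end

section \<open>Lattices and the adic topology\<close>

lemma ord_ge_0_conv_fps: "ord_ge 0 v \<Longrightarrow> fps_to_fls (fls_regpart v) = v"
  by (rule fls_eqI) (auto simp: ord_ge_def)

lemma ex_pole_bound:
  assumes "finite A"
  shows "\<exists>m::nat. \<forall>a\<in>A. ord_ge (- int m) (f a)"
  using assms
proof (induction A)
  case (insert a A)
  then obtain m where m: "\<forall>a\<in>A. ord_ge (- int m) (f a)" by blast
  show ?case
    by (rule exI[of _ "max m (nat (- fls_subdegree (f a)))"])
      (use m in \<open>auto intro: ord_ge_mono simp: ord_ge_iff_subdegree\<close>)
qed simp

lemma (in vector_space) finite_span_coeffs: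
  assumes "finite B" "span B = UNIV"
  obtains a where "v = (\<Sum>b\<in>B. scale (a b) b)"
proof -
  have "v \<in> range (\<lambda>a. \<Sum>b\<in>B. scale (a b) b)"
    using assms(2) unfolding span_finite[OF assms(1)] by simp
  then show ?thesis using that by blast
qed

lemma fin_dim_vector_space: "fin_dim S \<Longrightarrow> vector_space S"
  unfolding fin_dim_def finite_dimensional_vector_space_def by blast

lemma fin_dimI:
  assumes "vector_space S" "finite G" "module.span S G = UNIV"
  shows "fin_dim S"
proof -
  interpret vector_space S by fact
  obtain B where B: "B \<subseteq> G" "independent B" "G \<subseteq> span B"
    using maximal_independent_subset by blast
  have "span B = UNIV" using assms(3) span_minimal[OF B(3) subspace_span] by auto
  then have "finite_dimensional_vector_space S B"
    using B assms(2) by unfold_locales (auto intro: finite_subset)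
  then show ?thesis by (auto simp: fin_dim_def)
qed

lemma adic_lattice_memI:
  assumes "vector_space S" "\<And>b. b \<in> B \<Longrightarrow> ord_ge (int n) (a b)"
  shows "(\<Sum>b\<in>B. S (a b) b) \<in> adic_lattice S B n"
proof -
  interpret vector_space S by fact
  let ?c = "\<lambda>b. fls_regpart (fls_shift (int n) (a b))"
  have "a b = fls_X ^ n * fps_to_fls (?c b)" if "b \<in> B" for b
    using assms(2)[OF that]
    by (subst ord_ge_0_conv_fps) (auto simp: ord_ge_def fls_X_power_times_conv_shift)
  then have "(\<Sum>b\<in>B. S (a b) b) = S (fls_X ^ n) (\<Sum>b\<in>B. S (fps_to_fls (?c b)) b)"
    unfolding scale_sum_right scale_scale by (intro sum.cong) auto
  then show ?thesis unfolding adic_lattice_def by (intro CollectI exI[of _ ?c] conjI TrueI)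
qed

text \<open>
  Expand the members of \<open>G\<close> in terms of \<open>B\<close>; \<open>m\<close> bounds the poles of the finitely many coefficients.
\<close>

lemma adic_lattice_cofinal:
  assumes vs: "vector_space S" and B: "finite B" "module.span S B = UNIV" and G: "finite G"
  shows "\<exists>m. \<forall>n. adic_lattice S G (n + m) \<subseteq> adic_lattice S B n"
proof -
  interpret vector_space S by fact
  have "\<exists>a. g = (\<Sum>b\<in>B. S (a b) b)" for g
    using finite_span_coeffs[OF B] by metis
  then obtain a where a: "\<And>g. g = (\<Sum>b\<in>B. S (a g b) b)" by metis
  obtain m :: nat where m: "\<And>g b. g \<in> G \<Longrightarrow> b \<in> B \<Longrightarrow> ord_ge (- int m) (a g b)"
    using ex_pole_bound[of "G \<times> B" "\<lambda>(g, b). a g b"] G B(1) by fastforce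
  have "l \<in> adic_lattice S B n" if l_in: "l \<in> adic_lattice S G (n + m)" for l n
  proof -
    obtain c where l: "l = S (fls_X ^ (n + m)) (\<Sum>g\<in>G. S (fps_to_fls (c g)) g)"
      using l_in by (auto simp: adic_lattice_def)
    let ?d = "\<lambda>b. \<Sum>g\<in>G. fls_X ^ (n + m) * (fps_to_fls (c g) * a g b)"
    have "l = (\<Sum>g\<in>G. \<Sum>b\<in>B. S (fls_X ^ (n + m) * (fps_to_fls (c g) * a g b)) b)"
      unfolding l scale_sum_right
      by (intro sum.cong refl) (subst a, simp add: scale_sum_right)
    also have "\<dots> = (\<Sum>b\<in>B. S (?d b) b)"
      by (subst sum.swap) (simp add: scale_sum_left)
    also have "\<dots> \<in> adic_lattice S B n"
    proof (intro adic_lattice_memI vs ord_ge_sum)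
      fix b g assume "b \<in> B" "g \<in> G"
      then show "ord_ge (int n) (fls_X ^ (n + m) * (fps_to_fls (c g) * a g b))"
        by (intro ord_ge_mult'[where k = "int (n + m)" and l = "- int m"]
            ord_ge_mult'[where k = 0 and l = "- int m"] m)
          (auto simp: ord_ge_def)
    qed
    finally show ?thesis .
  qed
  then show ?thesis by blast
qed

text \<open>
  The lattices of a basis and those of a finite spanning set are cofinal in each other, so they define
  the same topology.
\<close>

lemma adic_open_spanning:
  assumes fd: "fin_dim S" and G: "finite G" "module.span S G = UNIV"
  shows "adic_open S U \<longleftrightarrow> (\<forall>v\<in>U. \<exists>n. \<forall>l\<in>adic_lattice S G n. v + l \<in> U)"
proof -
  have vs: "vector_space S" using fd by (rule fin_dim_vector_space)
  have basis: "finite B \<and> module.span S B = UNIV" if "finite_dimensional_vector_space S B" for B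
    using that unfolding finite_dimensional_vector_space_def finite_dimensional_vector_space_axioms_def by blast
  show ?thesis
  proof
    assume "adic_open S U"
    then obtain B where B: "finite_dimensional_vector_space S B"
      "\<forall>v\<in>U. \<exists>n. \<forall>l\<in>adic_lattice S B n. v + l \<in> U" by (auto simp: adic_open_def)
    obtain m where "\<forall>n. adic_lattice S G (n + m) \<subseteq> adic_lattice S B n"
      using adic_lattice_cofinal[OF vs _ _ G(1)] basis[OF B(1)] by blast
    then show "\<forall>v\<in>U. \<exists>n. \<forall>l\<in>adic_lattice S G n. v + l \<in> U" using B(2) by blast
  next
    assume *: "\<forall>v\<in>U. \<exists>n. \<forall>l\<in>adic_lattice S G n. v + l \<in> U"
    obtain B where B: "finite_dimensional_vector_space S B" using fd by (auto simp: fin_dim_def)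
    obtain m where "\<forall>n. adic_lattice S B (n + m) \<subseteq> adic_lattice S G n"
      using adic_lattice_cofinal[OF vs G] basis[OF B] by blast
    then have "\<forall>v\<in>U. \<exists>n. \<forall>l\<in>adic_lattice S B n. v + l \<in> U" using * by blast
    then show "adic_open S U" using B by (auto simp: adic_open_def)
  qed
qed

text \<open>
  The topology of \<open>k((u))\<close> itself. It serves as the common description of the \<open>z\<^sub>x\<close>-adic and of the
  \<open>\<theta>\<close>-adic topology.
\<close>

definition order_open :: "'a::field fls set \<Rightarrow> bool" where
  "order_open U \<longleftrightarrow> (\<forall>v\<in>U. \<exists>k. \<forall>l. ord_ge k l \<longrightarrow> v + l \<in> U)"

text \<open>
  The powers \<open>u\<^sup>i\<close> with \<open>i < q\<close> form a basis of \<open>k((u))\<close> over \<open>k((u\<^sup>q))\<close>, compatibly with orders.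
\<close>

lemma ramified_decomposition:
  fixes v :: "'a::field fls"
  assumes q: "q > 0" and v: "ord_ge (int q * N) v"
  obtains c :: "nat \<Rightarrow> 'a fls" where "\<And>i. ord_ge N (c i)"
    "v = (\<Sum>i<q. fls_compose_power (c i) q * fls_X_intpow (int i))"
proof -
  have "\<exists>c. ord_ge N c \<and> (\<forall>j\<ge>N. c $$ j = v $$ (int q * j + int i))" for i
    using fls_of_coeffs[of N "\<lambda>k. v $$ (int q * (N + int k) + int i)"] by force
  then obtain c where c_ord: "\<And>i. ord_ge N (c i)"
    and c: "\<And>i j. j \<ge> N \<Longrightarrow> c i $$ j = v $$ (int q * j + int i)" by metis
  have c': "c i $$ j = v $$ (int q * j + int i)" if i: "i < q" for i j
  proof (cases "j \<ge> N")
    case False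
    then have "int q * j \<le> int q * (N - 1)" by (intro mult_left_mono) auto
    then have "int q * j + int i < int q * N" using i by (simp add: algebra_simps)
    then show ?thesis using False v c_ord[of i] by (simp add: ord_ge_def)
  qed (rule c)
  have "v = (\<Sum>i<q. fls_compose_power (c i) q * fls_X_intpow (int i))"
  proof (rule fls_eqI)
    fix m :: int
    have "(\<Sum>i<q. fls_compose_power (c i) q * fls_X_intpow (int i)) $$ m =
        (\<Sum>i<q. if i = nat (m mod int q) then v $$ m else 0)"
      unfolding fls_nth_sum
    proof (intro sum.cong refl)
      fix i assume i: "i \<in> {..<q}"
      have "int q dvd m - int i \<longleftrightarrow> m mod int q = int i mod int q" by (simp add: mod_eq_dvd_iff)
      also have "int i mod int q = int i" using i by simp
      also have "m mod int q = int i \<longleftrightarrow> i = nat (m mod int q)" using q by auto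
      finally have dvd: "int q dvd m - int i \<longleftrightarrow> i = nat (m mod int q)" .
      have "(fls_compose_power (c i) q * fls_X_intpow (int i)) $$ m = fls_compose_power (c i) q $$ (m - int i)"
        by (simp only: mult.commute[of "fls_compose_power (c i) q"] X_intpow_mult_nth)
      then show "(fls_compose_power (c i) q * fls_X_intpow (int i)) $$ m =
          (if i = nat (m mod int q) then v $$ m else 0)"
        using q i c'[of i "(m - int i) div int q"] unfolding dvd[symmetric]
        by (auto simp: fls_nth_compose_power)
    qed
    also have "\<dots> = v $$ m" using q by (simp add: nat_less_iff)
    finally show "v $$ m = (\<Sum>i<q. fls_compose_power (c i) q * fls_X_intpow (int i)) $$ m" ..
  qed
  then show ?thesis using c_ord that by blast
qed

lemma ord_ge_compose_power: "q > 0 \<Longrightarrow> ord_ge N h \<Longrightarrow> ord_ge (int q * N) (fls_compose_power h q)"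
proof -
  assume q: "q > 0" and h: "ord_ge N h"
  have "i div int q < N" if "i < int q * N" for i
  proof (rule ccontr)
    assume "\<not> ?thesis"
    then have "int q * N \<le> int q * (i div int q)" by (intro mult_left_mono) auto
    then show False
      using that q mult_div_mod_eq[of "int q" i] pos_mod_sign[of "int q" i] by linarith
  qed
  then show ?thesis using q h by (simp add: ord_ge_def fls_nth_compose_power)
qed

text \<open>
  A \<open>k((t\<^sup>q))\<close>-structure on \<open>k((u))\<close> transported from \<open>k((t))\<close> by a bijection \<open>T\<close> that shifts orders by \<open>d\<close>.
  The identity gives \<open>E\<^sub>f\<close> over \<open>k((z\<^sub>x))\<close>, substitution of \<open>w\<close> followed by the map of
  \<open>model_isomorphism\<close> gives the action of \<open>k((\<theta>))\<close>.
\<close>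

locale ramified_module =
  fixes q :: nat and T :: "'a::field fls \<Rightarrow> 'a fls" and S :: "'a fls \<Rightarrow> 'a fls \<Rightarrow> 'a fls" and d :: int
  assumes q: "q > 0" and bij_T: "bij T" and T_add: "\<And>u v. T (u + v) = T u + T v"
    and T_S: "\<And>h v. T (S h v) = fls_compose_power h q * T v"
    and T_ord: "\<And>k v. ord_ge (k + d) (T v) \<longleftrightarrow> ord_ge k v"
begin

lemma T_inv: "T (inv T v) = v"
  using bij_T by (simp add: bij_is_surj surj_f_inv_f)

lemma T_eqI: "T u = T v \<Longrightarrow> u = v"
  using bij_T by (simp add: bij_is_inj inj_eq)

lemma T_0: "T 0 = 0"
proof -
  have "T 0 + T 0 = T 0 + 0" using T_add[of 0 0] by (metis add.right_neutral)
  then show ?thesis by (simp only: add_left_cancel)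
qed

lemma T_sum: "T (sum f A) = (\<Sum>i\<in>A. T (f i))"
  by (induction A rule: infinite_finite_induct) (simp_all add: T_0 T_add)

lemma vector_space: "vector_space S"
proof
  fix a b and u v :: "'a fls"
  show "S a (u + v) = S a u + S a v" "S (a + b) u = S a u + S b u"
    "S a (S b u) = S (a * b) u" "S 1 u = u"
    by (rule T_eqI, simp add: T_S T_add distrib_left distrib_right mult.assoc q)+
qed

definition G :: "'a fls set" where "G = (\<lambda>i. inv T (fls_X_intpow (int i))) ` {..<q}"

lemma finite_G: "finite G"
  by (simp add: G_def)

lemma inj_G: "inj_on (\<lambda>i. inv T (fls_X_intpow (int i))) {..<q}"
proof (rule inj_onI)
  fix i j assume "inv T (fls_X_intpow (int i)) = inv T (fls_X_intpow (int j))"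
  then have "fls_X_intpow (int i) = (fls_X_intpow (int j) :: 'a fls)" by (metis T_inv)
  then show "i = j" using fls_subdegree_fls_X_intpow[where 'a = 'a] by (metis of_nat_eq_iff)
qed

lemma G_decomposition:
  assumes "ord_ge (int q * N) (T v)"
  obtains a where "\<And>g. ord_ge N (a g)" "v = (\<Sum>g\<in>G. S (a g) g)"
proof -
  obtain c where c: "\<And>i. ord_ge N (c i)"
    "T v = (\<Sum>i<q. fls_compose_power (c i) q * fls_X_intpow (int i))"
    using ramified_decomposition[OF q assms] by blast
  define a where "a g = c (the_inv_into {..<q} (\<lambda>i. inv T (fls_X_intpow (int i))) g)" for g
  have "v = (\<Sum>g\<in>G. S (a g) g)"
    by (rule T_eqI)
      (simp add: T_sum T_S G_def sum.reindex[OF inj_G] c(2) T_inv a_def the_inv_into_f_f[OF inj_G])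
  then show ?thesis using c(1) that[of a] by (simp add: a_def)
qed

lemma span_G: "module.span S G = UNIV"
proof -
  interpret vector_space S by (rule vector_space)
  have "v \<in> span G" for v
  proof -
    let ?m = "fls_subdegree (T v)"
    have "int q * (- \<bar>?m\<bar>) \<le> 1 * (- \<bar>?m\<bar>)" using q by (intro mult_right_mono_neg) auto
    then have "ord_ge (int q * (- \<bar>?m\<bar>)) (T v)" by (intro ord_ge_mono[OF ord_ge_subdegree]) auto
    then obtain a where a: "v = (\<Sum>g\<in>G. S (a g) g)" by (rule G_decomposition)
    show ?thesis by (subst a) (intro span_sum span_scale span_base)
  qed
  then show ?thesis by auto
qed

lemma fin_dim: "fin_dim S"
  by (rule fin_dimI[OF vector_space finite_G span_G])

lemma adic_lattice_G: "adic_lattice S G N = {v. ord_ge (int q * int N) (T v)}"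
proof (intro equalityI subsetI)
  fix v assume "v \<in> adic_lattice S G N"
  then obtain c where v: "v = S (fls_X ^ N) (\<Sum>g\<in>G. S (fps_to_fls (c g)) g)"
    by (auto simp: adic_lattice_def)
  have "T v = fls_compose_power (fls_X ^ N) q * (\<Sum>g\<in>G. fls_compose_power (fps_to_fls (c g)) q * T g)"
    by (simp only: v T_S T_sum)
  moreover have "ord_ge (int q * int N) (fls_compose_power (fls_X ^ N) q :: 'a fls)"
    by (rule ord_ge_compose_power[OF q]) (auto simp: ord_ge_def)
  moreover have "ord_ge 0 (fls_compose_power (fps_to_fls (c g)) q * T g)" if "g \<in> G" for g
    using ord_ge_compose_power[OF q ord_ge_fps, of "c g"] that
    by (intro ord_ge_mult'[of 0 _ 0]) (auto simp: G_def T_inv ord_ge_def)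
  ultimately show "v \<in> {v. ord_ge (int q * int N) (T v)}"
    by (simp only: mem_Collect_eq) (rule ord_ge_mult'[where l = 0], assumption, rule ord_ge_sum, auto)
next
  fix v assume "v \<in> {v. ord_ge (int q * int N) (T v)}"
  then obtain a where "\<And>g. ord_ge (int N) (a g)" "v = (\<Sum>g\<in>G. S (a g) g)"
    using G_decomposition by blast
  then show "v \<in> adic_lattice S G N" using adic_lattice_memI[OF vector_space] by blast
qed

lemma adic_open_iff: "adic_open S U \<longleftrightarrow> order_open U"
proof -
  have "(\<exists>N. \<forall>l\<in>adic_lattice S G N. v + l \<in> U) \<longleftrightarrow> (\<exists>k. \<forall>l. ord_ge k l \<longrightarrow> v + l \<in> U)" for v
  proof
    assume "\<exists>N. \<forall>l\<in>adic_lattice S G N. v + l \<in> U"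
    then obtain N where N: "\<And>l. ord_ge (int q * int N) (T l) \<Longrightarrow> v + l \<in> U"
      by (auto simp: adic_lattice_G)
    have "v + l \<in> U" if "ord_ge (int q * int N - d) l" for l
      using that T_ord[of "int q * int N - d" l] by (intro N) simp
    then show "\<exists>k. \<forall>l. ord_ge k l \<longrightarrow> v + l \<in> U" by blast
  next
    assume "\<exists>k. \<forall>l. ord_ge k l \<longrightarrow> v + l \<in> U"
    then obtain k where k: "\<And>l. ord_ge k l \<Longrightarrow> v + l \<in> U" by blast
    define N where "N = nat \<bar>k + d\<bar>"
    have "1 * int N \<le> int q * int N" using q by (intro mult_right_mono) auto
    then have "k + d \<le> int q * int N" by (simp add: N_def)
    then have "\<forall>l\<in>adic_lattice S G N. v + l \<in> U"
      using k T_ord ord_ge_mono by (fastforce simp: adic_lattice_G)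
    then show "\<exists>N. \<forall>l\<in>adic_lattice S G N. v + l \<in> U" by blast
  qed
  then show ?thesis
    unfolding adic_open_spanning[OF fin_dim finite_G span_G] order_open_def by simp
qed

end

section \<open>Uniqueness of the action of Laurent series\<close>

lemma laurent_action_continuous:
  assumes fd: "fin_dim S" and top: "\<And>U. adic_open S U \<longleftrightarrow> order_open U"
  shows "\<exists>M. \<forall>h. ord_ge M h \<longrightarrow> ord_ge N (S h (v :: 'a::field fls))"
proof -
  interpret vector_space S using fd by (rule fin_dim_vector_space)
  have "order_open {l :: 'a fls. ord_ge N l}"
    unfolding order_open_def by (auto intro!: exI[of _ N] ord_ge_add)
  then have "adic_open S {l. ord_ge N l}" by (simp add: top)
  then obtain B where B: "finite_dimensional_vector_space S B"
    "\<forall>v\<in>{l. ord_ge N l}. \<exists>n. \<forall>l\<in>adic_lattice S B n. v + l \<in> {l. ord_ge N l}"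
    by (auto simp: adic_open_def)
  from B(2)[rule_format, of 0] obtain n where n: "\<And>l. l \<in> adic_lattice S B n \<Longrightarrow> ord_ge N l" by auto
  have fin: "finite B" "span B = UNIV"
    using B(1) unfolding finite_dimensional_vector_space_def finite_dimensional_vector_space_axioms_def by blast+
  obtain a where a: "v = (\<Sum>b\<in>B. S (a b) b)" by (rule finite_span_coeffs[OF fin])
  obtain m :: nat where m: "\<And>b. b \<in> B \<Longrightarrow> ord_ge (- int m) (a b)"
    using ex_pole_bound[OF fin(1), of a] by blast
  have "ord_ge N (S h v)" if "ord_ge (int n + int m) h" for h
  proof (rule n)
    have "S h v = (\<Sum>b\<in>B. S (h * a b) b)" by (simp add: a scale_sum_right)
    also have "\<dots> \<in> adic_lattice S B n"
      by (intro adic_lattice_memI vector_space_axioms ord_ge_mult'[OF that m]) auto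
    finally show "S h v \<in> adic_lattice S B n" .
  qed
  then show ?thesis by blast
qed

text \<open>
  Two such actions agree on Laurent polynomials. Truncating \<open>h\<close> at a high order changes \<open>S h v\<close> and \<open>S' h v\<close> only
  in high orders, because both actions are continuous for the same Hausdorff topology.
\<close>

lemma laurent_action_unique:
  fixes S S' :: "'a::field fls \<Rightarrow> 'a fls \<Rightarrow> 'a fls"
  assumes S: "fin_dim S" "\<And>U. adic_open S U \<longleftrightarrow> order_open U"
    and S': "fin_dim S'" "\<And>U. adic_open S' U \<longleftrightarrow> order_open U"
    and const: "\<And>c v. S (fls_const c) v = S' (fls_const c) v"
    and X: "\<And>v. S fls_X v = S' fls_X v"
  shows "S = S'"
proof (intro ext)
  fix h v
  interpret S: vector_space S using S(1) by (rule fin_dim_vector_space)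
  interpret S': vector_space S' using S'(1) by (rule fin_dim_vector_space)
  have inv: "S (inverse y) v = S' (inverse y) v" if "\<And>v. S y v = S' y v" "y \<noteq> 0" for y v
  proof -
    have "S (inverse y) v = S' (inverse y) (S' y (S (inverse y) v))" using that(2) by simp
    also have "S' y (S (inverse y) v) = v" using that by (simp flip: that(1))
    finally show ?thesis .
  qed
  have Xpow: "S (y ^ k) v = S' (y ^ k) v" if "\<And>v. S y v = S' y v" for y k v
    by (induction k arbitrary: v) (simp_all add: that flip: S.scale_scale S'.scale_scale)
  have Xj: "S (fls_X_intpow j) v = S' (fls_X_intpow j) v" for j v
  proof -
    have "S (fls_X powi j) v = S' (fls_X powi j) v"
      unfolding power_int_def by (auto intro!: Xpow inv X)
    then show ?thesis by simp
  qed
  have "ord_ge N (S h v - S' h v)" for N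
  proof -
    obtain M where M: "\<And>h. ord_ge M h \<Longrightarrow> ord_ge N (S h v)"
      using laurent_action_continuous[OF S] by blast
    obtain M' where M': "\<And>h. ord_ge M' h \<Longrightarrow> ord_ge N (S' h v)"
      using laurent_action_continuous[OF S'] by blast
    define p where "p = (\<Sum>j=fls_subdegree h..max M M'. fls_const (h $$ j) * fls_X_intpow j)"
    have tail: "ord_ge (max M M' + 1) (h - p)"
      unfolding p_def by (rule series_truncation[OF ord_ge_subdegree])
    have "S p v = S' p v"
      unfolding p_def by (simp add: S.scale_sum_left S'.scale_sum_left const Xj flip: S.scale_scale S'.scale_scale)
    then have "S h v - S' h v = S (h - p) v - S' (h - p) v"
      by (simp add: S.scale_left_diff_distrib S'.scale_left_diff_distrib)
    also have "ord_ge N \<dots>"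
      by (intro ord_ge_diff M M' ord_ge_mono[OF tail]) auto
    finally show ?thesis .
  qed
  then show "S h v = S' h v" using ord_ge_all_imp_0 by fastforce
qed

section \<open>The transform of a connection with a given solution\<close>

lemma fls_deriv_powi:
  fixes W :: "'a::field fls"
  assumes W: "W \<noteq> 0"
  shows "fls_deriv (W powi j) = of_int j * W powi (j - 1) * fls_deriv W"
proof (induction j rule: int_induct[of _ 0])
  case (step1 i)
  have "W powi (i + 1) = W powi i * W" using W by (simp add: power_int_add)
  moreover have "W powi i = W powi (i - 1) * W" using W power_int_add[of W "i - 1" 1] by simp
  ultimately show ?case using step1 by (simp add: fls_deriv_mult algebra_simps)
next
  case (step2 i)
  have i: "W powi i = W powi (i - 1) * W" "W powi (i - 1) = W powi (i - 1 - 1) * W"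
    using W power_int_add[of W "i - 1" 1] power_int_add[of W "i - 1 - 1" 1] by simp_all
  have "fls_deriv (W powi (i - 1)) * W = fls_deriv (W powi i) - W powi (i - 1) * fls_deriv W"
    by (subst i(1)) (simp add: fls_deriv_mult)
  also have "\<dots> = (of_int (i - 1) * W powi (i - 1 - 1) * fls_deriv W) * W"
    unfolding step2 using i(2) by (simp add: algebra_simps)
  finally show ?case using W by simp
qed simp

text \<open>
  Both sides are continuous in \<open>v\<close>, so the chain rule has to be checked only for powers of the
  indeterminate.
\<close>

lemma fls_compose_deriv:
  fixes w :: "'a::field fps"
  assumes w: "w $ 0 = 0" "w $ 1 \<noteq> 0"
  shows "fls_deriv (fls_compose_fps v w) = fls_compose_fps (fls_deriv v) w * fps_to_fls (fps_deriv w)"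
proof -
  have w_nz: "w \<noteq> 0" using w by auto
  note C = filtered_compose[OF w]
  have X: "fls_compose_fps (fls_X_intpow j) w = fps_to_fls w powi j" for j
    using fls_compose_fps_powi[OF w_nz w(1), of fls_X j] by simp
  have "filtered (-1) (\<lambda>v. fls_deriv (fls_compose_fps v w))"
    using filtered_comp[OF C filtered_deriv] by simp
  moreover have "filtered (-1) (\<lambda>v. fps_to_fls (fps_deriv w) * fls_compose_fps (fls_deriv v) w)"
    using filtered_comp[OF filtered_comp[OF filtered_deriv C] filtered_mult[OF ord_ge_fps]] by simp
  moreover have "fls_deriv (fls_compose_fps (fls_X_intpow j) w) =
      fps_to_fls (fps_deriv w) * fls_compose_fps (fls_deriv (fls_X_intpow j)) w" for j
  proof -
    have "fls_deriv (fls_X_intpow j :: 'a fls) = of_int j * fls_X_intpow (j - 1)"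
      using fls_deriv_powi[of fls_X j] by simp
    then have "fls_compose_fps (fls_deriv (fls_X_intpow j)) w = of_int j * fps_to_fls w powi (j - 1)"
      by (simp only: fls_compose_fps_mult[OF w_nz w(1)] X fls_compose_fps_of_int)
    then show ?thesis
      using w_nz by (simp add: X fls_deriv_powi fls_deriv_fps_to_fls)
  qed
  ultimately have "(\<lambda>v. fls_deriv (fls_compose_fps v w)) =
      (\<lambda>v. fps_to_fls (fps_deriv w) * fls_compose_fps (fls_deriv v) w)"
    by (rule filtered_ext)
  from fun_cong[OF this, of v] show ?thesis by (simp add: mult.commute)
qed

lemma fls_compose_lead:
  fixes w :: "'a::field fps"
  assumes w: "w $ 0 = 0" "w $ 1 \<noteq> 0"
  shows "fls_compose_fps (fls_X_intpow j) w $$ (j + 0) \<noteq> 0"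
proof -
  have w_nz: "w \<noteq> 0" "subdegree w = 1" using w by (auto intro!: subdegreeI)
  have "fls_compose_fps (fls_X_intpow j) w \<noteq> 0"
    by (simp add: fls_compose_fps_eq_0_iff[OF w_nz(1) w(1)])
  moreover have "fls_subdegree (fls_compose_fps (fls_X_intpow j) w) = j"
    using w w_nz by simp
  ultimately show ?thesis using nth_fls_subdegree_zero_iff by (metis add.right_neutral)
qed

lemma shift_aut_series:
  fixes n :: nat
  assumes n: "n > 0"
  shows "(fps_X * (fps_binomial (- 1 / of_nat n) oo fps_X ^ n)) ^ n =
      (fps_X / (1 + fps_X) oo fps_X ^ n :: 'a::field_char_0 fps)"
proof -
  have X0: "(fps_X ^ n :: 'a fps) $ 0 = 0" using n by simp
  have "(fps_X * (fps_binomial (- 1 / of_nat n) oo fps_X ^ n)) ^ n =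
      fps_X ^ n * ((fps_binomial (- 1 / of_nat n) ^ n) oo fps_X ^ n :: 'a fps)"
    by (simp add: power_mult_distrib fps_compose_power[OF X0])
  also have "fps_binomial (- 1 / of_nat n) ^ n = (inverse (1 + fps_X) :: 'a fps)"
    using n by (simp add: fps_binomial_power flip: fps_binomial_minus_one)
  also have "fps_X ^ n * (inverse (1 + fps_X) oo fps_X ^ n) = (fps_X * inverse (1 + fps_X) oo fps_X ^ n :: 'a fps)"
    using X0 n by (simp add: fps_compose_mult_distrib)
  also have "fps_X * inverse (1 + fps_X) = (fps_X / (1 + fps_X) :: 'a fps)"
    by (simp add: fps_divide_unit)
  finally show ?thesis .
qed

text \<open>
  The automorphism of \<open>k((\<theta>\<^sup>1\<^sup>/\<^sup>n))\<close> extends that of \<open>k((\<theta>))\<close>.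
\<close>

lemma shift_compose_power:
  fixes h :: "'a::field_char_0 fls"
  assumes n: "n > 0"
  shows "ramified_shift_aut n (fls_compose_power h n) = fls_compose_power (shift_aut h) n"
proof -
  let ?\<beta> = "fps_X * (fps_binomial (- 1 / of_nat n) oo fps_X ^ n) :: 'a fps"
  have \<beta>: "?\<beta> \<noteq> 0" "?\<beta> $ 0 = 0" using shift_series[of n, where 'a = 'a] n by auto
  have Xn: "fps_X ^ n \<noteq> (0 :: 'a fps)" "(fps_X ^ n :: 'a fps) $ 0 = 0" using n by auto
  have s: "fps_X / (1 + fps_X) \<noteq> (0 :: 'a fps)" "(fps_X / (1 + fps_X) :: 'a fps) $ 0 = 0"
    by (auto simp: fps_divide_unit)
  have pow: "fls_compose_power v n = fls_compose_fps v (fps_X ^ n)" for v :: "'a fls"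
  proof -
    let ?k = "fls_subdegree v"
    obtain p where v: "v = fls_shift (- ?k) (fps_to_fls p)"
      using ord_ge_0_conv_fps[of "fls_shift ?k v"] by (metis fls_shift_fls_shift fls_shift_0 ord_ge_iff_subdegree
        add.right_inverse fls_shift_eq0_iff fls_shift_subdegree diff_self order_refl)
    have "(fls_X ^ n) powi ?k = (fls_X_intpow (int n * ?k) :: 'a fls)"
      unfolding fls_X_power_int[symmetric] by (simp add: power_int_mult)
    then have "fls_compose_power (fls_shift (- ?k) (fps_to_fls p)) n =
        fls_compose_fps (fls_shift (- ?k) (fps_to_fls p)) (fps_X ^ n)"
      using n Xn
      by (simp add: fls_compose_fps_shift fls_compose_power_fps_to_fls fps_to_fls_power
          fls_X_intpow_times_conv_shift)
    then show ?thesis using v by simp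
  qed
  have "fps_X ^ n oo ?\<beta> = ?\<beta> ^ n"
    using fps_compose_power[OF \<beta>(2), of fps_X n] \<beta>(2) by (simp only: fps_X_fps_compose_startby0)
  then show ?thesis
    unfolding pow shift_aut_def ramified_shift_aut_def
      fls_compose_fps_assoc[OF Xn \<beta>] fls_compose_fps_assoc[OF s Xn] shift_aut_series[OF n, symmetric] by simp
qed

lemma vector_space_linearI:
  assumes "vector_space s1" "vector_space s2" "\<And>u v. F (u + v) = F u + F v" "\<And>c v. F (s1 c v) = s2 c (F v)"
  shows "Vector_Spaces.linear s1 s2 F"
  using assms unfolding Vector_Spaces.linear_def module_hom_def module_hom_axioms_def module_iff_vector_space
  by blast

lemma k_linear_of_filtered:
  assumes F: "filtered d F" and const: "\<And>c v. sc (fls_const c) v = fls_const c * v"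
  shows "k_linear sc F"
proof -
  have "vector_space (\<lambda>c v. fls_const c * v :: 'a fls)"
    by unfold_locales (simp_all add: algebra_simps flip: fls_plus_const fls_const_mult_const)
  then have "vector_space (\<lambda>c. sc (fls_const c))"
    unfolding const[abs_def] .
  then show ?thesis unfolding k_linear_def
    by (intro vector_space_linearI) (simp_all add: const filtered_add[OF F] filtered_scale[OF F])
qed

lemma bij_times: "c \<noteq> 0 \<Longrightarrow> bij (\<lambda>v :: 'a::field. c * v)"
  by (rule bij_betw_byWitness[where f' = "\<lambda>v. v / c"]) auto

text \<open>
  The hypothesis \<open>eq\<close> is the first equation of the system. It enters only through \<open>C_N\<close> below: composition
  with \<open>w\<close> turns \<open>z\<nabla>\<close> into the operator \<open>D\<close> of the locale \<open>saddle\<close>.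
\<close>

theorem local_mellin_isomorphism:
  fixes x :: "'a::field_char_0" and f :: "'a fls" and w :: "'a fps" and r s :: nat
  defines "Z \<equiv> fls_const x + fps_to_fls (w ^ r)"
  assumes x: "x \<noteq> 0" and r: "r > 0" and n: "n = r + s" and s: "s = 0 \<Longrightarrow> r = 1"
    and w: "w $ 0 = 0" "w $ 1 \<noteq> 0"
    and eq: "fls_compose_fps f w = - (fps_to_fls (w ^ r) / Z) * inverse (fls_X ^ n)"
    and hor: "\<not> has_horizontal_section (conn_E r f)"
  shows "difference_iso (local_mellin x (conn_E r f))
     (diff_D n (Z + fls_const (x * of_nat s / (2 * of_nat n)) * fls_X ^ n))"
proof -
  let ?g = "Z + fls_const (x * of_nat s / (2 * of_nat n)) * fls_X ^ n"
  let ?W = "fps_to_fls w"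
  have w_nz: "w \<noteq> 0" using w by auto
  have n_pos: "n > 0" using n r by simp
  have wr: "(w ^ r) $ r = (w $ 1) ^ r" "i < r \<Longrightarrow> (w ^ r) $ i = 0" for i
    using startsby_zero_power_nth_same[OF w(1)] startsby_zero_power_prefix[OF w(1)] by auto
  interpret saddle r s n x "(w $ 1) ^ r" Z
    by unfold_locales (use n r x w wr in \<open>auto simp: Z_def ord_ge_def\<close>)
  define C where "C v = fls_compose_fps v w" for v
  have C_filtered: "filtered 0 C" unfolding C_def by (rule filtered_compose[OF w])
  have C_lead: "C (fls_X_intpow j) $$ (j + 0) \<noteq> 0" for j
    unfolding C_def by (rule fls_compose_lead[OF w])
  have C_mult: "C (u * v) = C u * C v" for u v
    unfolding C_def by (rule fls_compose_fps_mult[OF w_nz w(1)])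
  have C_X: "C (fls_X_intpow j) = ?W powi j" for j
    unfolding C_def using fls_compose_fps_powi[OF w_nz w(1), of fls_X j] by simp
  have C_const: "C (fls_const a) = fls_const a" for a by (simp add: C_def)
  let ?z = "fls_const x + fls_X_intpow (int r) :: 'a fls"
  define nabla where "nabla v = ramified_deriv r v + fls_X_intpow (- int r) * f * v" for v
  define N where "N v = ?z * nabla v" for v
  have Wr: "?W powi int r = fps_to_fls (w ^ r)" by (simp add: fps_to_fls_power)
  have W_nz: "?W \<noteq> 0" using w_nz by simp
  have C_z: "C ?z = Z"
    by (simp only: filtered_add[OF C_filtered] C_const C_X Wr Z_def)
  have Z': "fls_deriv Z = of_nat r * ?W powi (int r - 1) * fls_deriv ?W"
  proof -
    have "fls_deriv Z = fls_deriv (?W powi int r)" unfolding Z_def Wr by simp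
    then show ?thesis by (simp only: fls_deriv_powi[OF W_nz] of_int_of_nat_eq)
  qed
  have C_N: "C (N v) = D (C v)" for v
  proof -
    have "C (ramified_deriv r v) = fls_const (1 / of_nat r) * ?W powi (1 - int r) * C (fls_deriv v)"
      unfolding ramified_deriv_def by (simp only: C_mult C_const C_X)
    moreover have "fls_deriv (C v) = C (fls_deriv v) * fls_deriv ?W"
      unfolding C_def by (simp add: fls_compose_deriv[OF w] fls_deriv_fps_to_fls)
    moreover have "fls_const (1 / of_nat r) * ?W powi (1 - int r) * (of_nat r * ?W powi (int r - 1)) = 1"
    proof -
      have "?W powi (1 - int r) * ?W powi (int r - 1) = 1"
        using W_nz by (simp flip: power_int_add)
      moreover have "fls_const (1 / of_nat r) * of_nat r = (1 :: 'a fls)"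
        using r by (simp add: fls_of_nat)
      moreover have "fls_const (1 / of_nat r) * ?W powi (1 - int r) * (of_nat r * ?W powi (int r - 1)) =
          (fls_const (1 / of_nat r) * of_nat r) * (?W powi (1 - int r) * ?W powi (int r - 1))"
        by (simp only: ac_simps)
      ultimately show ?thesis by simp
    qed
    moreover have "fls_const (1 / of_nat r) * ?W powi (1 - int r) * C (fls_deriv v) *
          (of_nat r * ?W powi (int r - 1) * fls_deriv ?W) =
        (fls_const (1 / of_nat r) * ?W powi (1 - int r) * (of_nat r * ?W powi (int r - 1))) *
          (C (fls_deriv v) * fls_deriv ?W)"
      by (simp only: ac_simps)
    ultimately have "C (ramified_deriv r v) * fls_deriv Z = fls_deriv (C v)"
      unfolding Z' by simp
    then have deriv: "Z * C (ramified_deriv r v) = P * fls_deriv (C v)"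
      using deriv_Z by (simp add: P_def field_simps)
    have "Z * (C (fls_X_intpow (- int r)) * C f) = - fls_X_intpow (- int n)"
    proof -
      have "C (fls_X_intpow (- int r)) * fps_to_fls (w ^ r) = 1"
        unfolding C_X Wr[symmetric] using W_nz power_int_add[of ?W "- int r" "int r"]
        by (metis add.left_inverse power_int_0_right)
      moreover have "inverse (fls_X ^ n) = (fls_X_intpow (- int n) :: 'a fls)"
        using fls_inverse_X_power[of n, where 'a = 'a] by (simp add: fls_X_inv_power_conv_shift_1)
      moreover have "Z * (C (fls_X_intpow (- int r)) * C f) =
          - (C (fls_X_intpow (- int r)) * fps_to_fls (w ^ r)) * inverse (fls_X ^ n)"
        using Z_nz unfolding C_def eq by (simp add: field_simps)
      ultimately show ?thesis by simp
    qed
    then have "Z * (C (fls_X_intpow (- int r)) * C f * C v) = - fls_X_intpow (- int n) * C v"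
      by (simp only: mult.assoc[symmetric])
    with deriv show ?thesis
      unfolding N_def C_mult C_z unfolding nabla_def filtered_add[OF C_filtered] C_mult D_def
      by (simp add: distrib_left mult.assoc)
  qed
  have no_kernel: "v = 0" if "D v = 0" for v
  proof -
    obtain u where u: "v = C u"
      using filtered_bij(1)[OF C_filtered C_lead] by (metis bij_pointE)
    have z_nz: "?z \<noteq> 0" using C_z Z_nz filtered_zero[OF C_filtered] by auto
    have "C (N u) = C 0" using that filtered_zero[OF C_filtered] by (simp add: C_N u)
    then have "N u = 0" using filtered_bij(1)[OF C_filtered C_lead] by (metis bij_pointE)
    then have "nabla u = 0" using z_nz by (simp add: N_def)
    then have "u = 0" using hor by (auto simp: has_horizontal_section_def conn_E_def nabla_def)
    then show ?thesis using u filtered_zero[OF C_filtered] by simp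
  qed
  obtain T0 where T0: "filtered (int n) T0" "\<And>j. T0 (fls_X_intpow j) $$ (j + int n) \<noteq> 0"
    "\<And>v. T0 (D v) = - (fls_X_intpow (- int n) * T0 v)"
    and T0_Z: "\<And>v. T0 (Z * v) = (Z + fls_const (x * of_nat s / (2 * of_nat n)) * fls_X_intpow (int n))
       * ramified_shift_aut n (T0 v)"
    using model_isomorphism[OF s no_kernel] by blast
  define T where "T v = T0 (C v)" for v
  have T_filtered: "filtered (int n) T"
    using filtered_comp[OF C_filtered T0(1)] by (simp add: T_def[abs_def])
  have T_lead: "T (fls_X_intpow j) $$ (j + int n) \<noteq> 0" for j
    using filtered_nth_lowest[OF T0(1), of j "C (fls_X_intpow j)"] C_lead[of j] T0(2)[of j]
      filtered_ord[OF C_filtered ord_ge_X_intpow, of j] by (simp add: T_def)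
  note T_bij = filtered_bij(1)[OF T_filtered T_lead]
  have T_N: "T (N v) = - (fls_X_intpow (- int n) * T v)" for v
    unfolding T_def C_N T0(3) ..
  have T_z: "T (?z * v) = ?g * ramified_shift_aut n (T v)" for v
    unfolding T_def C_mult C_z T0_Z by (simp add: fls_X_power_conv_shift_1)
  define S where "S h v = inv T (fls_compose_power h n * T v)" for h v
  interpret S: ramified_module n T S "int n"
    by unfold_locales
      (use T_bij n_pos filtered_ord_iff[OF T_filtered T_lead] in
        \<open>auto simp: S_def filtered_add[OF T_filtered] bij_is_surj surj_f_inv_f\<close>)
  interpret E: ramified_module r "\<lambda>v. v" "fst (conn_E r f)" 0
    by unfold_locales (use r in \<open>auto simp: conn_E_def bij_id[unfolded id_def]\<close>)
  have "- inv N v = S fls_X v" for v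
  proof -
    have "inj N"
    proof (rule injI)
      fix u v assume "N u = N v"
      then have "fls_X_intpow (- int n) * T u = fls_X_intpow (- int n) * T v"
        using T_N by (metis neg_equal_iff_equal)
      then show "u = v" using S.T_eqI fls_shift_eq0_iff[of "int n" "1 :: 'a fls"] by auto
    qed
    moreover have "N (- S fls_X v) = v"
    proof (rule S.T_eqI)
      have "fls_X_intpow (- int n) * (fls_X_intpow (int n) * T v) = T v"
        unfolding mult.assoc[symmetric] X_intpow_add[symmetric] by simp
      then show "T (N (- S fls_X v)) = T v"
        unfolding T_N filtered_uminus[OF T_filtered] S.T_S using n_pos by simp
    qed
    ultimately show ?thesis by (metis inv_f_f minus_equation_iff)
  qed
  moreover have N_eq: "N = (\<lambda>w. fst (conn_E r f) (fls_const x + fls_X) (snd (conn_E r f) w))"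
    using r by (simp add: fun_eq_iff N_def nabla_def conn_E_def)
  ultimately have theta: "S fls_X v = mellin_theta x (conn_E r f) v" for v
    by (simp add: mellin_theta_def)
  have const: "S (fls_const c) v = fst (conn_E r f) (fls_const c) v" for c v
    by (rule S.T_eqI) (use r n_pos in \<open>simp add: S.T_S conn_E_def filtered_scale[OF T_filtered]\<close>)
  have S_theta: "is_theta_action x (conn_E r f) S"
    unfolding is_theta_action_def using S.fin_dim const theta by (simp add: S.adic_open_iff E.adic_open_iff)
  have unique: "S' = S" if "is_theta_action x (conn_E r f) S'" for S'
    by (rule laurent_action_unique)
      (use that const theta S.fin_dim in \<open>auto simp: is_theta_action_def S.adic_open_iff E.adic_open_iff\<close>)
  have the_S: "(THE S'. is_theta_action x (conn_E r f) S') = S"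
    by (rule the_equality) (rule S_theta, rule unique)
  have mellin: "local_mellin x (conn_E r f) = (S, \<lambda>v. ?z * v)"
    unfolding local_mellin_def the_S using r by (simp add: conn_E_def)
  have g_nz: "?g \<noteq> 0"
  proof -
    have "?g $$ 0 = x" using Z_0 n_pos by simp
    then show ?thesis using x by (metis fls_zero_nth)
  qed
  have z_nz: "?z \<noteq> 0" using C_z Z_nz filtered_zero[OF C_filtered] by auto
  have z_ord: "ord_ge 0 ?z" by (simp add: ord_ge_def)
  have S_const: "S (fls_const c) v = fls_const c * v" for c v
    using r by (simp add: const conn_E_def)
  have diff_M: "is_difference_op (S, \<lambda>v. ?z * v)"
  proof -
    have "?z * S h v = S (shift_aut h) (?z * v)" for h v
      by (rule S.T_eqI)
        (simp only: T_z S.T_S shift_mult[OF n_pos] shift_compose_power[OF n_pos] mult.left_commute)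
    then show ?thesis unfolding is_difference_op_def
      using S.fin_dim k_linear_of_filtered[OF filtered_mult[OF z_ord] S_const] bij_times[OF z_nz] by simp
  qed
  have diff_N: "is_difference_op (diff_D n ?g)"
  proof -
    let ?\<phi> = "ramified_shift_aut n :: 'a fls \<Rightarrow> 'a fls"
    have g_ord: "ord_ge 0 ?g" using Z_ord by (simp add: ord_ge_def)
    have filt: "filtered 0 (\<lambda>v. ?g * ?\<phi> v)"
      using filtered_comp[OF shift_filtered[OF n_pos] filtered_mult[OF g_ord]] by simp
    have "bij (\<lambda>v. ?g * ?\<phi> v)"
      using bij_comp[OF filtered_bij(1)[OF shift_filtered[OF n_pos] shift_lead[OF n_pos]] bij_times[OF g_nz]]
      by (simp add: comp_def)
    moreover have "k_linear (\<lambda>h v. fls_compose_power h n * v) (\<lambda>v. ?g * ?\<phi> v)"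
      by (rule k_linear_of_filtered[OF filt]) (use n_pos in simp)
    moreover have "?g * ?\<phi> (fls_compose_power h n * v) = fls_compose_power (shift_aut h) n * (?g * ?\<phi> v)" for h v
      by (simp only: shift_mult[OF n_pos] shift_compose_power[OF n_pos] mult.left_commute)
    ultimately show ?thesis
      unfolding is_difference_op_def diff_D_def prod.case using fin_dim_ramified[OF n_pos] by blast
  qed
  have "Vector_Spaces.linear S (\<lambda>h v. fls_compose_power h n * v) T"
    by (intro vector_space_linearI S.vector_space fin_dim_vector_space[OF fin_dim_ramified[OF n_pos]]
        filtered_add[OF T_filtered] S.T_S)
  then show ?thesis
    unfolding difference_iso_def mellin using diff_M diff_N T_bij T_z
    by (auto simp: diff_D_def intro!: exI[of _ T])
qed

section \<open>Roots of power series and roots of unity\<close>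

lemma fps_nth_root_exists:
  fixes u :: "'a::{alg_closed_field, field_char_0} fps"
  assumes n: "n > 0" and u: "u $ 0 \<noteq> 0"
  obtains v where "v ^ n = u"
proof -
  obtain y where y: "y ^ n = u $ 0" using nth_root_exists[OF n] by blast
  obtain k where k: "n = Suc k" using n by (cases n) auto
  have "fps_radical (\<lambda>_ _. y) (Suc k) u ^ Suc k = u"
    using power_radical[OF u, of "\<lambda>_ _. y" k] y k by simp
  then show ?thesis using that k by blast
qed

lemma fps_power_eq_X_power:
  fixes y :: "'a::field_char_0 fps"
  assumes n: "n > 0" and y: "y ^ n = fps_X ^ n"
  obtains \<eta> where "\<eta> ^ n = 1" "y = fps_const \<eta> * fps_X"
proof -
  have "(y $ 0) ^ n = 0"
    using arg_cong[OF y, of "\<lambda>p. p $ 0"] n by (simp add: fps_nth_power_0 zero_power)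
  then have "y $ 0 = 0" by simp
  then have "y = fps_shift 1 y * fps_X" by (intro fps_ext) auto
  then obtain u where u: "y = u * fps_X" by blast
  have "u ^ n * fps_X ^ n = 1 * fps_X ^ n" using y by (simp add: u power_mult_distrib)
  then have un: "u ^ n = 1" by (subst (asm) mult_right_cancel) auto
  have "of_nat n * fps_deriv u * u ^ (n - 1) = 0"
    using arg_cong[OF un, of fps_deriv] by (simp add: fps_deriv_power')
  moreover have "u \<noteq> 0" using un n by (auto simp: power_0_left)
  ultimately have "fps_deriv u = 0" using n by simp
  then have uc: "u = fps_const (u $ 0)" by simp
  have "(u $ 0) ^ n = 1" using arg_cong[OF un, of "\<lambda>p. p $ 0"] by (simp add: fps_nth_power_0)
  then show ?thesis using that[of "u $ 0"] uc u by simp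
qed

lemma moebius_difference:
  fixes c u v e :: "'a::field"
  assumes "c + u \<noteq> 0" "c + v \<noteq> 0"
  shows "- (v / (c + v)) * e - - (u / (c + u)) * e = - (c * (v - u) * inverse (c + u) * inverse (c + v) * e)"
proof -
  have eq: "v / (c + v) - u / (c + u) = c * (v - u) * inverse (c + u) * inverse (c + v)"
    using assms by (simp add: divide_simps) (simp add: algebra_simps)
  show ?thesis unfolding eq[symmetric] by (simp add: left_diff_distrib)
qed

text \<open>
  A series of \<open>k((z\<^sup>1\<^sup>/\<^sup>q))\<close> that lies in \<open>k((z\<^sup>1\<^sup>/\<^sup>p))\<close> involves only exponents divisible by \<open>q / gcd q p\<close>,
  which exceeds 1 for \<open>0 < p < q\<close> and so has a prime factor.
\<close>

lemma ramified_support: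
  assumes ram: "in_ramified q p h" and p: "0 < p" "p < q"
  obtains d where "prime d" "d dvd q" "\<And>i. h $$ i \<noteq> 0 \<Longrightarrow> int d dvd i"
proof -
  obtain h' where h': "fls_compose_power h p = fls_compose_power h' q"
    using ram by (auto simp: in_ramified_def)
  define e where "e = q div gcd q p"
  have e: "q = e * gcd q p" "p = (p div gcd q p) * gcd q p" "gcd q p > 0" using p by (auto simp: e_def)
  have cop: "coprime e (p div gcd q p)" using p unfolding e_def by (intro div_gcd_coprime) auto
  have "e \<noteq> 1"
  proof
    assume "e = 1"
    then have "q dvd p" using e(1) by (metis gcd_dvd2 mult_1)
    then show False using p by (auto dest: dvd_imp_le)
  qed
  then obtain d where d: "prime d" "d dvd e" using prime_factor_nat by blast
  have "int d dvd i" if "h $$ i \<noteq> 0" for i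
  proof -
    have "fls_compose_power h p $$ (int p * i) \<noteq> 0"
      using that p by (simp add: fls_nth_compose_power)
    then have "int q dvd int p * i"
      unfolding h' using p by (simp add: fls_nth_compose_power split: if_splits)
    then have "int e * int (gcd q p) dvd int (p div gcd q p) * i * int (gcd q p)"
      using e by (metis mult.assoc mult.commute of_nat_mult)
    then have "int e dvd int (p div gcd q p) * i" using p by simp
    then have "int e dvd i" using cop by (simp add: coprime_dvd_mult_right_iff)
    then show ?thesis using d(2) by (meson dvd_trans of_nat_dvd_iff)
  qed
  moreover have "d dvd q" using d(2) e(1) by (metis dvd_mult2)
  ultimately show ?thesis using that d(1) by blast
qed

lemma in_ramified_of_support:
  fixes h :: "'a::field fls"
  assumes q: "q > 0" and d: "d dvd q" and supp: "\<And>i. h $$ i \<noteq> 0 \<Longrightarrow> int d dvd i"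
  shows "in_ramified q (q div d) h"
proof -
  obtain p where p: "q = d * p" using d by (elim dvdE)
  then have pos: "d > 0" "p > 0" using q by auto
  let ?K = "- \<bar>fls_subdegree h\<bar>"
  obtain h' where h'_ord: "ord_ge ?K h'" and h'_nth: "\<And>k. k \<ge> ?K \<Longrightarrow> h' $$ k = h $$ (int d * (?K + int (nat (k - ?K))))"
    using fls_of_coeffs[of ?K "\<lambda>k. h $$ (int d * (?K + int k))"] by blast
  have h': "h' $$ k = h $$ (int d * k)" for k
  proof (cases "k \<ge> ?K")
    case True
    then show ?thesis using h'_nth[of k] by simp
  next
    case False
    then have "int d * k \<le> 1 * k" using pos by (intro mult_right_mono_neg) auto
    then have "h $$ (int d * k) = 0" using False by (intro fls_eq0_below_subdegree) auto
    then show ?thesis using False h'_ord by (simp add: ord_ge_def)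
  qed
  have "fls_compose_power h p = fls_compose_power h' q"
  proof (rule fls_eqI)
    fix N
    show "fls_compose_power h p $$ N = fls_compose_power h' q $$ N"
    proof (cases "int p dvd N")
      case True
      then obtain i where N: "N = int p * i" by (elim dvdE)
      have lhs: "fls_compose_power h p $$ N = h $$ i" using pos N by (simp add: fls_nth_compose_power)
      show ?thesis
      proof (cases "int d dvd i")
        case True
        then obtain k where i: "i = int d * k" by (elim dvdE)
        have "N = int q * k" by (simp add: N i p)
        then have "fls_compose_power h' q $$ N = h' $$ k" using q by (simp add: fls_nth_compose_power)
        then show ?thesis using lhs by (simp add: h' i)
      next
        case False
        then have "\<not> int q dvd N" using pos by (simp add: N p mult.commute)
        then show ?thesis using lhs False supp[of i] q by (auto simp: fls_nth_compose_power)
      qed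
    next
      case False
      then have "\<not> int q dvd N" by (metis p dvd_mult_right of_nat_mult)
      then show ?thesis using False pos q by (simp add: fls_nth_compose_power)
    qed
  qed
  then show ?thesis unfolding in_ramified_def p using pos by auto
qed

lemma prime_root_of_unity:
  assumes d: "prime d"
  obtains \<zeta> :: "'a::{alg_closed_field, field_char_0}"
    where "\<zeta> ^ d = 1" "\<And>i. \<zeta> powi i = 1 \<longleftrightarrow> int d dvd i"
proof -
  define p :: "'a poly" where "p = (\<Sum>i<d. monom 1 i)"
  have d1: "d > 1" using d by (rule prime_gt_1_nat)
  have "coeff p (d - 1) = (\<Sum>i<d. if i = d - 1 then 1 else 0)"
    unfolding p_def coeff_sum by (intro sum.cong) auto
  then have "coeff p (d - 1) \<noteq> 0" using d1 by simp
  then have "degree p \<ge> d - 1" by (rule le_degree)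
  then have "degree p > 0" using d1 by simp
  then obtain \<zeta> where \<zeta>: "poly p \<zeta> = 0" using alg_closed_imp_poly_has_root by blast
  then have sum: "(\<Sum>i<d. \<zeta> ^ i) = 0" by (simp add: p_def poly_sum poly_monom)
  then have "\<zeta> \<noteq> 1" using d1 by auto
  have \<zeta>d: "\<zeta> ^ d = 1" using power_diff_1_eq[of \<zeta> d] sum by simp
  then have nz: "\<zeta> \<noteq> 0" using d1 by (auto simp: zero_power)
  have dvd: "\<zeta> powi (int d * k) = 1" for k
    using \<zeta>d by (simp add: power_int_mult)
  have "int d dvd i" if "\<zeta> powi i = 1" for i
  proof (rule ccontr)
    assume "\<not> int d dvd i"
    then have "coprime i (int d)" using d by (metis coprime_commute prime_imp_coprime prime_nat_int_transfer)
    then obtain u v where uv: "u * i + v * int d = 1" using bezout_int[of i "int d"] by auto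
    have "\<zeta> powi (u * i + v * int d) = \<zeta> powi (i * u) * \<zeta> powi (int d * v)"
      using nz by (simp add: power_int_add mult.commute)
    also have "\<dots> = (\<zeta> powi i) powi u * \<zeta> powi (int d * v)"
      by (simp only: power_int_mult)
    also have "\<dots> = 1" by (simp add: dvd that)
    finally show False using \<open>\<zeta> \<noteq> 1\<close> by (simp add: uv)
  qed
  moreover have "\<zeta> powi i = 1" if "int d dvd i" for i using that dvd by (auto elim!: dvdE)
  ultimately show ?thesis using that \<zeta>d by blast
qed

text \<open>
  The quotient of \<open>y\<^sup>k - 1\<close> by \<open>y - 1\<close> is a sum of \<open>k\<close> series with constant term 1, hence a unit in
  characteristic 0.
\<close>

lemma unit_power_close:
  fixes y :: "'a::field_char_0 fls"
  assumes y: "ord_ge 0 y" "y $$ 0 = 1" and k: "k > 0"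
  shows "ord_ge N (y ^ k - 1) \<longleftrightarrow> ord_ge N (y - 1)"
proof -
  have pow: "ord_ge 0 (y ^ i) \<and> (y ^ i) $$ 0 = 1" for i
  proof (induction i)
    case (Suc i)
    then show ?case
      using ord_ge_mult[OF y(1), of 0 "y ^ i"] mult_nth_lowest[OF y(1), of 0 "y ^ i"] y(2) by simp
  qed (simp add: ord_ge_def)
  define q where "q = (\<Sum>i<k. y ^ i)"
  have q: "ord_ge 0 q" "q $$ 0 \<noteq> 0"
    unfolding q_def using pow k by (auto intro!: ord_ge_sum simp: fls_nth_sum)
  have eq: "y ^ k - 1 = (y - 1) * q" unfolding q_def by (rule power_diff_1_eq)
  have "q \<noteq> 0" using q(2) by (metis fls_zero_nth)
  then have eq': "y - 1 = (y ^ k - 1) * inverse q" unfolding eq by (simp add: mult.assoc)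
  show ?thesis
    using ord_ge_mult'[of N "y - 1" 0 q N] q(1) ord_ge_mult'[of N "y ^ k - 1" 0 "inverse q" N] ord_ge_inverse[OF q]
    unfolding eq[symmetric] eq'[symmetric] by auto
qed

lemma unit_powi_close:
  fixes y :: "'a::field_char_0 fls"
  assumes y: "ord_ge 0 y" "y $$ 0 = 1" and close: "ord_ge N (y - 1)"
  shows "ord_ge N (y powi i - 1)"
proof -
  have nat: "ord_ge N (y ^ k - 1)" if "ord_ge 0 y" "y $$ 0 = 1" "ord_ge N (y - 1)" for k and y :: "'a fls"
    using unit_power_close[OF that(1,2), of k N] that(3) by (cases "k = 0") auto
  have y_nz: "y \<noteq> 0" using y(2) by (metis fls_zero_nth zero_neq_one)
  have inv_ord: "ord_ge 0 (inverse y)" using y by (intro ord_ge_inverse) auto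
  have "(y * inverse y) $$ (0 + 0) = inverse y $$ 0"
    unfolding mult_nth_lowest[OF y(1) inv_ord] y(2) by simp
  then have inv_0: "inverse y $$ 0 = 1" using y_nz by simp
  have "inverse y - 1 = - (inverse y * (y - 1))" using y_nz by (simp add: algebra_simps)
  then have "ord_ge N (inverse y - 1)"
    using ord_ge_mult[OF inv_ord close] by (simp add: ord_ge_uminus)
  then show ?thesis
    unfolding power_int_def using nat[OF y close] nat[OF inv_ord inv_0] by simp
qed

section \<open>Solutions of the system\<close>

locale mellin_system =
  fixes x :: "'a::{alg_closed_field, field_char_0}" and f :: "'a fls" and r s n :: nat
  assumes x: "x \<noteq> 0" and r: "r > 0" and n: "n = r + s"
    and f_subdegree: "fls_subdegree f = - int s" and f_nz: "f \<noteq> 0"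
begin

definition solution :: "'a fps \<Rightarrow> bool" where
  "solution w \<longleftrightarrow> w \<noteq> 0 \<and> w $ 0 = 0 \<and>
     fls_compose_fps f w =
       - (fps_to_fls (w ^ r) / (fls_const x + fps_to_fls (w ^ r))) * inverse (fls_X ^ n)"

definition g_of :: "'a fps \<Rightarrow> 'a fls" where
  "g_of w = fls_const x + fps_to_fls (w ^ r) + fls_const (x * of_nat s / (2 * of_nat n)) * fls_X ^ n"

lemma n_pos: "n > 0" using n r by simp

lemma solves_system_iff: "solves_system x r s f g \<longleftrightarrow> (\<exists>w. solution w \<and> g = g_of w)"
proof -
  have "of_nat s + of_nat r = (of_nat n :: 'a)" by (simp add: n)
  then show ?thesis
    unfolding solves_system_def Let_def n[symmetric] solution_def g_of_def by auto
qed

lemma z_nz: "w $ 0 = 0 \<Longrightarrow> fls_const x + fps_to_fls (w ^ r) \<noteq> 0"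
  and z_subdegree: "w $ 0 = 0 \<Longrightarrow> fls_subdegree (fls_const x + fps_to_fls (w ^ r)) = 0"
proof -
  assume w: "w $ 0 = 0"
  have "(fls_const x + fps_to_fls (w ^ r)) $$ 0 \<noteq> 0"
    using x w r by (simp add: fps_nth_power_0 zero_power)
  then show "fls_const x + fps_to_fls (w ^ r) \<noteq> 0" "fls_subdegree (fls_const x + fps_to_fls (w ^ r)) = 0"
    by (metis fls_zero_nth, intro fls_subdegree_eqI) auto
qed

lemma solution_order:
  assumes "solution w"
  shows "w $ 1 \<noteq> 0"
proof -
  have w: "w \<noteq> 0" "w $ 0 = 0" and eq: "fls_compose_fps f w =
       - (fps_to_fls (w ^ r) / (fls_const x + fps_to_fls (w ^ r))) * inverse (fls_X ^ n)"
    using assms by (auto simp: solution_def)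
  have "fls_subdegree (fls_compose_fps f w) = int r * int (subdegree w) - int n"
    unfolding eq using w z_nz[OF w(2)] z_subdegree[OF w(2)]
    by (simp add: divide_inverse fls_subdegree_fls_to_fps)
  then have "- int s * int (subdegree w) = int r * int (subdegree w) - int n"
    using f_subdegree w(2) by simp
  moreover have "int n * int (subdegree w) = int r * int (subdegree w) + int s * int (subdegree w)"
    by (simp add: n distrib_right)
  ultimately have "int n * int (subdegree w) = int n" by simp
  then have "subdegree w = 1" using n_pos by simp
  then show ?thesis by (metis nth_subdegree_nonzero w(1))
qed

text \<open>
  The series \<open>z\<^sub>x\<^sup>-\<^sup>1 f z\<close>, which is the symbol of \<open>z\<nabla>\<close>. In terms of it the first equation becomes
  \<open>K(w) = -\<theta>\<^sup>-\<^sup>1\<close>.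
\<close>

definition K :: "'a fls" where "K = fls_X_intpow (- int r) * f * (fls_const x + fls_X_intpow (int r))"

lemma solution_iff:
  assumes w: "w \<noteq> 0" "w $ 0 = 0"
  shows "solution w \<longleftrightarrow> fls_compose_fps K w = - inverse (fls_X ^ n)"
proof -
  let ?W = "fps_to_fls (w ^ r)"
  let ?z = "fls_const x + ?W"
  have X: "fls_compose_fps (fls_X_intpow j) w = fps_to_fls w powi j" for j
    using fls_compose_fps_powi[OF w, of fls_X j] by simp
  have "fls_compose_fps K w = inverse ?W * fls_compose_fps f w * ?z"
    unfolding K_def
    by (simp only: fls_compose_fps_mult[OF w] fls_compose_fps_add[OF w] X)
      (simp add: power_int_minus fps_to_fls_power)
  moreover have "F = - (?W / ?z) * A \<longleftrightarrow> inverse ?W * F * ?z = - A" for F A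
    using w z_nz[OF w(2)] by (simp add: field_simps)
  ultimately show ?thesis
    unfolding solution_def using w by simp
qed

lemma K_nz: "K \<noteq> 0" and K_subdegree: "fls_subdegree K = - int n"
proof -
  have "(fls_const x + fls_X_intpow (int r)) $$ 0 \<noteq> 0" using x r by simp
  then have "fls_const x + fls_X_intpow (int r) \<noteq> 0"
    "fls_subdegree (fls_const x + fls_X_intpow (int r)) = 0"
    by (metis fls_zero_nth, intro fls_subdegree_eqI) auto
  moreover have "fls_shift (int r) 1 \<noteq> (0 :: 'a fls)" by (simp add: fls_shift_eq0_iff)
  ultimately show "K \<noteq> 0" "fls_subdegree K = - int n"
    using f_nz f_subdegree by (simp_all add: K_def n)
qed

text \<open>
  Writing \<open>K = -H\<^sup>-\<^sup>n\<close> with \<open>H\<close> of order 1, the compositional inverse of \<open>H\<close> is a solution.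
\<close>

lemma solution_exists: "\<exists>w. solution w"
proof -
  have "fls_subdegree (- inverse K) = int n" using K_nz K_subdegree by simp
  then have "ord_ge 0 (fls_shift (int n) (- inverse K))" by (auto simp: ord_ge_def)
  define u where "u = fls_regpart (fls_shift (int n) (- inverse K))"
  have u0: "u $ 0 \<noteq> 0"
    using K_nz nth_fls_subdegree_nonzero[of "- inverse K"] \<open>fls_subdegree (- inverse K) = int n\<close>
    by (simp add: u_def del: nth_fls_subdegree_nonzero)
  have u: "- inverse K = fls_X ^ n * fps_to_fls u"
    unfolding u_def ord_ge_0_conv_fps[OF \<open>ord_ge 0 _\<close>] by (simp add: fls_X_power_times_conv_shift)
  obtain v where v: "v ^ n = u" using fps_nth_root_exists[OF n_pos u0] by blast
  define H where "H = fps_X * v"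
  have "v $ 0 \<noteq> 0" using u0 v n_pos by (auto simp: fps_nth_power_0 zero_power)
  then have H: "H $ 0 = 0" "H $ 1 \<noteq> 0" by (simp_all add: H_def)
  have K: "K = - inverse (fps_to_fls (H ^ n))"
  proof -
    have "fps_to_fls (H ^ n) = - inverse K"
      unfolding u by (simp add: H_def power_mult_distrib v fls_times_fps_to_fls fps_to_fls_power)
    then show ?thesis by simp
  qed
  define w where "w = fps_inv H"
  have "H oo w = fps_X" unfolding w_def by (rule fps_inv_right[OF H])
  moreover have w0: "w $ 0 = 0" by (simp add: w_def fps_inv_def)
  ultimately have w: "w \<noteq> 0" by auto
  have "fls_compose_fps K w = - inverse (fls_X ^ n)"
    unfolding K using \<open>H oo w = fps_X\<close>
    by (simp add: fls_compose_fps_inverse[OF w w0] fls_compose_fps_to_fls[OF w w0]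
        fps_compose_power[OF w0, symmetric] fps_to_fls_power fls_compose_fps_power[OF w w0] H_def[symmetric])
  then show ?thesis using solution_iff[OF w w0] by blast
qed

text \<open>
  If \<open>v\<close> is the compositional inverse of \<open>w\<close>, then \<open>K = -v\<^sup>-\<^sup>n\<close>, so \<open>v(w')\<close> is an \<open>n\<close>-th root of \<open>t\<^sup>n\<close>.
\<close>

lemma solutions_conjugate:
  assumes w: "solution w" and w': "solution w'"
  obtains \<eta> where "\<eta> ^ n = 1" "w' = w oo (fps_const \<eta> * fps_X)"
proof -
  have w0: "w \<noteq> 0" "w $ 0 = 0" "w $ 1 \<noteq> 0" using w solution_order by (auto simp: solution_def)
  have w0': "w' \<noteq> 0" "w' $ 0 = 0" using w' by (auto simp: solution_def)
  define v where "v = fps_inv w"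
  have v0: "v $ 0 = 0" by (simp add: v_def fps_inv_def)
  have wv: "w oo v = fps_X" unfolding v_def using w0 by (intro fps_inv_right) auto
  then have v_nz: "v \<noteq> 0" using w0 by auto
  have "fls_compose_fps K (w oo v) = fls_compose_fps (- inverse (fls_X ^ n)) v"
    using solution_iff[OF w0(1,2)] w by (simp flip: fls_compose_fps_assoc[OF w0(1,2) v_nz v0])
  moreover have "fls_compose_fps K fps_X = K"
    by (rule fls_eqI) (use fls_nth_fls_compose_fps_linear[of 1 K] in simp)
  ultimately have K: "K = - inverse (fps_to_fls v ^ n)"
    by (simp add: wv fls_compose_fps_inverse[OF v_nz v0] fls_compose_fps_power[OF v_nz v0])
  have "- inverse (fls_X ^ n) = fls_compose_fps K w'"
    using solution_iff[OF w0'] w' by simp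
  also have "\<dots> = - inverse (fps_to_fls (v oo w') ^ n)"
    unfolding K by (simp add: fls_compose_fps_inverse[OF w0'] fls_compose_fps_power[OF w0'] fls_compose_fps_to_fls[OF w0'])
  finally have "fps_to_fls (v oo w') ^ n = fls_X ^ n" by simp
  then have "fps_to_fls ((v oo w') ^ n) = fps_to_fls (fps_X ^ n)" by (simp add: fps_to_fls_power)
  then have "(v oo w') ^ n = fps_X ^ n" by (simp only: fps_to_fls_eq_iff)
  then obtain \<eta> where \<eta>: "\<eta> ^ n = 1" "v oo w' = fps_const \<eta> * fps_X"
    using fps_power_eq_X_power[OF n_pos] by blast
  \<comment> \<open>As \<open>v\<close> is inverse to \<open>w\<close>, applying \<open>w\<close> to \<open>v(w') = \<eta>t\<close> recovers \<open>w'\<close>.\<close>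
  have "w oo (v oo w') = w'"
    unfolding fps_compose_assoc[OF w0'(2) v0] wv using w0'(2) by simp
  then show ?thesis using that \<eta> by simp
qed

lemma galois_g_of:
  assumes \<eta>: "\<eta> ^ n = 1"
  shows "galois_act \<eta> (g_of w) = g_of (w oo (fps_const \<eta> * fps_X))"
proof -
  have nz: "\<eta> \<noteq> 0" using root_of_unity_nonzero[OF n_pos \<eta>] .
  have H: "fps_const \<eta> * fps_X \<noteq> 0" "(fps_const \<eta> * fps_X) $ 0 = 0" using nz by auto
  show ?thesis
    unfolding g_of_def galois_act_def
      fls_compose_fps_add[OF H] fls_compose_fps_mult[OF H] fls_compose_fps_power[OF H] fls_compose_fps_to_fls[OF H]
    using \<eta> by (simp add: fps_compose_power[OF H(2)] fls_times_fps_to_fls[of _ fps_X, simplified]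
        power_mult_distrib flip: fls_const_power)
qed

lemma solution_galois:
  assumes w: "solution w" and \<eta>: "\<eta> ^ n = 1"
  shows "solution (w oo (fps_const \<eta> * fps_X))"
proof -
  let ?H = "fps_const \<eta> * fps_X"
  have "\<eta> \<noteq> 0" using root_of_unity_nonzero[OF n_pos \<eta>] .
  then have H: "?H \<noteq> 0" "?H $ 0 = 0" by auto
  have w0: "w \<noteq> 0" "w $ 0 = 0" using w by (auto simp: solution_def)
  have "fls_compose_fps K (w oo ?H) = fls_compose_fps (- inverse (fls_X ^ n)) ?H"
    using solution_iff[OF w0] w by (simp flip: fls_compose_fps_assoc[OF w0 H])
  also have "\<dots> = - inverse (fps_to_fls (?H ^ n))"
    by (simp add: fls_compose_fps_inverse[OF H] fls_compose_fps_power[OF H] fps_to_fls_power)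
  also have "?H ^ n = fps_X ^ n" using \<eta> by (simp add: power_mult_distrib fps_const_power)
  finally have "fls_compose_fps K (w oo ?H) = - inverse (fls_X ^ n)" by (simp add: fps_to_fls_power)
  then show ?thesis
    using w0 H by (subst solution_iff) (simp_all add: fps_compose_eq_0_iff)
qed

lemma g_of_nth_0: "solution w \<Longrightarrow> g_of w $$ 0 = x"
  using n_pos r by (simp add: g_of_def solution_def fps_nth_power_0 zero_power)

lemma g_of_ord: "ord_ge 0 (g_of w)"
  by (simp add: g_of_def ord_ge_def)

lemma g_of_nz: "solution w \<Longrightarrow> g_of w \<noteq> 0"
  using g_of_nth_0 x by (metis fls_zero_nth)

lemma solutions_related: "solution w \<Longrightarrow> solution w' \<Longrightarrow> (g_of w, g_of w') \<in> S_rel n"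
proof -
  assume w: "solution w" and w': "solution w'"
  obtain \<eta> where \<eta>: "\<eta> ^ n = 1" "w' = w oo (fps_const \<eta> * fps_X)"
    using solutions_conjugate[OF w w'] .
  have "galois_act \<eta> (g_of w) = g_of w'" by (simp add: galois_g_of \<eta>)
  then show ?thesis
    unfolding S_rel_def using \<eta>(1) g_of_nz w w'
    by (auto intro!: exI[of _ \<eta>] exI[of _ "0::int"] simp: little_o_def)
qed

section \<open>Ramification of f and of g\<close>

text \<open>
  Let \<open>\<sigma>\<close> be the substitution \<open>t \<mapsto> \<zeta>t\<close> for a primitive \<open>d\<close>-th root of unity. The support condition says that
  \<open>w\<^sup>r\<close> is \<open>\<sigma>\<close>-invariant up to order \<open>n\<close>. By the first equation \<open>f(w)\<close> is then invariant up to order 0.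
  Taking \<open>r\<close>-th roots, \<open>w(\<zeta>t) = \<zeta>w(t) (1 + o(t\<^sup>s))\<close>, and since \<open>f\<close> has order \<open>-s\<close>, replacing \<open>w(\<zeta>t)\<close> by
  \<open>\<zeta>w(t)\<close> inside \<open>f\<close> does not matter up to order 0 either. Together, \<open>f(\<zeta>u) - f(u)\<close> has positive order.
\<close>

lemma ramification_descends:
  assumes w: "solution w" and d: "prime d" "d dvd n"
    and supp: "\<And>i. i < int n \<Longrightarrow> g_of w $$ i \<noteq> 0 \<Longrightarrow> int d dvd i"
  shows "d dvd r" and "\<And>i. i \<le> 0 \<Longrightarrow> f $$ i \<noteq> 0 \<Longrightarrow> int d dvd i"
proof -
  have w0: "w \<noteq> 0" "w $ 0 = 0" "w $ 1 \<noteq> 0" using w solution_order by (auto simp: solution_def)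
  let ?W = "fps_to_fls w"
  define V where "V = ?W ^ r"
  have V: "fps_to_fls (w ^ r) = V" by (simp add: V_def fps_to_fls_power)
  have V_ord: "ord_ge (int r) V" and V_r: "V $$ int r \<noteq> 0"
    unfolding V[symmetric]
    using startsby_zero_power_nth_same[OF w0(2), of r] startsby_zero_power_prefix[OF w0(2), of r] w0(3)
    by (auto simp: ord_ge_def)
  have V_supp: "int d dvd i" if "i \<le> int n" "V $$ i \<noteq> 0" for i
  proof (cases "i = int n")
    case False
    have "i > 0" using that V_ord r by (metis le_less_linear less_trans of_nat_0_less_iff order_le_less ord_geD)
    then have "g_of w $$ i = V $$ i" using False by (simp add: g_of_def V)
    then show ?thesis using supp[of i] that False by simp
  qed (use d in simp)
  show "d dvd r" using V_supp[of "int r"] V_r n by simp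
  obtain \<zeta> :: 'a where \<zeta>: "\<zeta> ^ d = 1" "\<And>i. \<zeta> powi i = 1 \<longleftrightarrow> int d dvd i"
    using prime_root_of_unity[OF d(1)] by blast
  have \<zeta>_nz: "\<zeta> \<noteq> 0" using \<zeta>(1) d(1) by (metis power_0_left prime_gt_0_nat zero_neq_one less_irrefl)
  have \<zeta>_pow: "\<zeta> ^ k = 1 \<longleftrightarrow> d dvd k" for k
    using \<zeta>(2)[of "int k"] by simp
  let ?H = "fps_const \<zeta> * fps_X"
  have H: "?H \<noteq> 0" "?H $ 0 = 0" using \<zeta>_nz by auto
  let ?\<sigma> = "galois_act \<zeta>"
  let ?C = "\<lambda>v. fls_compose_fps v w"
  define A :: "'a fls" where "A = inverse (fls_X ^ n)"
  define Z where "Z = fls_const x + V"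
  have \<sigma>V: "ord_ge (int n + 1) (?\<sigma> V - V)"
    unfolding ord_ge_def
  proof (intro allI impI)
    fix i assume "i < int n + 1"
    then show "(?\<sigma> V - V) $$ i = 0"
      using V_supp[of i] \<zeta>(2)[of i] by (cases "V $$ i = 0") (auto simp: galois_act_nth[OF \<zeta>_nz])
  qed
  have Z_ord: "ord_ge 0 Z" and Z_0: "Z $$ 0 = x"
    using V_ord r by (auto simp: Z_def ord_ge_def)
  have \<sigma>Z_ord: "ord_ge 0 (?\<sigma> Z)" and \<sigma>Z_0: "?\<sigma> Z $$ 0 = x"
    using Z_ord Z_0 by (auto simp: ord_ge_def galois_act_nth[OF \<zeta>_nz])
  have Z_nz: "Z \<noteq> 0" "?\<sigma> Z \<noteq> 0" using Z_0 \<sigma>Z_0 x by (metis fls_zero_nth)+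
  have f_eq: "?C f = - (V / Z) * A"
    using w unfolding solution_def V Z_def A_def by simp
  have \<sigma>_hom: "?\<sigma> (u * v) = ?\<sigma> u * ?\<sigma> v" "?\<sigma> (u / v) = ?\<sigma> u / ?\<sigma> v" for u v
    using galois_act_hom[OF \<zeta>_nz] by auto
  have \<sigma>A: "?\<sigma> A = A"
  proof -
    have "?\<sigma> (1 / fls_X ^ n) = 1 / fls_X ^ n"
      unfolding \<sigma>_hom galois_act_hom(3)[OF \<zeta>_nz]
      using galois_act_X_power[OF n_pos, of \<zeta> 1] \<zeta>_pow[of n] d(2) by simp
    then show ?thesis by (simp add: A_def divide_inverse)
  qed
  have A_ord: "ord_ge (- int n) A" by (simp add: A_def ord_ge_iff_subdegree)
  have 1: "ord_ge 1 (?\<sigma> (?C f) - ?C f)"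
  proof -
    have \<sigma>F: "?\<sigma> (?C f) = - (?\<sigma> V / ?\<sigma> Z) * A"
      unfolding f_eq using \<sigma>A \<sigma>_hom galois_act_diff[OF \<zeta>_nz, of 0] by (simp add: galois_act_def)
    have \<sigma>Z: "?\<sigma> Z = fls_const x + ?\<sigma> V"
      unfolding Z_def by (rule fls_eqI) (simp add: galois_act_nth[OF \<zeta>_nz])
    have "?\<sigma> (?C f) - ?C f = - (fls_const x * (?\<sigma> V - V) * inverse Z * inverse (?\<sigma> Z) * A)"
      unfolding \<sigma>F unfolding f_eq \<sigma>Z unfolding Z_def
      by (rule moebius_difference[OF Z_nz(1)[unfolded Z_def] Z_nz(2)[unfolded \<sigma>Z]])
    moreover have "ord_ge (int n + 1 + 0 + 0 + - int n) (fls_const x * (?\<sigma> V - V) * inverse Z * inverse (?\<sigma> Z) * A)"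
      by (intro ord_ge_mult ord_ge_const_mult \<sigma>V ord_ge_inverse Z_ord \<sigma>Z_ord A_ord)
        (simp_all add: Z_0 \<sigma>Z_0 x)
    ultimately show ?thesis using ord_ge_uminus by fastforce
  qed
  define w1 where "w1 = w oo ?H"
  define w2 where "w2 = fps_const \<zeta> * w"
  have w1: "w1 $ 0 = 0" "w1 $ 1 \<noteq> 0" and w2: "w2 $ 0 = 0" "w2 $ 1 \<noteq> 0"
    and w1_1: "w1 $ 1 = \<zeta> * w $ 1"
    using w0 \<zeta>_nz by (simp_all add: w1_def w2_def fps_compose_linear)
  have nz12: "w1 \<noteq> 0" "w2 \<noteq> 0" using w1 w2 by auto
  have W1: "fps_to_fls w1 = ?\<sigma> ?W"
    unfolding w1_def galois_act_def by (rule fls_compose_fps_to_fls[OF H, symmetric])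
  have \<sigma>C: "?\<sigma> (?C v) = fls_compose_fps v w1" for v
    unfolding w1_def galois_act_def by (rule fls_compose_fps_assoc[OF w0(1,2) H])
  have C\<sigma>: "?C (?\<sigma> v) = fls_compose_fps v w2" for v
  proof -
    have "?H oo w = w2" using w0(2) by (simp add: fps_compose_mult_distrib w2_def)
    then show ?thesis unfolding galois_act_def by (simp add: fls_compose_fps_assoc[OF H w0(1,2)])
  qed
  \<comment> \<open>\<open>w1\<close> is \<open>w(\<zeta>t)\<close>, \<open>w2\<close> is \<open>\<zeta>w(t)\<close>, and \<open>y\<close> is their ratio.\<close>
  define y where "y = fps_to_fls w1 / fps_to_fls w2"
  have W12: "fps_to_fls w1 = fps_to_fls w2 * y" using nz12 by (simp add: y_def)
  have w12_sub: "subdegree w1 = 1" "subdegree w2 = 1"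
    using w1 w2 by (auto intro!: subdegreeI)
  have y_ord: "ord_ge 0 y"
    using nz12 w12_sub by (simp add: y_def ord_ge_iff_subdegree divide_inverse fls_subdegree_fls_to_fps)
  have w2_ord: "ord_ge 1 (fps_to_fls w2)" using w12_sub by (simp add: ord_ge_iff_subdegree fls_subdegree_fls_to_fps)
  have "(fps_to_fls w2 * y) $$ (1 + 0) = fps_to_fls w2 $$ 1 * y $$ 0"
    by (rule mult_nth_lowest[OF w2_ord y_ord])
  then have y_0: "y $$ 0 = 1" unfolding W12[symmetric] using w0(3) \<zeta>_nz w1_1 by (simp add: w2_def)
  have "ord_ge (int s + 1) (y ^ r - 1)"
  proof -
    have "fps_to_fls w2 ^ r = V"
      using \<zeta>_pow[of r] \<open>d dvd r\<close>
      by (simp add: w2_def V_def power_mult_distrib fls_times_fps_to_fls flip: fls_const_power)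
    moreover have "fps_to_fls w1 ^ r = ?\<sigma> V"
      unfolding W1 V_def galois_act_def by (rule fls_compose_fps_power[OF H, symmetric])
    ultimately have "V * y ^ r = ?\<sigma> V" unfolding W12 power_mult_distrib by simp
    moreover have "V \<noteq> 0" using V_r by (metis fls_zero_nth)
    ultimately have "y ^ r - 1 = (?\<sigma> V - V) * inverse V" by (simp add: field_simps)
    moreover have "fls_subdegree V = int r" using V_r V_ord by (intro fls_subdegree_eqI) (auto simp: ord_ge_def)
    then have "ord_ge (- int r) (inverse V)" by (simp add: ord_ge_iff_subdegree)
    ultimately show ?thesis using ord_ge_mult'[OF \<sigma>V] n by simp
  qed
  then have y_close: "ord_ge (int s + 1) (y - 1)" using unit_power_close[OF y_ord y_0 r] by simp
  have filt: "filtered 0 (\<lambda>v. fls_compose_fps v w1 - fls_compose_fps v w2)"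
    by (intro filtered_minus filtered_compose w1 w2)
  have "filtered (int s + 1) (\<lambda>v. fls_compose_fps v w1 - fls_compose_fps v w2)"
  proof (rule filtered_improve[OF filt])
    fix j
    have X: "fls_compose_fps (fls_X_intpow j) w = fps_to_fls w powi j" if "w \<noteq> 0" "w $ 0 = 0" for w :: "'a fps"
      using fls_compose_fps_powi[OF that, of fls_X j] by simp
    have "fls_compose_fps (fls_X_intpow j) w1 - fls_compose_fps (fls_X_intpow j) w2 =
        fps_to_fls w2 powi j * (y powi j - 1)"
      unfolding X[OF nz12(1) w1(1)] X[OF nz12(2) w2(1)] W12 by (simp add: power_int_mult_distrib algebra_simps)
    moreover have "ord_ge j (fps_to_fls w2 powi j)"
      using w12_sub nz12 by (simp add: ord_ge_iff_subdegree fls_subdegree_fls_to_fps)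
    ultimately show "ord_ge (j + (int s + 1)) (fls_compose_fps (fls_X_intpow j) w1 - fls_compose_fps (fls_X_intpow j) w2)"
      using ord_ge_mult unit_powi_close[OF y_ord y_0 y_close] by metis
  qed
  from filtered_ord[OF this, of "- int s" f]
  have 2: "ord_ge 1 (?\<sigma> (?C f) - ?C (?\<sigma> f))"
    using f_subdegree by (simp add: \<sigma>C C\<sigma> ord_ge_iff_subdegree)
  have "ord_ge (1 + 0) (?C (?\<sigma> f - f))"
    using ord_ge_diff[OF 1 2] by (simp add: fls_compose_fps_diff[OF w0(1,2)])
  then have \<sigma>f: "ord_ge 1 (?\<sigma> f - f)"
    using filtered_ord_iff[OF filtered_compose[OF w0(2,3)] fls_compose_lead[OF w0(2,3)], of 1] by blast
  show "int d dvd i" if "i \<le> 0" "f $$ i \<noteq> 0" for i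
    using ord_geD[OF \<sigma>f, of i] that \<zeta>(2)[of i] by (simp add: galois_act_nth[OF \<zeta>_nz])
qed

end

text \<open>
  The terms of positive order can be dropped within the class of \<open>f\<close>.
\<close>

lemma truncation_in_class:
  fixes f :: "'a::field fls"
  obtains h where "h \<in> R_rel r `` {f}" "\<And>i. h $$ i \<noteq> 0 \<Longrightarrow> i \<le> 0 \<and> f $$ i \<noteq> 0"
proof -
  define h where "h = (\<Sum>j=fls_subdegree f..0. fls_const (f $$ j) * fls_X_intpow j)"
  have "ord_ge (0 + 1) (f - h)"
    unfolding h_def by (rule series_truncation[OF ord_ge_subdegree])
  then have "(f, h) \<in> R_rel r"
    unfolding R_rel_def
    by (auto intro!: exI[of _ "1::'a"] exI[of _ "0::int"] simp: galois_act_1 little_o_iff_ord_ge)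
  moreover have "h $$ i = (if i \<in> {fls_subdegree f..0} then f $$ i else 0)" for i
  proof -
    have "h $$ i = (\<Sum>j\<in>{fls_subdegree f..0}. if j = i then f $$ i else 0)"
      unfolding h_def fls_nth_sum by (intro sum.cong) (auto simp: X_intpow_nth)
    then show ?thesis by simp
  qed
  ultimately show ?thesis using that by (metis ImageI atLeastAtMost_iff singletonI)
qed

lemma R_circ_support:
  fixes f :: "'a::field fls"
  assumes circ: "R_rel r `` {f} \<in> R_circ r" and r: "r > 0" and d: "d dvd r"
    and supp: "\<And>i. i \<le> 0 \<Longrightarrow> f $$ i \<noteq> 0 \<Longrightarrow> int d dvd i"
  shows "d = 1"
proof (rule ccontr)
  assume d1: "d \<noteq> 1"
  obtain k where k: "r = d * k" using d by (elim dvdE)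
  then have "d > 1" "k > 0" using d1 r by (auto simp: neq0_conv[symmetric] simp del: neq0_conv)
  then have "0 < r div d" "r div d < r" unfolding k by simp_all
  moreover obtain h where h: "h \<in> R_rel r `` {f}" "\<And>i. h $$ i \<noteq> 0 \<Longrightarrow> i \<le> 0 \<and> f $$ i \<noteq> 0"
    using truncation_in_class[of r f] by blast
  moreover have "in_ramified r (r div d) h"
    using in_ramified_of_support[OF r d, of h] supp h(2) by blast
  ultimately show False using circ unfolding R_circ_def by blast
qed

theorem theorem10p3:
  fixes x a :: "'a::{alg_closed_field, field_char_0}"
    and f :: "'a fls"
    and r s :: nat
  assumes "x \<noteq> 0"
    and "r > 0"
    and "a \<noteq> 0"
    and "R_rel r `` {f} \<in> R_circ r"
    and "little_o (- int s) (f - fls_const a * fls_X_intpow (- int s))"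
    and "\<not> has_horizontal_section (conn_E r f)"
  shows "\<exists>C \<in> S_circ (r + s).
           (\<exists>g. solves_system x r s f g) \<and>
           (\<forall>g. solves_system x r s f g \<longrightarrow>
              g \<in> C \<and> difference_iso (local_mellin x (conn_E r f)) (diff_D (r + s) g))"
proof -
  define n where "n = r + s"
  have f_nth: "f $$ i = (if i = - int s then a else 0)" if "i \<le> - int s" for i
    using assms(5) that by (auto simp: little_o_iff_ord_ge ord_ge_def)
  have f_sub: "fls_subdegree f = - int s"
    using f_nth assms(3) by (intro fls_subdegree_eqI) auto
  have f_nz: "f \<noteq> 0" using f_nth[of "- int s"] assms(3) by auto
  interpret mellin_system x f r s n
    by unfold_locales (use assms f_sub f_nz in \<open>auto simp: n_def\<close>)
  have s0: "r = 1" if "s = 0"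
  proof (rule R_circ_support[OF assms(4,2)])
    show "int r dvd i" if "i \<le> 0" "f $$ i \<noteq> 0" for i
      using f_nth[of i] that \<open>s = 0\<close> by (auto split: if_splits)
  qed simp
  have iso: "difference_iso (local_mellin x (conn_E r f)) (diff_D n (g_of w))" if w: "solution w" for w
    unfolding g_of_def
    by (rule local_mellin_isomorphism[OF assms(1,2) n s0 _ solution_order[OF w] _ assms(6)])
      (use w in \<open>auto simp: solution_def\<close>)
  obtain w where w: "solution w" using solution_exists by blast
  define C where "C = S_rel n `` {g_of w}"
  have "C \<in> S_circ n"
    unfolding S_circ_def
  proof (intro CollectI conjI allI impI notI)
    show "C \<in> S_set n"
      unfolding S_set_def C_def using g_of_nz[OF w] by (intro quotientI) simp
    fix p assume p: "0 < p \<and> p < n" and "\<exists>h\<in>C. in_ramified n p h"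
    then obtain h where h: "(g_of w, h) \<in> S_rel n" "in_ramified n p h" unfolding C_def by blast
    obtain \<eta> and m :: int where h_nz: "h \<noteq> 0" and \<eta>: "\<eta> ^ n = 1"
      and close: "little_o (int n) (galois_act \<eta> (g_of w) / h - 1 - fls_const (of_int m / of_nat n) * fls_X ^ n)"
      using h(1) unfolding S_rel_def by blast
    define w' where "w' = w oo (fps_const \<eta> * fps_X)"
    have w': "solution w'" unfolding w'_def by (rule solution_galois[OF w \<eta>])
    have g': "galois_act \<eta> (g_of w) = g_of w'"
      unfolding w'_def by (rule galois_g_of[OF \<eta>])
    obtain d where d: "prime d" "d dvd n" "\<And>i. h $$ i \<noteq> 0 \<Longrightarrow> int d dvd i"
      using ramified_support[OF h(2)] p by blast
    \<comment> \<open>Representatives of one class differ, up to the Galois action, only from order \<open>n\<close> on.\<close>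
    have "g_of w' $$ i = h $$ i" if i: "i < int n" for i
    proof -
      define U where "U = g_of w' / h"
      have U: "little_o (int n) (U - 1 - fls_const (of_int m / of_nat n) * fls_X ^ n)"
        using close unfolding g' U_def .
      have U_nz: "U \<noteq> 0" by (rule unit_class_unit(1)[OF n_pos U])
      have "h = g_of w' * inverse U" using U_nz h_nz by (simp add: U_def field_simps)
      moreover have "ord_ge 0 (inverse U)"
        using unit_class_unit(3)[OF n_pos U] by (simp add: little_o_iff_ord_ge)
      ultimately have h_ord: "ord_ge 0 h" using ord_ge_mult[OF g_of_ord] by fastforce
      have "ord_ge (int n) (U - 1)"
        using U by (auto simp: little_o_iff_ord_ge ord_ge_def)
      then have "ord_ge (0 + int n) (h * (U - 1))" by (rule ord_ge_mult[OF h_ord])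
      moreover have "h * (U - 1) = g_of w' - h" using h_nz by (simp add: U_def algebra_simps)
      ultimately show ?thesis using i by (simp add: ord_ge_def)
    qed
    then have "int d dvd i" if "i < int n" "g_of w' $$ i \<noteq> 0" for i
      using d(3) that by simp
    note desc = ramification_descends[OF w' d(1,2) this]
    have "d = 1" by (rule R_circ_support[OF assms(4,2) desc])
    then show False using d(1) by simp
  qed
  moreover have "g \<in> C \<and> difference_iso (local_mellin x (conn_E r f)) (diff_D n g)"
    if g: "solves_system x r s f g" for g
  proof -
    obtain w' where "solution w'" "g = g_of w'" using g solves_system_iff by blast
    then show ?thesis using iso solutions_related[OF w] by (auto simp: C_def)
  qed
  moreover have "\<exists>g. solves_system x r s f g" using w solves_system_iff by blast
  ultimately show ?thesis unfolding n_def[symmetric] by blast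
qed

end
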